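(* Let $\gamma\colon J\subset \mathbb{R}\to \mathbb{H}^2$ be a unit-speed curve and let $\gamma_s \colon J\to \mathbb{H}^2\subset \mathbb{R}_1^3$ be the family of its parallel curves, that is, $$\gamma_s(t)=\cosh(s)\gamma(t)+\sinh(s)\gamma(t)\wedge \gamma'(t).$$ Define $F\colon J\times I\to \mathbb{H}^{2}\times \mathbb{R}\subset \mathbb{R}_1^4$ by $$ F(t,s)=\gamma_s(t)+a(s)\frac{\partial}{\partial t}, $$ where $I\subset \mathbb{R}$ is an open interval and $a\in C^{\infty}(I)$ has positive derivative. Then, on the subset $M^2\subset J\times I$ of its regular points, the map $f=\Phi\circ F\colon M^2\to \mathbb{R}^3\setminus \mathbb{R}$ defines a Joachimsthal surface. Conversely, any Joachimsthal surface in $\mathbb{R}^3$ can be parametrized in this way.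
   Context: $\mathbb{H}^2\subset\mathbb{R}^3_1$ is the hyperbolic plane in Lorentzian space, $\wedge$ is the Lorentzian cross product (so $\gamma\wedge\gamma'$ is a unit normal field to $\gamma$ in $\mathbb{H}^2$), and $\partial/\partial t$ in the formula for $F$ is the unit vector tangent to the factor $\mathbb{R}$ of $\mathbb{H}^2\times\mathbb{R}$, so $F(t,s)=(\gamma_s(t),a(s))$. $\Phi\colon\mathbb{H}^2\times\mathbb{R}\to\mathbb{R}^3\setminus\mathbb{R}$ is the conformal covering map $\Phi(x_0e_0+x_1e_1+x_2e_2,t)=\frac1{x_0}(x_1,\cos t,\sin t)$, where $e_0,e_1,e_2$ is a basis of $\mathbb{R}^3_1$ with $\langle e_0,e_0\rangle=0=\langle e_2,e_2\rangle$, $\langle e_0,e_2\rangle=-1/2$, $\langle e_1,e_1\rangle=1$, $\langle e_1,e_0\rangle=\langle e_1,e_2\rangle=0$, and $\mathbb{R}=\{y\in\mathbb{R}^3: y_2=y_3=0\}$. A Joachimsthal surface is a surface in $\mathbb{R}^3$ whose lines of curvature correspondent to one of the principal curvatures are contained in planes that intersect along a common line, whereas the lines of curvature correspondent to the other principal curvature lie on spheres centered on that line. In the converse, Euclidean coordinates of $\mathbb{R}^3$ are chosen so that the common line is $\{y_2=y_3=0\}$.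
   Formalization: Planes orthogonal to the common line count as spheres (a horocycle γ can give a cylinder); the converse is local, at points off the line where the tangent plane is neither equal nor orthogonal to the plane through the line and the point (surfaces of revolution fail otherwise). *)

theory Defs
  imports "HOL-Analysis.Analysis"
begin

section \<open>Smooth maps\<close>

text \<open>The domain \<open>S\<close> is always an open set below. The directional derivatives along all
  vectors determine the full iterated derivatives because the domain is finite-dimensional.\<close>

primrec Ck_on :: "nat \<Rightarrow> 'a::euclidean_space set \<Rightarrow> ('a \<Rightarrow> 'b::real_normed_vector) \<Rightarrow> bool" where
  "Ck_on 0 S f \<longleftrightarrow> continuous_on S f"
| "Ck_on (Suc k) S f \<longleftrightarrow> (\<forall>x\<in>S. f differentiable (at x)) \<and>
     (\<forall>v. Ck_on k S (\<lambda>x. frechet_derivative f (at x) v))"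

definition smooth_on :: "'a::euclidean_space set \<Rightarrow> ('a \<Rightarrow> 'b::real_normed_vector) \<Rightarrow> bool" where
  "smooth_on S f \<longleftrightarrow> (\<forall>k. Ck_on k S f)"

definition diffeomorphism_on ::
    "'a::euclidean_space set \<Rightarrow> 'b::euclidean_space set \<Rightarrow> ('a \<Rightarrow> 'b) \<Rightarrow> bool" where
  "diffeomorphism_on V U \<psi> \<longleftrightarrow> open V \<and> open U \<and> bij_betw \<psi> V U \<and>
     smooth_on V \<psi> \<and> smooth_on U (inv_into V \<psi>)"

section \<open>The hyperbolic plane in Lorentzian space\<close>

definition lorentz :: "real^3 \<Rightarrow> real^3 \<Rightarrow> real" where
  "lorentz x y = - x$1 * y$1 + x$2 * y$2 + x$3 * y$3"

definition lorentz_cross :: "real^3 \<Rightarrow> real^3 \<Rightarrow> real^3" where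
  "lorentz_cross u v = (let c = cross3 u v in vector [- c$1, c$2, c$3])"

lemma lorentz_lorentz_cross: "lorentz (lorentz_cross u v) w = det (vector [u, v, w])"
  by (simp add: lorentz_def lorentz_cross_def cross3_def Let_def det_3 algebra_simps)

definition hyperbolic_plane :: "(real^3) set" where
  "hyperbolic_plane = {x. lorentz x x = - 1 \<and> x$1 > 0}"

text \<open>These relations already force the three vectors to be a basis.\<close>

definition pseudo_orthonormal :: "real^3 \<Rightarrow> real^3 \<Rightarrow> real^3 \<Rightarrow> bool" where
  "pseudo_orthonormal e0 e1 e2 \<longleftrightarrow>
     lorentz e0 e0 = 0 \<and> lorentz e2 e2 = 0 \<and> lorentz e0 e2 = - 1/2 \<and>
     lorentz e1 e1 = 1 \<and> lorentz e1 e0 = 0 \<and> lorentz e1 e2 = 0"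

section \<open>The conformal covering of the complement of the axis\<close>

definition Phi :: "real^3 \<Rightarrow> real^3 \<Rightarrow> real^3 \<Rightarrow> (real^3) \<times> real \<Rightarrow> real^3" where
  "Phi e0 e1 e2 = (\<lambda>(x, t). THE y. \<exists>x0 x1 x2.
     x = x0 *\<^sub>R e0 + x1 *\<^sub>R e1 + x2 *\<^sub>R e2 \<and>
     y = (1 / x0) *\<^sub>R vector [x1, cos t, sin t])"

lemma lorentz_comb:
  "lorentz (a *\<^sub>R u + b *\<^sub>R v + c *\<^sub>R w) z = a * lorentz u z + b * lorentz v z + c * lorentz w z"
  by (simp add: lorentz_def algebra_simps)

lemma lorentz_sym: "lorentz x y = lorentz y x"
  by (simp add: lorentz_def)

lemma Phi_eq:
  assumes "pseudo_orthonormal e0 e1 e2"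
  shows "Phi e0 e1 e2 (x0 *\<^sub>R e0 + x1 *\<^sub>R e1 + x2 *\<^sub>R e2, t)
         = (1 / x0) *\<^sub>R vector [x1, cos t, sin t]"
proof -
  have coord: "lorentz (a *\<^sub>R e0 + b *\<^sub>R e1 + c *\<^sub>R e2) e2 = - a / 2"
    "lorentz (a *\<^sub>R e0 + b *\<^sub>R e1 + c *\<^sub>R e2) e1 = b" for a b c
    using assms lorentz_sym[of e0 e1] lorentz_sym[of e2 e1]
    by (simp_all add: lorentz_comb pseudo_orthonormal_def)
  have "a = x0 \<and> b = x1"
    if "x0 *\<^sub>R e0 + x1 *\<^sub>R e1 + x2 *\<^sub>R e2 = a *\<^sub>R e0 + b *\<^sub>R e1 + c *\<^sub>R e2" for a b c
    using coord[of a b c] coord[of x0 x1 x2] that by simp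
  then show ?thesis
    unfolding Phi_def by (auto intro!: the_equality)
qed

definition axis_line :: "(real^3) set" where
  "axis_line = {y. y$2 = 0 \<and> y$3 = 0}"

section \<open>The surfaces generated by parallel curves\<close>

definition parallel_curve :: "(real \<Rightarrow> real^3) \<Rightarrow> real \<Rightarrow> real \<Rightarrow> real^3" where
  "parallel_curve \<gamma> s t =
     cosh s *\<^sub>R \<gamma> t + sinh s *\<^sub>R lorentz_cross (\<gamma> t) (vector_derivative \<gamma> (at t))"

definition lift_map :: "(real \<Rightarrow> real^3) \<Rightarrow> (real \<Rightarrow> real) \<Rightarrow> real \<times> real \<Rightarrow> (real^3) \<times> real" where
  "lift_map \<gamma> a = (\<lambda>(t, s). (parallel_curve \<gamma> s t, a s))"

definition open_interval :: "real set \<Rightarrow> bool" where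
  "open_interval K \<longleftrightarrow> open K \<and> is_interval K \<and> K \<noteq> {}"

definition unit_speed_curve :: "real set \<Rightarrow> (real \<Rightarrow> real^3) \<Rightarrow> bool" where
  "unit_speed_curve J \<gamma> \<longleftrightarrow> open_interval J \<and> smooth_on J \<gamma> \<and> \<gamma> ` J \<subseteq> hyperbolic_plane \<and>
     (\<forall>t\<in>J. lorentz (vector_derivative \<gamma> (at t)) (vector_derivative \<gamma> (at t)) = 1)"

definition height_function :: "real set \<Rightarrow> (real \<Rightarrow> real) \<Rightarrow> bool" where
  "height_function I a \<longleftrightarrow> open_interval I \<and> smooth_on I a \<and> (\<forall>s\<in>I. deriv a s > 0)"

definition regular_points :: "'a::euclidean_space set \<Rightarrow> ('a \<Rightarrow> 'b::euclidean_space) \<Rightarrow> 'a set" where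
  "regular_points S F = {q\<in>S. F differentiable (at q) \<and> inj (frechet_derivative F (at q))}"

section \<open>Immersed surfaces and their principal directions\<close>

definition immersed_surface :: "(real \<times> real) set \<Rightarrow> (real \<times> real \<Rightarrow> real^3) \<Rightarrow> bool" where
  "immersed_surface M f \<longleftrightarrow> open M \<and> smooth_on M f \<and> (\<forall>p\<in>M. inj (frechet_derivative f (at p)))"

definition gauss_map :: "(real \<times> real \<Rightarrow> real^3) \<Rightarrow> real \<times> real \<Rightarrow> real^3" where
  "gauss_map f p =
     sgn (cross3 (frechet_derivative f (at p) (1, 0)) (frechet_derivative f (at p) (0, 1)))"

text \<open>The shape operator \<open>A\<close> is given by \<open>df (A v) = - dN v\<close>, so \<open>A v = \<kappa> v\<close> reads as follows.\<close>

definition principal_direction ::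
    "(real \<times> real \<Rightarrow> real^3) \<Rightarrow> real \<times> real \<Rightarrow> real \<Rightarrow> real \<times> real \<Rightarrow> bool" where
  "principal_direction f p \<kappa> v \<longleftrightarrow> v \<noteq> 0 \<and>
     frechet_derivative (gauss_map f) (at p) v = - (\<kappa> *\<^sub>R frechet_derivative f (at p) v)"

definition smooth_line_field ::
    "(real \<times> real) set \<Rightarrow> (real \<times> real \<Rightarrow> (real \<times> real) set) \<Rightarrow> bool" where
  "smooth_line_field M D \<longleftrightarrow> (\<forall>p\<in>M. \<exists>U X. open U \<and> p \<in> U \<and> U \<subseteq> M \<and> smooth_on U X \<and>
     (\<forall>q\<in>U. X q \<noteq> 0 \<and> D q = span {X q}))"

text \<open>Two orthogonal line fields that diagonalise the shape operator. Away from umbilics they are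
  the two eigenline fields; at umbilics, where every direction is principal, the choice of the
  fields says which curves count as lines of curvature of which family.\<close>

definition principal_line_fields ::
    "(real \<times> real) set \<Rightarrow> (real \<times> real \<Rightarrow> real^3) \<Rightarrow> (real \<times> real \<Rightarrow> real) \<Rightarrow> (real \<times> real \<Rightarrow> real)
     \<Rightarrow> (real \<times> real \<Rightarrow> (real \<times> real) set) \<Rightarrow> (real \<times> real \<Rightarrow> (real \<times> real) set) \<Rightarrow> bool" where
  "principal_line_fields M f \<kappa>1 \<kappa>2 D1 D2 \<longleftrightarrow>
     smooth_line_field M D1 \<and> smooth_line_field M D2 \<and>
     (\<forall>p\<in>M. (\<forall>v\<in>D1 p - {0}. principal_direction f p (\<kappa>1 p) v) \<and>
            (\<forall>w\<in>D2 p - {0}. principal_direction f p (\<kappa>2 p) w) \<and>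
            (\<forall>v\<in>D1 p. \<forall>w\<in>D2 p.
               frechet_derivative f (at p) v \<bullet> frechet_derivative f (at p) w = 0))"

definition integral_curve ::
    "(real \<times> real) set \<Rightarrow> (real \<times> real \<Rightarrow> (real \<times> real) set) \<Rightarrow> real set \<Rightarrow> (real \<Rightarrow> real \<times> real) \<Rightarrow> bool" where
  "integral_curve M D K c \<longleftrightarrow> open_interval K \<and> c ` K \<subseteq> M \<and>
     (\<forall>\<tau>\<in>K. c differentiable (at \<tau>) \<and> vector_derivative c (at \<tau>) \<in> D (c \<tau>) - {0})"

section \<open>Joachimsthal surfaces\<close>

definition line_set :: "(real^3) set \<Rightarrow> bool" where
  "line_set L \<longleftrightarrow> affine L \<and> aff_dim L = 1"

definition plane_set :: "(real^3) set \<Rightarrow> bool" where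
  "plane_set P \<longleftrightarrow> affine P \<and> aff_dim P = 2"

text \<open>The limiting case of a centre at infinity, a plane orthogonal to \<open>L\<close>, counts as a sphere.
  It cannot be avoided: if \<open>\<gamma>\<close> is a horocycle based at the point at infinity of the half-plane
  \<open>Phi e0 e1 e2 ` (hyperbolic_plane \<times> {t})\<close>, the surface obtained is a cylinder with rulings parallel
  to the axis, and the second family of lines of curvature consists of its orthogonal sections.\<close>

definition sphere_centered_on :: "(real^3) set \<Rightarrow> (real^3) set \<Rightarrow> bool" where
  "sphere_centered_on L \<Sigma> \<longleftrightarrow> (\<exists>z\<in>L. \<exists>r>0. \<Sigma> = sphere z r) \<or>
     (plane_set \<Sigma> \<and> (\<forall>x\<in>L. \<forall>y\<in>L. \<forall>u\<in>\<Sigma>. \<forall>v\<in>\<Sigma>. (x - y) \<bullet> (u - v) = 0))"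

definition joachimsthal_surface ::
    "(real^3) set \<Rightarrow> (real \<times> real) set \<Rightarrow> (real \<times> real \<Rightarrow> real^3) \<Rightarrow> bool" where
  "joachimsthal_surface L M f \<longleftrightarrow> line_set L \<and> immersed_surface M f \<and>
     (\<exists>\<kappa>1 \<kappa>2 D1 D2. principal_line_fields M f \<kappa>1 \<kappa>2 D1 D2 \<and>
        (\<forall>K c. integral_curve M D1 K c \<longrightarrow> (\<exists>P. plane_set P \<and> L \<subseteq> P \<and> f ` c ` K \<subseteq> P)) \<and>
        (\<forall>K c. integral_curve M D2 K c \<longrightarrow> (\<exists>\<Sigma>. sphere_centered_on L \<Sigma> \<and> f ` c ` K \<subseteq> \<Sigma>)))"

text \<open>The tangent plane at \<open>p\<close> is neither equal nor orthogonal to the plane \<open>P\<close> spanned by \<open>L\<close> and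
  \<open>f p\<close>. At an equal or orthogonal tangent plane the parametrization by parallel curves would
  need \<open>a' = 0\<close> or \<open>a' = \<infinity>\<close>, respectively; the latter happens everywhere on a
  surface of revolution about \<open>L\<close>.\<close>

definition oblique_at :: "(real^3) set \<Rightarrow> (real \<times> real \<Rightarrow> real^3) \<Rightarrow> real \<times> real \<Rightarrow> bool" where
  "oblique_at L f p \<longleftrightarrow> f p \<notin> L \<and>
     (let P = affine hull (insert (f p) L); N = gauss_map f p
      in \<not> (\<forall>y\<in>P. (y - f p) \<bullet> N = 0) \<and> f p + N \<notin> P)"

definition euclidean_motion :: "(real^3 \<Rightarrow> real^3) \<Rightarrow> bool" where
  "euclidean_motion R \<longleftrightarrow> (\<forall>x y. dist (R x) (R y) = dist x y)"

end

theory Submission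
  imports Defs
begin

text \<open>
  Write \<open>n = \<gamma> \<wedge> \<gamma>'\<close>. Since \<open>n'\<close> is a multiple of \<open>\<gamma>'\<close>, the curves \<open>s = const\<close> on the surface all
  have velocity proportional to \<open>\<gamma>'(t)\<close>; after applying \<open>Phi\<close> they lie in the half-planes
  \<open>a(s) = const\<close> through the axis. A curve \<open>t = const\<close> lies over the geodesic orthogonal to \<open>\<gamma>'(t)\<close>, and
  \<open>Phi\<close> maps geodesic times \<open>\<real>\<close> into a sphere centred on the axis. These coordinates are orthogonal and
  the mixed second derivative is tangential, so both coordinate directions are principal.

  Conversely, lift the surface locally to \<open>(X, \<theta>)\<close> and let \<open>V1\<close>, \<open>V2\<close> span the two line fields.
  The plane condition says \<open>d\<theta>(V1) = 0\<close>. The sphere condition says that along the second family \<open>X\<close>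
  stays on one geodesic, so its unit normal \<open>\<nu>\<close>, which is the direction of \<open>dX(V1)\<close>, satisfies
  \<open>d\<nu>(V2) = 0\<close>. Hence a component of \<open>\<nu>\<close> together with \<open>\<theta>\<close> gives local coordinates in which \<open>\<nu>\<close>
  depends on the first one only and \<open>X\<close> moves along \<open>\<nu>\<close> in the first one. Distances along the
  geodesics orthogonal to \<open>\<nu>\<close> are then independent of the first coordinate, so they are a function
  of \<open>\<theta>\<close> alone, and the curves \<open>\<theta> = const\<close> are mutually parallel.
\<close>

text \<open>The definition of a Joachimsthal surface constrains whole integral curves, while the
  converse needs pointwise relations between derivatives. Existence of integral curves of smooth
  fields bridges the two: the curve through a point stays in a plane or sphere, and differentiating
  the equation at that point gives the relation. Spheres become geodesics because, on the
  hyperboloid, \<open>lorentz X G = 0\<close> with \<open>G\<close> unit spacelike reads in the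
  coordinates of \<open>Phi\<close> as the equation of a sphere centred on the axis, or of a plane
  orthogonal to it when the \<open>e0\<close> coordinate of \<open>G\<close> vanishes. The two
  halves of \<open>oblique_at\<close> enter separately. A tangent plane different from the plane
  through the axis makes \<theta> vary along \<open>V2\<close>, so \<theta> can serve as a
  coordinate. A tangent plane not orthogonal to that plane makes the derivative of \<open>X\<close>
  along \<open>V2\<close> nonzero, so that the motion of \<open>X\<close> determines the geodesic
  and the signed distance along it is invertible as a function of \<theta>. The sign of the
  resulting derivative is a matter of orientation and is corrected by passing to the opposite of
  \<nu>.\<close>

abbreviation dd :: "('a::euclidean_space \<Rightarrow> 'b::real_normed_vector) \<Rightarrow> 'a \<Rightarrow> 'a \<Rightarrow> 'b" where
  "dd f x v \<equiv> frechet_derivative f (at x) v"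

section \<open>Calculus of smooth maps\<close>

lemma dd_eq: "(f has_derivative f') (at x) \<Longrightarrow> dd f x v = f' v"
  using frechet_derivative_at by metis

lemma dd_cong:
  assumes "f differentiable (at x)" "open S" "x \<in> S" "\<And>y. y \<in> S \<Longrightarrow> f y = g y"
  shows "dd f x = dd g x"
  using frechet_derivative_transform_within_open[OF assms] by simp

section \<open>Closure of C^k maps under linear, bilinear and chain operations\<close>

lemma Ck_on_subset: "Ck_on k S f \<Longrightarrow> T \<subseteq> S \<Longrightarrow> Ck_on k T f"
  by (induction k arbitrary: f) (auto intro: continuous_on_subset)

lemma Ck_on_cong:
  "open S \<Longrightarrow> (\<And>x. x \<in> S \<Longrightarrow> f x = g x) \<Longrightarrow> Ck_on k S f \<Longrightarrow> Ck_on k S g"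
proof (induction k arbitrary: f g)
  case 0
  then show ?case by (auto cong: continuous_on_cong)
next
  case (Suc k)
  have "g differentiable (at x)" if "x \<in> S" for x
    using Suc.prems that has_derivative_transform_within_open[of f _ x UNIV S g]
    unfolding differentiable_def Ck_on.simps by meson
  moreover have "dd f x = dd g x" if "x \<in> S" for x
    using Suc.prems that by (intro dd_cong) auto
  ultimately show ?case
    using Suc.IH[OF Suc.prems(1), of "\<lambda>x. dd f x v" "\<lambda>x. dd g x v" for v] Suc.prems by auto
qed

text \<open>Inductions on the order supply an explicit derivative \<open>f'\<close>. It agrees with
  the chosen \<open>frechet_derivative\<close> only on the open set \<open>S\<close>, hence the
  transfer by \<open>Ck_on_cong\<close>.\<close>

lemma Ck_on_SucI:
  assumes "open S" "\<And>x. x \<in> S \<Longrightarrow> (f has_derivative f' x) (at x)" "\<And>v. Ck_on k S (\<lambda>x. f' x v)"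
  shows "Ck_on (Suc k) S f"
proof -
  have "Ck_on k S (\<lambda>x. dd f x v)" for v
    by (rule Ck_on_cong[OF assms(1) _ assms(3)[of v]]) (simp add: dd_eq[OF assms(2)])
  with assms(2) show ?thesis by (auto simp: differentiable_def)
qed

lemma Ck_on_SucD:
  assumes "Ck_on (Suc k) S f"
  shows "x \<in> S \<Longrightarrow> (f has_derivative dd f x) (at x)" "Ck_on k S (\<lambda>x. dd f x v)"
  using assms by (auto simp: frechet_derivative_works[symmetric])

lemma Ck_on_Suc_imp: "Ck_on (Suc k) S f \<Longrightarrow> Ck_on k S f"
  by (induction k arbitrary: f)
    (auto intro!: differentiable_imp_continuous_on
       simp: differentiable_on_def differentiable_at_withinI)

lemma Ck_on_const: "Ck_on k S (\<lambda>x. c)"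
  by (induction k arbitrary: c) auto

lemma Ck_on_bounded_linear:
  assumes "open S" "bounded_linear h"
  shows "Ck_on k S f \<Longrightarrow> Ck_on k S (\<lambda>x. h (f x))"
proof (induction k arbitrary: f)
  case 0
  then show ?case
    using assms(2) by (simp add: bounded_linear.continuous_on)
next
  case (Suc k)
  show ?case
    by (rule Ck_on_SucI[OF assms(1), where f'="\<lambda>x v. h (dd f x v)"])
      (use Suc Ck_on_SucD[OF Suc.prems] in
        \<open>auto intro: bounded_linear.has_derivative[OF assms(2)]\<close>)
qed

lemma Ck_on_add:
  assumes "open S"
  shows "Ck_on k S f \<Longrightarrow> Ck_on k S g \<Longrightarrow> Ck_on k S (\<lambda>x. f x + g x)"
proof (induction k arbitrary: f g)
  case 0
  then show ?case by (simp add: continuous_on_add)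
next
  case (Suc k)
  show ?case
    by (rule Ck_on_SucI[OF assms(1), where f'="\<lambda>x v. dd f x v + dd g x v"])
      (use Suc Ck_on_SucD[OF Suc.prems(1)] Ck_on_SucD[OF Suc.prems(2)] in
        \<open>auto intro: has_derivative_add\<close>)
qed

lemma Ck_on_sum:
  assumes "open S"
  shows "(\<And>i. i \<in> I \<Longrightarrow> Ck_on k S (f i)) \<Longrightarrow> Ck_on k S (\<lambda>x. \<Sum>i\<in>I. f i x)"
  by (induction I rule: infinite_finite_induct) (auto intro!: Ck_on_const Ck_on_add assms)

lemma Ck_on_bilinear:
  assumes "open S" "bounded_bilinear h"
  shows "Ck_on k S f \<Longrightarrow> Ck_on k S g \<Longrightarrow> Ck_on k S (\<lambda>x. h (f x) (g x))"
proof (induction k arbitrary: f g)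
  case 0
  then show ?case
    using assms(2) by (simp add: bounded_bilinear.continuous_on)
next
  case (Suc k)
  show ?case
    by (rule Ck_on_SucI[OF assms(1), where f'="\<lambda>x v. h (f x) (dd g x v) + h (dd f x v) (g x)"])
      (use Suc.IH Ck_on_SucD[OF Suc.prems(1)] Ck_on_SucD[OF Suc.prems(2)] Suc.prems[THEN Ck_on_Suc_imp] in
        \<open>auto intro!: bounded_bilinear.FDERIV[OF assms(2)] Ck_on_add assms(1)\<close>)
qed

lemma linear_Basis_expansion:
  fixes h :: "'a::euclidean_space \<Rightarrow> 'b::real_vector"
  assumes "linear h"
  shows "h v = (\<Sum>i\<in>Basis. (v \<bullet> i) *\<^sub>R h i)"
proof -
  have "h v = h (\<Sum>i\<in>Basis. (v \<bullet> i) *\<^sub>R i)"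
    by (simp add: euclidean_representation)
  also have "\<dots> = (\<Sum>i\<in>Basis. (v \<bullet> i) *\<^sub>R h i)"
    using assms by (simp add: linear_sum linear_scale)
  finally show ?thesis .
qed

text \<open>The chain rule produces a linear map depending on \<open>x\<close>, applied to a vector
  depending on \<open>x\<close>. Expanding the vector in the basis turns this into a finite sum of
  products, so regularity in each fixed direction \<open>v\<close> suffices.\<close>

lemma Ck_on_linear_family:
  fixes A :: "'a::euclidean_space \<Rightarrow> 'b::euclidean_space \<Rightarrow> 'c::real_normed_vector"
  assumes "open S" "\<And>x. x \<in> S \<Longrightarrow> linear (A x)" "\<And>v. Ck_on k S (\<lambda>x. A x v)" "Ck_on k S w"
  shows "Ck_on k S (\<lambda>x. A x (w x))"
proof (rule Ck_on_cong[OF assms(1)])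
  show "Ck_on k S (\<lambda>x. \<Sum>i\<in>Basis. (w x \<bullet> i) *\<^sub>R A x i)"
    by (intro Ck_on_sum assms(1) Ck_on_bilinear[OF assms(1) bounded_bilinear_scaleR] assms(3)
        Ck_on_bounded_linear[OF assms(1) bounded_linear_inner_left] assms(4))
qed (use linear_Basis_expansion[OF assms(2)] in metis)

lemma Ck_on_compose:
  fixes f :: "'a::euclidean_space \<Rightarrow> 'b::euclidean_space"
    and g :: "'b \<Rightarrow> 'c::real_normed_vector"
  assumes "open S" "open T"
  shows "Ck_on k T g \<Longrightarrow> Ck_on k S f \<Longrightarrow> f ` S \<subseteq> T \<Longrightarrow> Ck_on k S (\<lambda>x. g (f x))"
proof (induction k arbitrary: f g)
  case 0
  then show ?case
    by (auto intro: continuous_on_compose2)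
next
  case (Suc k)
  note f = Ck_on_SucD[OF Suc.prems(2)]
  note g = Ck_on_SucD[OF Suc.prems(1)]
  show ?case
  proof (rule Ck_on_SucI[OF assms(1), where f'="\<lambda>x v. dd g (f x) (dd f x v)"])
    fix x assume "x \<in> S"
    then show "((\<lambda>x. g (f x)) has_derivative (\<lambda>v. dd g (f x) (dd f x v))) (at x)"
      using diff_chain_at[OF f(1) g(1)] Suc.prems(3) by (auto simp: o_def)
  next
    fix v
    show "Ck_on k S (\<lambda>x. dd g (f x) (dd f x v))"
    proof (rule Ck_on_linear_family[OF assms(1)])
      show "linear (dd g (f x))" if "x \<in> S" for x
        using g(1) that Suc.prems(3) by (blast intro: has_derivative_linear)
      show "Ck_on k S (\<lambda>x. dd g (f x) v)" for v
        using Suc.IH[OF g(2) Ck_on_Suc_imp[OF Suc.prems(2)] Suc.prems(3)] .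
    qed (rule f(2))
  qed
qed

section \<open>Smooth maps and smooth elementary functions\<close>

named_theorems smooth_intros

lemma smooth_onI: "(\<And>k. Ck_on k S f) \<Longrightarrow> smooth_on S f"
  by (simp add: smooth_on_def)

lemma smooth_onD: "smooth_on S f \<Longrightarrow> Ck_on k S f"
  by (simp add: smooth_on_def)

lemma smooth_on_subset: "smooth_on S f \<Longrightarrow> T \<subseteq> S \<Longrightarrow> smooth_on T f"
  by (auto simp: smooth_on_def intro: Ck_on_subset)

lemma smooth_on_cong:
  "open S \<Longrightarrow> smooth_on S f \<Longrightarrow> (\<And>x. x \<in> S \<Longrightarrow> f x = g x) \<Longrightarrow> smooth_on S g"
  using Ck_on_cong[of S f g] by (simp add: smooth_on_def)

lemma smooth_on_derivative:
  assumes "smooth_on S f"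
  shows "x \<in> S \<Longrightarrow> (f has_derivative dd f x) (at x)"
  using Ck_on_SucD(1)[OF smooth_onD[OF assms, of "Suc 0"]] .

lemma smooth_on_differentiable: "smooth_on S f \<Longrightarrow> x \<in> S \<Longrightarrow> f differentiable (at x)"
  using smooth_on_derivative differentiableI by blast

lemma smooth_on_linear_dd: "smooth_on S f \<Longrightarrow> x \<in> S \<Longrightarrow> linear (dd f x)"
  using smooth_on_derivative has_derivative_linear by blast

lemma smooth_on_continuous: "smooth_on S f \<Longrightarrow> continuous_on S f"
  using smooth_onD[of S f 0] by simp

lemma smooth_on_dd_const: "smooth_on S f \<Longrightarrow> smooth_on S (\<lambda>x. dd f x v)"
  unfolding smooth_on_def by (metis Ck_on_SucD(2))

lemma smooth_on_linear_family:
  fixes A :: "'a::euclidean_space \<Rightarrow> 'b::euclidean_space \<Rightarrow> 'c::real_normed_vector"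
  assumes "open S" "\<And>x. x \<in> S \<Longrightarrow> linear (A x)" "\<And>v. smooth_on S (\<lambda>x. A x v)" "smooth_on S w"
  shows "smooth_on S (\<lambda>x. A x (w x))"
  using assms by (auto simp: smooth_on_def intro: Ck_on_linear_family)

lemma smooth_on_const [smooth_intros]: "smooth_on S (\<lambda>x. c)"
  by (simp add: smooth_on_def Ck_on_const)

lemma smooth_on_bounded_linear:
  "bounded_linear h \<Longrightarrow> open S \<Longrightarrow> smooth_on S f \<Longrightarrow> smooth_on S (\<lambda>x. h (f x))"
  by (auto simp: smooth_on_def intro: Ck_on_bounded_linear)

lemma smooth_on_bilinear:
  "bounded_bilinear h \<Longrightarrow> open S \<Longrightarrow> smooth_on S f \<Longrightarrow> smooth_on S g \<Longrightarrow> smooth_on S (\<lambda>x. h (f x) (g x))"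
  by (auto simp: smooth_on_def intro: Ck_on_bilinear)

lemma smooth_on_ident [smooth_intros]:
  assumes "open S"
  shows "smooth_on S (\<lambda>x::'a::euclidean_space. x)"
proof (rule smooth_onI)
  show "Ck_on k S (\<lambda>x. x)" for k
    by (cases k) (auto intro!: Ck_on_SucI[OF assms, where f'="\<lambda>x v. v"] Ck_on_const
        simp del: Ck_on.simps(2))
qed

lemma smooth_on_add [smooth_intros]:
  "open S \<Longrightarrow> smooth_on S f \<Longrightarrow> smooth_on S g \<Longrightarrow> smooth_on S (\<lambda>x. f x + g x)"
  by (auto simp: smooth_on_def intro: Ck_on_add)

lemmas smooth_on_fst [smooth_intros] = smooth_on_bounded_linear[OF bounded_linear_fst]
lemmas smooth_on_snd [smooth_intros] = smooth_on_bounded_linear[OF bounded_linear_snd]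
lemmas smooth_on_minus [smooth_intros] =
  smooth_on_bounded_linear[OF bounded_linear_minus[OF bounded_linear_ident]]
lemmas smooth_on_vec_nth [smooth_intros] = smooth_on_bounded_linear[OF bounded_linear_vec_nth]
lemmas smooth_on_mult [smooth_intros] = smooth_on_bilinear[OF bounded_bilinear_mult]
lemmas smooth_on_scaleR [smooth_intros] = smooth_on_bilinear[OF bounded_bilinear_scaleR]
lemmas smooth_on_inner [smooth_intros] = smooth_on_bilinear[OF bounded_bilinear_inner]

lemma smooth_on_diff [smooth_intros]:
  "open S \<Longrightarrow> smooth_on S f \<Longrightarrow> smooth_on S g \<Longrightarrow> smooth_on S (\<lambda>x. f x - g x)"
  using smooth_on_add[OF _ _ smooth_on_minus, of S f g] by simp

lemma smooth_on_power [smooth_intros]: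
  fixes f :: "_ \<Rightarrow> real"
  shows "open S \<Longrightarrow> smooth_on S f \<Longrightarrow> smooth_on S (\<lambda>x. f x ^ n)"
  by (induction n) (auto intro!: smooth_intros)

lemma smooth_on_Pair [smooth_intros]:
  assumes "open S" "smooth_on S f" "smooth_on S g"
  shows "smooth_on S (\<lambda>x. (f x, g x))"
proof -
  have "bounded_linear (\<lambda>x. (x, 0))" "bounded_linear (\<lambda>y. (0, y))"
    by (auto intro!: bounded_linear_Pair bounded_linear_ident bounded_linear_zero)
  from smooth_on_add[OF assms(1) smooth_on_bounded_linear[OF this(1) assms(1,2)]
      smooth_on_bounded_linear[OF this(2) assms(1,3)]]
  show ?thesis by simp
qed

lemma smooth_on_compose:
  fixes f :: "'a::euclidean_space \<Rightarrow> 'b::euclidean_space"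
    and g :: "'b \<Rightarrow> 'c::real_normed_vector"
  shows "smooth_on T g \<Longrightarrow> smooth_on S f \<Longrightarrow> open S \<Longrightarrow> open T \<Longrightarrow> f ` S \<subseteq> T \<Longrightarrow>
    smooth_on S (\<lambda>x. g (f x))"
  by (auto simp: smooth_on_def intro: Ck_on_compose)

lemma smooth_on_dd [smooth_intros]:
  "open S \<Longrightarrow> smooth_on S f \<Longrightarrow> smooth_on S X \<Longrightarrow> smooth_on S (\<lambda>x. dd f x (X x))"
  by (rule smooth_on_linear_family[of S "dd f" X]) (auto intro: smooth_on_dd_const smooth_on_linear_dd)

lemma Ck_on_real_SucI:
  fixes f :: "real \<Rightarrow> 'b::real_normed_vector"
  assumes "open S" "\<And>x. x \<in> S \<Longrightarrow> (f has_vector_derivative f' x) (at x)" "Ck_on k S f'"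
  shows "Ck_on (Suc k) S f"
proof (rule Ck_on_SucI[OF assms(1), where f'="\<lambda>x v. v *\<^sub>R f' x"])
  show "Ck_on k S (\<lambda>x. v *\<^sub>R f' x)" for v
    by (rule Ck_on_bounded_linear[OF assms(1) bounded_linear_scaleR_right assms(3)])
qed (use assms(2) in \<open>auto simp: has_vector_derivative_def\<close>)

lemma smooth_on_antiderivative:
  fixes f :: "real \<Rightarrow> 'b::real_normed_vector"
  assumes "open S" "\<And>x. x \<in> S \<Longrightarrow> (f has_vector_derivative f' x) (at x)" "smooth_on S f'"
  shows "smooth_on S f"
  unfolding smooth_on_def
  using Ck_on_real_SucI[OF assms(1,2) smooth_onD[OF assms(3)]] Ck_on_Suc_imp by blast

text \<open>Each function is, up to sign, the derivative of the other, so one induction on the order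
  has to carry both.\<close>

lemma smooth_on_real_sin_cos:
  shows "smooth_on UNIV (sin :: real \<Rightarrow> real)" "smooth_on UNIV (cos :: real \<Rightarrow> real)"
proof -
  have "Ck_on k UNIV (sin :: real \<Rightarrow> real) \<and> Ck_on k UNIV (cos :: real \<Rightarrow> real)" for k
  proof (induction k)
    case (Suc k)
    have "Ck_on k UNIV (\<lambda>x::real. - sin x)"
      using Ck_on_bounded_linear[OF open_UNIV bounded_linear_minus[OF bounded_linear_ident]] Suc
      by blast
    moreover have "(sin has_vector_derivative cos x) (at x)"
      "(cos has_vector_derivative - sin x) (at x)" for x :: real
      by (auto simp: has_real_derivative_iff_has_vector_derivative[symmetric])
    ultimately show ?case
      using Suc Ck_on_real_SucI[OF open_UNIV, of sin cos k]
        Ck_on_real_SucI[OF open_UNIV, of cos "\<lambda>x. - sin x" k] by blast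
  qed (auto intro: continuous_intros)
  then show "smooth_on UNIV (sin :: real \<Rightarrow> real)" "smooth_on UNIV (cos :: real \<Rightarrow> real)"
    by (auto simp: smooth_on_def)
qed

lemma smooth_on_real_exp: "smooth_on UNIV (exp :: real \<Rightarrow> real)"
proof -
  have "Ck_on k UNIV (exp :: real \<Rightarrow> real)" for k
  proof (induction k)
    case (Suc k)
    moreover have "(exp has_vector_derivative exp x) (at x)" for x :: real
      by (auto simp: has_real_derivative_iff_has_vector_derivative[symmetric])
    ultimately show ?case
      using Ck_on_real_SucI[OF open_UNIV, of exp exp k] by blast
  qed (auto intro: continuous_intros)
  then show ?thesis by (auto simp: smooth_on_def)
qed

lemma smooth_on_real_inverse: "smooth_on (- {0}) (inverse :: real \<Rightarrow> real)"
proof -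
  have "Ck_on k (- {0}) (inverse :: real \<Rightarrow> real)" for k
  proof (induction k)
    case (Suc k)
    have "Ck_on k (- {0::real}) (\<lambda>x. - (inverse x * inverse x))"
      by (intro Ck_on_bounded_linear[OF _ bounded_linear_minus[OF bounded_linear_ident]]
          Ck_on_bilinear[OF _ bounded_bilinear_mult] Suc) auto
    moreover have "(inverse has_vector_derivative - (inverse x * inverse x)) (at x)"
      if "x \<in> - {0}" for x :: real
      using DERIV_inverse[of x UNIV] that
      by (simp add: has_real_derivative_iff_has_vector_derivative[symmetric] power2_eq_square
          del: inverse_mult_distrib)
    ultimately show ?case
      using Ck_on_real_SucI[of "- {0::real}" inverse "\<lambda>x. - (inverse x * inverse x)" k] by auto
  qed (auto intro: continuous_intros)
  then show ?thesis by (auto simp: smooth_on_def)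
qed

lemma smooth_on_sin [smooth_intros]:
    "open S \<Longrightarrow> smooth_on S f \<Longrightarrow> smooth_on S (\<lambda>x. sin (f x :: real))"
  and smooth_on_cos [smooth_intros]:
    "open S \<Longrightarrow> smooth_on S f \<Longrightarrow> smooth_on S (\<lambda>x. cos (f x :: real))"
  and smooth_on_exp [smooth_intros]:
    "open S \<Longrightarrow> smooth_on S f \<Longrightarrow> smooth_on S (\<lambda>x. exp (f x :: real))"
  and smooth_on_inverse [smooth_intros]:
    "open S \<Longrightarrow> smooth_on S f \<Longrightarrow> (\<And>x. x \<in> S \<Longrightarrow> f x \<noteq> 0) \<Longrightarrow> smooth_on S (\<lambda>x. inverse (f x :: real))"
  by (auto intro!: smooth_on_compose[OF smooth_on_real_sin_cos(1)]
      smooth_on_compose[OF smooth_on_real_sin_cos(2)] smooth_on_compose[OF smooth_on_real_exp]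
      smooth_on_compose[OF smooth_on_real_inverse])

lemma smooth_on_divide [smooth_intros]:
  fixes f g :: "_ \<Rightarrow> real"
  shows "open S \<Longrightarrow> smooth_on S f \<Longrightarrow> smooth_on S g \<Longrightarrow> (\<And>x. x \<in> S \<Longrightarrow> g x \<noteq> 0) \<Longrightarrow>
    smooth_on S (\<lambda>x. f x / g x)"
  unfolding divide_inverse by (intro smooth_intros)

lemma smooth_on_cosh [smooth_intros]:
    "open S \<Longrightarrow> smooth_on S f \<Longrightarrow> smooth_on S (\<lambda>x. cosh (f x :: real))"
  and smooth_on_sinh [smooth_intros]:
    "open S \<Longrightarrow> smooth_on S f \<Longrightarrow> smooth_on S (\<lambda>x. sinh (f x :: real))"
  by (auto simp: cosh_def sinh_def intro!: smooth_intros)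

lemma smooth_on_arctan [smooth_intros]:
  assumes "open S" "smooth_on S f"
  shows "smooth_on S (\<lambda>x. arctan (f x))"
proof (rule smooth_on_compose[of UNIV arctan])
  have nz: "1 + x\<^sup>2 \<noteq> 0" for x :: real
    by (smt (verit) zero_le_power2)
  show "smooth_on UNIV arctan"
    by (rule smooth_on_antiderivative[where f'="\<lambda>x. inverse (1 + x\<^sup>2)"])
      (auto intro!: smooth_intros derivative_eq_intros nz
        simp: has_real_derivative_iff_has_vector_derivative[symmetric])
qed (use assms in auto)

lemma smooth_on_sqrt [smooth_intros]:
  assumes "open S" "smooth_on S f" "\<And>x. x \<in> S \<Longrightarrow> f x > 0"
  shows "smooth_on S (\<lambda>x. sqrt (f x))"
proof (rule smooth_on_compose[of "{0<..}" sqrt])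
  have "Ck_on k {0<..} sqrt" for k
  proof (induction k)
    case (Suc k)
    \<comment> \<open>The derivative \<open>1 / (2 * sqrt x)\<close> is rewritten with
      \<open>sqrt x\<close> in the numerator, so that the induction hypothesis on
      \<open>sqrt\<close> itself applies.\<close>
    have "Ck_on k {0<..} (\<lambda>x. inverse x * ((1 / 2) * sqrt x))"
      by (intro Ck_on_bilinear[OF _ bounded_bilinear_mult] Suc Ck_on_const
          Ck_on_subset[OF smooth_onD[OF smooth_on_real_inverse]]) auto
    moreover have "(sqrt has_vector_derivative inverse x * ((1 / 2) * sqrt x)) (at x)" if "x > 0" for x
      using that by (auto intro!: derivative_eq_intros
          simp: has_real_derivative_iff_has_vector_derivative[symmetric] field_simps)
    ultimately show ?case
      by (intro Ck_on_real_SucI[where f'="\<lambda>x. inverse x * ((1 / 2) * sqrt x)"]) auto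
  qed (auto intro: continuous_intros)
  then show "smooth_on {0<..} sqrt" by (auto simp: smooth_on_def)
qed (use assms in auto)

lemma vector_3_expansion:
  "(vector [a, b, c] :: real^3) = a *\<^sub>R axis 1 1 + b *\<^sub>R axis 2 1 + c *\<^sub>R axis 3 1"
  by (simp add: vec_eq_iff forall_3 axis_def)

lemma smooth_on_vector_3 [smooth_intros]:
  "open S \<Longrightarrow> smooth_on S a \<Longrightarrow> smooth_on S b \<Longrightarrow> smooth_on S c \<Longrightarrow>
    smooth_on S (\<lambda>x. vector [a x, b x, c x] :: real^3)"
  unfolding vector_3_expansion by (intro smooth_intros)

lemma smooth_on_lorentz [smooth_intros]:
  "open S \<Longrightarrow> smooth_on S f \<Longrightarrow> smooth_on S g \<Longrightarrow> smooth_on S (\<lambda>x. lorentz (f x) (g x))"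
  unfolding lorentz_def by (intro smooth_intros)

lemma smooth_on_lorentz_cross [smooth_intros]:
  "open S \<Longrightarrow> smooth_on S f \<Longrightarrow> smooth_on S g \<Longrightarrow> smooth_on S (\<lambda>x. lorentz_cross (f x) (g x))"
  unfolding lorentz_cross_def Let_def cross3_def vector_3 by (intro smooth_intros)

lemma dd_compose:
  assumes "g differentiable (at (f x))" "f differentiable (at x)"
  shows "dd (\<lambda>x. g (f x)) x v = dd g (f x) (dd f x v)"
  using frechet_derivative_compose[of f x g] assms by (auto simp: o_def)

lemma vector_derivative_eq_dd: "f differentiable (at x) \<Longrightarrow> vector_derivative f (at x) = dd f x 1"
  using frechet_derivative_eq_vector_derivative[of f x] by auto

section \<open>Diffeomorphisms and the inverse function theorem\<close>

lemma diffeomorphism_onI: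
  assumes "open V" "open U" "smooth_on V \<psi>" "smooth_on U g" "\<psi> ` V \<subseteq> U" "g ` U \<subseteq> V"
    "\<And>x. x \<in> V \<Longrightarrow> g (\<psi> x) = x" "\<And>y. y \<in> U \<Longrightarrow> \<psi> (g y) = y"
  shows "diffeomorphism_on V U \<psi>"
proof -
  have bij: "bij_betw \<psi> V U"
    by (rule bij_betw_byWitness[where f'=g]) (use assms in auto)
  have "inv_into V \<psi> y = g y" if "y \<in> U" for y
    using bij assms(4-8) that by (metis bij_betw_imp_inj_on image_subset_iff inv_into_f_eq)
  then have "smooth_on U (inv_into V \<psi>)"
    using smooth_on_cong[OF assms(2,4)] by simp
  with bij assms show ?thesis
    by (simp add: diffeomorphism_on_def)
qed

lemma diffeomorphism_onE:
  assumes "diffeomorphism_on V U \<psi>"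
  obtains g where "open V" "open U" "smooth_on V \<psi>" "smooth_on U g" "\<psi> ` V = U" "g ` U = V"
    "\<And>x. x \<in> V \<Longrightarrow> g (\<psi> x) = x" "\<And>y. y \<in> U \<Longrightarrow> \<psi> (g y) = y"
proof (rule that[of "inv_into V \<psi>"])
  have bij: "bij_betw \<psi> V U"
    using assms by (simp add: diffeomorphism_on_def)
  show "\<psi> ` V = U" "inv_into V \<psi> ` U = V"
    using bij bij_betw_inv_into[OF bij] by (auto simp: bij_betw_def)
  show "inv_into V \<psi> (\<psi> x) = x" if "x \<in> V" for x
    using bij that by (meson bij_betw_inv_into_left)
  show "\<psi> (inv_into V \<psi> y) = y" if "y \<in> U" for y
    using bij that by (meson bij_betw_inv_into_right)
qed (use assms in \<open>auto simp: diffeomorphism_on_def\<close>)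

lemma diffeomorphism_on_restrict:
  assumes "diffeomorphism_on V U \<psi>" "open V'" "V' \<subseteq> V"
  shows "diffeomorphism_on V' (\<psi> ` V') \<psi>"
proof -
  obtain g where g: "open V" "open U" "smooth_on V \<psi>" "smooth_on U g" "\<psi> ` V = U" "g ` U = V"
    "\<And>x. x \<in> V \<Longrightarrow> g (\<psi> x) = x" "\<And>y. y \<in> U \<Longrightarrow> \<psi> (g y) = y"
    using diffeomorphism_onE[OF assms(1)] by metis
  have "\<psi> ` V' = U \<inter> g -` V'"
    using g assms(3) by (auto simp: image_iff)
  then have "open (\<psi> ` V')"
    using continuous_open_preimage[OF smooth_on_continuous[OF g(4)] g(2) assms(2)] by simp
  then show ?thesis
    using g assms(2,3) smooth_on_subset[OF g(3) assms(3)]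
      smooth_on_subset[OF g(4), of "\<psi> ` V'"] image_mono[OF assms(3), of \<psi>]
    by (intro diffeomorphism_onI[where g=g]) auto
qed

text \<open>Bootstrapping: the derivative of an inverse map is a smooth function \<open>H v\<close>
  of the inverse map itself, so if \<open>g\<close> is C^k then so is its derivative, and
  \<open>g\<close> gains one order.\<close>

lemma smooth_on_inverse_map:
  fixes g :: "'a::euclidean_space \<Rightarrow> 'b::euclidean_space"
  assumes "open V" "open S" "\<And>y. y \<in> V \<Longrightarrow> (g has_derivative G y) (at y)" "g ` V \<subseteq> S"
    and H: "\<And>v. smooth_on S (H v)" "\<And>y v. y \<in> V \<Longrightarrow> G y v = H v (g y)"
  shows "smooth_on V g"
proof (rule smooth_onI)
  fix k show "Ck_on k V g"
  proof (induction k)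
    case 0
    show ?case
      using assms(1,3) by (auto intro!: continuous_at_imp_continuous_on dest: has_derivative_continuous)
  next
    case (Suc k)
    have *: "Ck_on k V (\<lambda>y. G y v)" for v
      by (rule Ck_on_cong[OF assms(1) _ Ck_on_compose[OF assms(1,2) smooth_onD[OF H(1)] Suc assms(4), of v]])
        (simp add: H(2))
    show ?case
      by (rule Ck_on_SucI[OF assms(1,3) *])
  qed
qed

text \<open>\<open>H v y\<close> is the inverse of the derivative at \<open>y\<close>, applied to
  \<open>v\<close>. Passing it in as a smooth family replaces a proof that inversion of linear maps
  is smooth; in dimensions one and two it is an explicit quotient.\<close>

lemma smooth_local_diffeo:
  fixes f :: "'a::euclidean_space \<Rightarrow> 'a"
  assumes "open S" "x \<in> S" "smooth_on S f" and H: "\<And>v. smooth_on S (H v)"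
    "\<And>y v. y \<in> S \<Longrightarrow> dd f y (H v y) = v" "\<And>y v. y \<in> S \<Longrightarrow> H (dd f y v) y = v"
  obtains V where "open V" "x \<in> V" "V \<subseteq> S" "diffeomorphism_on V (f ` V) f"
proof -
  have bl: "bounded_linear (dd f y)" if "y \<in> S" for y
    using smooth_on_derivative[OF assms(3) that] has_derivative_bounded_linear by blast
  have lin: "linear (\<lambda>v. H v x)"
    by (rule right_inverse_linear[of "dd f x"])
      (use smooth_on_linear_dd[OF assms(3,2)] H(2) assms(2) in auto)
  obtain U' V g g' where g: "open U'" "U' \<subseteq> S" "x \<in> U'" "open V" "f x \<in> V" "homeomorphism U' V f g"
    "\<And>y. y \<in> V \<Longrightarrow> (g has_derivative (g' y)) (at y)"
    "\<And>y. y \<in> V \<Longrightarrow> g' y = inv (blinfun_apply (Blinfun (dd f (g y))))"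
  proof (rule inverse_function_theorem[OF assms(1) _ _ assms(2),
        where f'="\<lambda>y. Blinfun (dd f y)" and invf="Blinfun (\<lambda>v. H v x)" and f=f])
    show "(f has_derivative blinfun_apply (Blinfun (dd f y))) (at y)" if "y \<in> S" for y
      using smooth_on_derivative[OF assms(3) that] bl[OF that] by (simp add: bounded_linear_Blinfun_apply)
    show "continuous_on S (\<lambda>y. Blinfun (dd f y))"
    proof (rule continuous_on_blinfun_componentwise)
      fix i :: 'a
      show "continuous_on S (\<lambda>y. blinfun_apply (Blinfun (dd f y)) i)"
        using smooth_on_continuous[OF smooth_on_dd_const[OF assms(3), of i]]
        by (simp add: bl bounded_linear_Blinfun_apply cong: continuous_on_cong)
    qed
    show "Blinfun (\<lambda>v. H v x) o\<^sub>L Blinfun (dd f x) = id_blinfun"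
      using assms(2) H(3) lin bl
      by (intro blinfun_eqI) (simp add: bounded_linear_Blinfun_apply linear_conv_bounded_linear)
  qed metis
  have gU: "g ` V = U'" "f ` U' = V" "\<And>u. u \<in> U' \<Longrightarrow> g (f u) = u" "\<And>y. y \<in> V \<Longrightarrow> f (g y) = y"
    using g(6) by (auto simp: homeomorphism_def)
  have g': "g' y v = H v (g y)" if "y \<in> V" for y v
  proof -
    have gS: "g y \<in> S"
      using that gU(1) g(2) by blast
    have "inj (dd f (g y))"
      using H(3)[OF gS] by (metis injI)
    then show ?thesis
      using g(8)[OF that] bl[OF gS] H(2)[OF gS]
      by (simp add: bounded_linear_Blinfun_apply) (metis inv_f_f)
  qed
  have "smooth_on V g"
    by (rule smooth_on_inverse_map[OF g(4) assms(1) g(7) _ H(1) g']) (use gU(1) g(2) in auto)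
  then have "diffeomorphism_on U' (f ` U') f"
    using g(1,2,4) gU by (intro diffeomorphism_onI[where g=g]) (auto intro: smooth_on_subset[OF assms(3)])
  with g(1-3) show thesis by (intro that)
qed

lemma smooth_local_diffeo_real:
  fixes f :: "real \<Rightarrow> real"
  assumes "open S" "x \<in> S" "smooth_on S f" "dd f x 1 \<noteq> 0"
  obtains V where "open V" "x \<in> V" "V \<subseteq> S" "diffeomorphism_on V (f ` V) f"
proof -
  define S' where "S' = S \<inter> (\<lambda>y. dd f y 1) -` (- {0})"
  have S': "open S'" "S' \<subseteq> S" "x \<in> S'"
    unfolding S'_def using assms
    by (auto intro!: continuous_open_preimage smooth_on_continuous smooth_on_dd_const)
  have f: "smooth_on S' f"
    using smooth_on_subset[OF assms(3) S'(2)] .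
  have lin: "dd f y v = v * dd f y 1" if "y \<in> S'" for y v
    using linear_scale[OF smooth_on_linear_dd[OF f that], of v 1] by simp
  show thesis
  proof (rule smooth_local_diffeo[OF S'(1,3) f, where H="\<lambda>v y. v / dd f y 1"])
    show "smooth_on S' (\<lambda>y. v / dd f y 1)" for v
      by (intro smooth_intros S' f) (auto simp: S'_def)
  next
    fix y v assume y: "y \<in> S'"
    then show "dd f y (v / dd f y 1) = v" "dd f y v / dd f y 1 = v"
      using lin[OF y, of v] lin[OF y, of "v / dd f y 1"] by (auto simp: S'_def)
  qed (use S'(2) that in auto)
qed

lemma dd_pair:
  fixes f :: "real \<times> real \<Rightarrow> 'b::real_normed_vector"
  assumes "f differentiable (at p)"
  shows "dd f p v = fst v *\<^sub>R dd f p (1, 0) + snd v *\<^sub>R dd f p (0, 1)"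
proof -
  have "v = fst v *\<^sub>R (1, 0) + snd v *\<^sub>R (0, 1)"
    by (simp add: prod_eq_iff)
  then have "dd f p v = dd f p (fst v *\<^sub>R (1, 0) + snd v *\<^sub>R (0, 1))"
    by (rule arg_cong)
  also have "\<dots> = fst v *\<^sub>R dd f p (1, 0) + snd v *\<^sub>R dd f p (0, 1)"
    using linear_frechet_derivative[OF assms] by (simp only: linear_add linear_scale)
  finally show ?thesis .
qed

lemma smooth_local_diffeo_real2:
  fixes f :: "real \<times> real \<Rightarrow> real \<times> real"
  assumes "open S" "x \<in> S" "smooth_on S f" "inj (dd f x)"
  obtains V where "open V" "x \<in> V" "V \<subseteq> S" "diffeomorphism_on V (f ` V) f"
proof -
  define a b c d where "a y = fst (dd f y (1, 0))" and "b y = fst (dd f y (0, 1))"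
    and "c y = snd (dd f y (1, 0))" and "d y = snd (dd f y (0, 1))" for y
  define \<Delta> where "\<Delta> y = a y * d y - b y * c y" for y
  have lin: "dd f y v = (fst v * a y + snd v * b y, fst v * c y + snd v * d y)" if "y \<in> S" for y v
    using dd_pair[OF smooth_on_differentiable[OF assms(3) that], of v]
    by (simp add: a_def b_def c_def d_def prod_eq_iff)
  have smooth: "smooth_on S a" "smooth_on S b" "smooth_on S c" "smooth_on S d"
    unfolding a_def b_def c_def d_def by (intro smooth_intros assms)+
  then have \<Delta>: "smooth_on S \<Delta>"
    unfolding \<Delta>_def by (intro smooth_intros assms)
  \<comment> \<open>If the determinant vanished, the vectors \<open>(d x, - c x)\<close> and
    \<open>(b x, - a x)\<close> would lie in the kernel; injectivity then makes all four entries
    zero, which is absurd.\<close>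
  have "\<Delta> x \<noteq> 0"
  proof
    assume "\<Delta> x = 0"
    then have "dd f x (d x, - c x) = dd f x 0" "dd f x (b x, - a x) = dd f x 0"
      using assms(2) by (auto simp: lin \<Delta>_def algebra_simps)
    from this[THEN injD[OF assms(4)]] have "d x = 0" "c x = 0" "b x = 0" "a x = 0"
      by (auto simp: zero_prod_def)
    then have "dd f x (1, 0) = dd f x 0"
      using assms(2) by (simp add: lin)
    then show False
      using assms(4) by (auto simp: zero_prod_def dest!: injD)
  qed
  define S' where "S' = S \<inter> \<Delta> -` (- {0})"
  have S': "open S'" "S' \<subseteq> S" "x \<in> S'"
    unfolding S'_def using assms \<open>\<Delta> x \<noteq> 0\<close> \<Delta>
    by (auto intro!: continuous_open_preimage smooth_on_continuous)
  have nz: "\<Delta> y \<noteq> 0" if "y \<in> S'" for y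
    using that by (simp add: S'_def)
  \<comment> \<open>The inverse of the derivative is given by Cramer's rule.\<close>
  show thesis
  proof (rule smooth_local_diffeo[OF S'(1,3) smooth_on_subset[OF assms(3) S'(2)],
        where H="\<lambda>v y. ((fst v * d y - snd v * b y) / \<Delta> y, (snd v * a y - fst v * c y) / \<Delta> y)"])
    show "smooth_on S' (\<lambda>y. ((fst v * d y - snd v * b y) / \<Delta> y, (snd v * a y - fst v * c y) / \<Delta> y))" for v
      using smooth_on_subset[OF _ S'(2)] smooth \<Delta> by (intro smooth_intros S' nz) auto
  next
    fix y v assume y: "y \<in> S'"
    have "dd f y v = (fst v * a y + snd v * b y, fst v * c y + snd v * d y)" for v
      using lin y S'(2) by blast
    moreover have "(p * d y - q * b y) * a y + (q * a y - p * c y) * b y = p * \<Delta> y"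
      "(p * d y - q * b y) * c y + (q * a y - p * c y) * d y = q * \<Delta> y"
      "(p * a y + q * b y) * d y - (p * c y + q * d y) * b y = p * \<Delta> y"
      "(p * c y + q * d y) * a y - (p * a y + q * b y) * c y = q * \<Delta> y" for p q
      by (simp_all add: \<Delta>_def algebra_simps)
    ultimately show "dd f y ((fst v * d y - snd v * b y) / \<Delta> y, (snd v * a y - fst v * c y) / \<Delta> y) = v"
      "((fst (dd f y v) * d y - snd (dd f y v) * b y) / \<Delta> y,
        (snd (dd f y v) * a y - fst (dd f y v) * c y) / \<Delta> y) = v"
      using nz[OF y] by (simp_all add: prod_eq_iff add_divide_distrib[symmetric])
  qed (use S'(2) that in auto)
qed

section \<open>Integral curves of smooth vector fields\<close>

lemma smooth_on_cball_lipschitz: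
  fixes X :: "'a::euclidean_space \<Rightarrow> 'b::real_normed_vector"
  assumes "smooth_on U X" "cball q r \<subseteq> U"
  obtains L where "L > 0" "\<And>x y. x \<in> cball q r \<Longrightarrow> y \<in> cball q r \<Longrightarrow> norm (X x - X y) \<le> L * norm (x - y)"
proof -
  have "\<exists>K. \<forall>x\<in>cball q r. norm (dd X x i) \<le> K" for i
  proof -
    have "compact ((\<lambda>x. dd X x i) ` cball q r)"
      by (intro compact_continuous_image compact_cball continuous_on_subset[OF
            smooth_on_continuous[OF smooth_on_dd_const[OF assms(1)]] assms(2)])
    then show ?thesis
      by (auto dest!: compact_imp_bounded simp: bounded_iff)
  qed
  then obtain K where K: "\<And>i x. x \<in> cball q r \<Longrightarrow> norm (dd X x i) \<le> K i"
    by metis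
  \<comment> \<open>The sum bounds the operator norm of the derivative on the ball, whose convexity
    turns the bound into a Lipschitz constant by the mean value inequality. The added 1 keeps it
    positive even when the derivative vanishes.\<close>
  define L where "L = (\<Sum>i\<in>Basis. \<bar>K i\<bar>) + 1"
  have sum_pos: "(\<Sum>i\<in>Basis. \<bar>K i\<bar>) \<ge> 0"
    by (simp add: sum_nonneg)
  have bd: "onorm (dd X x) \<le> L" if "x \<in> cball q r" for x
  proof (rule onorm_bound)
    fix v
    have lin: "linear (dd X x)"
      using smooth_on_linear_dd[OF assms(1)] assms(2) that by blast
    have "norm (dd X x v) \<le> (\<Sum>i\<in>Basis. norm ((v \<bullet> i) *\<^sub>R dd X x i))"
      by (subst linear_Basis_expansion[OF lin]) (rule norm_sum)
    also have "\<dots> \<le> (\<Sum>i\<in>Basis. \<bar>K i\<bar> * norm v)"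
    proof (rule sum_mono)
      fix i :: 'a assume i: "i \<in> Basis"
      have "norm (dd X x i) \<le> \<bar>K i\<bar>"
        using K[OF that, of i] by linarith
      then show "norm ((v \<bullet> i) *\<^sub>R dd X x i) \<le> \<bar>K i\<bar> * norm v"
        using Basis_le_norm[OF i, of v] by (simp add: mult.commute mult_mono)
    qed
    also have "\<dots> \<le> L * norm v"
      by (simp add: L_def sum_distrib_right[symmetric] mult_right_mono)
    finally show "norm (dd X x v) \<le> L * norm v" .
  qed (use sum_pos in \<open>unfold L_def, linarith\<close>)
  show thesis
  proof
    show "L > 0"
      using sum_pos unfolding L_def by linarith
    show "norm (X x - X y) \<le> L * norm (x - y)" if "x \<in> cball q r" "y \<in> cball q r" for x y
      by (rule differentiable_bound[where S="cball q r" and f'="dd X"])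
        (use that bd assms(2) in \<open>auto intro!: has_derivative_at_withinI smooth_on_derivative[OF assms(1)]\<close>)
  qed
qed

text \<open>Picard--Lindeloef: the field is first extended from a ball to a bounded globally Lipschitz
  field by composing it with the nearest-point projection, so that the contraction acts on the
  whole space of bounded continuous curves.\<close>

lemma lipschitz_field_integral_curve:
  fixes Y :: "'a::euclidean_space \<Rightarrow> 'a"
  assumes L: "L > 0" "\<And>x y. norm (Y x - Y y) \<le> L * norm (x - y)"
    and B: "B > 0" "\<And>x. norm (Y x) \<le> B"
    and \<delta>: "\<delta> > 0" "4 * \<delta> * L \<le> 1 / 2"
  obtains c where "c 0 = q" "\<And>t. norm (c t - q) \<le> 4 * \<delta> * B"
    "\<And>t. t \<in> {-\<delta><..<\<delta>} \<Longrightarrow> (c has_vector_derivative Y (c t)) (at t)"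
proof -
  have contY: "continuous_on UNIV Y"
    by (rule lipschitz_on_continuous_on[of L]) (use L in \<open>auto simp: lipschitz_on_def dist_norm\<close>)
  \<comment> \<open>Clamping time to \<open>{-\<delta>..\<delta>}\<close> makes every iterate a
    bounded continuous curve on the whole line.\<close>
  define p where "p t = max (-\<delta>) (min \<delta> t)" for t
  have p: "p t \<in> {-\<delta>..\<delta>}" for t
    using \<delta>(1) by (auto simp: p_def)
  \<comment> \<open>Integration starts at \<open>-\<delta>\<close> and the value at 0 is subtracted
    afterwards, so negative times call for no reversed integrals. Each of the two terms is at most
    \<open>2 * \<delta> * B\<close>, whence the factor \<open>4 * \<delta>\<close> in the
    estimates.\<close>
  define P where "P c t = integral {-\<delta>..t} (\<lambda>u. Y (apply_bcontfun c u))" for c t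
  define T where "T c t = q + (P c (p t) - P c 0)" for c t
  have contYc: "continuous_on S (\<lambda>u. Y (apply_bcontfun c u))" for c S
    by (rule continuous_on_compose2[OF contY]) auto
  have int: "(\<lambda>u. Y (apply_bcontfun c u)) integrable_on {-\<delta>..t}" for c t
    by (intro integrable_continuous_real contYc)
  have Pbd: "norm (P c t) \<le> 2 * \<delta> * B" if "t \<in> {-\<delta>..\<delta>}" for c t
  proof -
    have "norm (P c t) \<le> B * (t - (-\<delta>))"
      unfolding P_def using that B by (intro integral_bound contYc) auto
    also have "\<dots> \<le> B * (2 * \<delta>)"
      using that B(1) by (intro mult_left_mono) auto
    finally show ?thesis by (simp add: mult_ac)
  qed
  have Plip: "norm (P c t - P c' t) \<le> 2 * \<delta> * (L * dist c c')" if "t \<in> {-\<delta>..\<delta>}" for c c' t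
  proof -
    have "norm (P c t - P c' t) =
        norm (integral {-\<delta>..t} (\<lambda>u. Y (apply_bcontfun c u) - Y (apply_bcontfun c' u)))"
      unfolding P_def by (subst integral_diff[OF int int]) simp
    also have "\<dots> \<le> L * dist c c' * (t - (-\<delta>))"
    proof (rule integral_bound)
      fix u
      have "norm (Y (apply_bcontfun c u) - Y (apply_bcontfun c' u))
        \<le> L * norm (apply_bcontfun c u - apply_bcontfun c' u)"
        by (rule L(2))
      also have "\<dots> \<le> L * dist c c'"
        using L(1) dist_bounded[of c u c'] by (simp add: dist_norm)
      finally show "norm (Y (apply_bcontfun c u) - Y (apply_bcontfun c' u)) \<le> L * dist c c'" .
    qed (use that in \<open>auto intro!: continuous_intros contYc\<close>)
    also have "\<dots> \<le> L * dist c c' * (2 * \<delta>)"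
      using that L(1) by (intro mult_left_mono) auto
    finally show ?thesis by (simp add: mult_ac)
  qed
  have Tq: "norm (T c t - q) \<le> 4 * \<delta> * B" for c t
    using norm_triangle_ineq4[of "P c (p t)" "P c 0"] Pbd[OF p, of c t] Pbd[of 0 c] \<delta>(1)
    by (simp add: T_def)
  have Pcont: "continuous_on {-\<delta>..\<delta>} (P c)" for c
    unfolding P_def by (intro indefinite_integral_continuous_1 int)
  have "T c \<in> bcontfun" for c
  proof (rule bcontfun_normI)
    have "continuous_on UNIV (\<lambda>t. P c (p t))"
      by (rule continuous_on_compose2[OF Pcont]) (use p in \<open>auto simp: p_def intro!: continuous_intros\<close>)
    then show "continuous_on UNIV (T c)"
      unfolding T_def by (intro continuous_intros)
    show "norm (T c t) \<le> norm q + 4 * \<delta> * B" for t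
      using Tq[of c t] norm_triangle_ineq2[of "T c t" q] by linarith
  qed
  then have TB: "apply_bcontfun (Bcontfun (T c)) = T c" for c
    by (simp add: Bcontfun_inverse)
  have "\<exists>!c. Bcontfun (T c) = c"
  proof (rule banach_fix_type[of "1/2"])
    have "dist (Bcontfun (T c)) (Bcontfun (T c')) \<le> 1/2 * dist c c'" for c c'
    proof (rule dist_bound)
      fix t
      have "norm (T c t - T c' t) = norm ((P c (p t) - P c' (p t)) - (P c 0 - P c' 0))"
        by (simp add: T_def algebra_simps)
      also have "\<dots> \<le> norm (P c (p t) - P c' (p t)) + norm (P c 0 - P c' 0)"
        by (rule norm_triangle_ineq4)
      also have "\<dots> \<le> (4 * \<delta> * L) * dist c c'"
        using Plip[OF p, of c t c'] Plip[of 0 c c'] \<delta>(1) by (simp add: mult_ac)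
      also have "\<dots> \<le> 1/2 * dist c c'"
        by (intro mult_right_mono \<delta>) auto
      finally show "dist (apply_bcontfun (Bcontfun (T c)) t) (apply_bcontfun (Bcontfun (T c')) t)
          \<le> 1/2 * dist c c'"
        by (simp only: TB dist_norm)
    qed
    then show "\<forall>c c'. dist (Bcontfun (T c)) (Bcontfun (T c')) \<le> 1/2 * dist c c'"
      by blast
  qed auto
  then obtain C where "Bcontfun (T C) = C" by blast
  then have C: "apply_bcontfun C = T C"
    using TB by metis
  show thesis
  proof (rule that[of "apply_bcontfun C"])
    show "apply_bcontfun C 0 = q"
      using \<delta>(1) unfolding C by (simp add: T_def p_def)
    show "norm (apply_bcontfun C t - q) \<le> 4 * \<delta> * B" for t
      using Tq by (simp add: C)
    fix t assume t: "t \<in> {-\<delta><..<\<delta>}"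
    have "(P C has_vector_derivative Y (apply_bcontfun C t)) (at t within {-\<delta>..\<delta>})"
      unfolding P_def using integral_has_vector_derivative[OF contYc] t by auto
    then have "(P C has_vector_derivative Y (apply_bcontfun C t)) (at t)"
      using t by (simp add: at_within_Icc_at)
    then have "((\<lambda>t. q + (P C t - P C 0)) has_vector_derivative Y (apply_bcontfun C t)) (at t)"
      by (auto intro!: derivative_eq_intros)
    then show "(apply_bcontfun C has_vector_derivative Y (apply_bcontfun C t)) (at t)"
      by (rule has_vector_derivative_transform_within_open[of _ _ _ "{-\<delta><..<\<delta>}"])
        (use t C in \<open>auto simp: T_def p_def\<close>)
  qed
qed

lemma smooth_field_integral_curve:
  fixes X :: "'a::euclidean_space \<Rightarrow> 'a"
  assumes "open U" "q \<in> U" "smooth_on U X"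
  obtains \<delta> c where "\<delta> > 0" "c 0 = q" "\<And>t. t \<in> {-\<delta><..<\<delta>} \<Longrightarrow> c t \<in> U"
    "\<And>t. t \<in> {-\<delta><..<\<delta>} \<Longrightarrow> (c has_vector_derivative X (c t)) (at t)"
proof -
  obtain r where r: "r > 0" "cball q r \<subseteq> U"
    using assms(1,2) open_contains_cball by blast
  obtain L where L: "L > 0" "\<And>x y. x \<in> cball q r \<Longrightarrow> y \<in> cball q r \<Longrightarrow> norm (X x - X y) \<le> L * norm (x - y)"
    using smooth_on_cball_lipschitz[OF assms(3) r(2)] by metis
  have "compact (X ` cball q r)"
    by (intro compact_continuous_image compact_cball continuous_on_subset[OF
          smooth_on_continuous[OF assms(3)] r(2)])
  then obtain B where B: "B > 0" "\<And>x. x \<in> cball q r \<Longrightarrow> norm (X x) \<le> B"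
    by (auto dest!: compact_imp_bounded simp: bounded_pos)
  define Y where "Y x = X (closest_point (cball q r) x)" for x
  have cp: "closest_point (cball q r) x \<in> cball q r" for x
    using r(1) by (intro closest_point_in_set) auto
  have "norm (Y x - Y y) \<le> L * norm (x - y)" for x y
  proof -
    have "norm (Y x - Y y) \<le> L * dist (closest_point (cball q r) x) (closest_point (cball q r) y)"
      unfolding Y_def dist_norm by (intro L(2) cp)
    also have "\<dots> \<le> L * dist x y"
      using L(1) r(1) by (intro mult_left_mono closest_point_lipschitz) auto
    finally show ?thesis by (simp add: dist_norm)
  qed
  moreover have "norm (Y x) \<le> B" for x
    unfolding Y_def by (intro B cp)
  \<comment> \<open>The first bound makes the integral operator a contraction with constant 1/2; the
    second keeps the curve inside the ball, where \<open>Y\<close> coincides with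
    \<open>X\<close>.\<close>
  moreover define \<delta> where "\<delta> = min (1 / (8 * L)) (r / (4 * B))"
  moreover have "\<delta> > 0" "4 * \<delta> * L \<le> 1 / 2" "4 * \<delta> * B \<le> r"
    using L(1) B(1) r(1) by (auto simp: \<delta>_def min_def field_simps)
  ultimately obtain c where c: "c 0 = q" "\<And>t. norm (c t - q) \<le> 4 * \<delta> * B"
    "\<And>t. t \<in> {-\<delta><..<\<delta>} \<Longrightarrow> (c has_vector_derivative Y (c t)) (at t)"
    using lipschitz_field_integral_curve[of L Y B \<delta> q] L(1) B(1) by metis
  have cb: "c t \<in> cball q r" for t
    using c(2)[of t] \<open>4 * \<delta> * B \<le> r\<close> by (simp add: dist_norm norm_minus_commute)
  show thesis
    by (rule that[of \<delta> c]) (use \<open>\<delta> > 0\<close> c cb r(2) in \<open>auto simp: Y_def closest_point_self\<close>)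
qed

section \<open>Lorentzian geometry\<close>

lemma bounded_bilinear_lorentz: "bounded_bilinear lorentz"
  unfolding bilinear_conv_bounded_bilinear[symmetric] bilinear_def
  by (auto intro!: linearI simp: lorentz_def algebra_simps)

lemma bounded_bilinear_lorentz_cross: "bounded_bilinear lorentz_cross"
  unfolding bilinear_conv_bounded_bilinear[symmetric] bilinear_def
  by (auto intro!: linearI simp: lorentz_cross_def cross3_def vec_eq_iff forall_3 algebra_simps)

lemmas lorentz_simps =
  bounded_bilinear.add_left[OF bounded_bilinear_lorentz]
  bounded_bilinear.add_right[OF bounded_bilinear_lorentz]
  bounded_bilinear.diff_left[OF bounded_bilinear_lorentz]
  bounded_bilinear.diff_right[OF bounded_bilinear_lorentz]
  bounded_bilinear.minus_left[OF bounded_bilinear_lorentz]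
  bounded_bilinear.minus_right[OF bounded_bilinear_lorentz]
  bounded_bilinear.scaleR_left[OF bounded_bilinear_lorentz, unfolded real_scaleR_def]
  bounded_bilinear.scaleR_right[OF bounded_bilinear_lorentz, unfolded real_scaleR_def]
  bounded_bilinear.zero_left[OF bounded_bilinear_lorentz]
  bounded_bilinear.zero_right[OF bounded_bilinear_lorentz]

lemmas lorentz_cross_simps =
  bounded_bilinear.add_left[OF bounded_bilinear_lorentz_cross]
  bounded_bilinear.add_right[OF bounded_bilinear_lorentz_cross]
  bounded_bilinear.scaleR_left[OF bounded_bilinear_lorentz_cross]
  bounded_bilinear.scaleR_right[OF bounded_bilinear_lorentz_cross]
  bounded_bilinear.minus_right[OF bounded_bilinear_lorentz_cross]

lemmas has_derivative_lorentz = bounded_bilinear.FDERIV[OF bounded_bilinear_lorentz]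
lemmas has_vector_derivative_lorentz =
  bounded_bilinear.has_vector_derivative[OF bounded_bilinear_lorentz]

text \<open>The Euclidean triple product identity with its sign reversed.\<close>

lemma lorentz_cross_triple:
  "lorentz_cross (lorentz_cross u v) w = lorentz v w *\<^sub>R u - lorentz u w *\<^sub>R v"
  by (simp add: lorentz_cross_def lorentz_def cross3_def vec_eq_iff forall_3 algebra_simps)

lemma lorentz_cross_self [simp]: "lorentz_cross u u = 0"
  by (simp add: lorentz_cross_def cross3_def vec_eq_iff forall_3 algebra_simps)

lemma lorentz_cross_orthogonal [simp]:
  "lorentz (lorentz_cross u v) u = 0" "lorentz (lorentz_cross u v) v = 0"
  "lorentz u (lorentz_cross u v) = 0" "lorentz v (lorentz_cross u v) = 0"
  by (simp_all add: lorentz_cross_def lorentz_def cross3_def algebra_simps)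

text \<open>Again the Euclidean identity with the opposite sign. Consequently the cross product of a
  unit timelike vector with a unit spacelike vector orthogonal to it is unit spacelike.\<close>

lemma lorentz_cross_lagrange:
  "lorentz (lorentz_cross u v) (lorentz_cross w z)
    = lorentz u z * lorentz v w - lorentz u w * lorentz v z"
  by (simp add: lorentz_cross_def lorentz_def cross3_def algebra_simps)

text \<open>The double product of \<open>z\<close> with the normal \<open>lorentz_cross x v\<close>
  is computed in two ways by the triple product identity; comparing the results expresses
  \<open>z\<close> in the frame. The last term is subtracted because \<open>x\<close> is
  timelike.\<close>

lemma lorentz_frame_expansion:
  assumes "lorentz x x = -1" "lorentz v v = 1" "lorentz x v = 0"
  shows "z = lorentz z v *\<^sub>R v + lorentz z (lorentz_cross x v) *\<^sub>R lorentz_cross x v - lorentz z x *\<^sub>R x"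
proof -
  let ?n = "lorentz_cross x v"
  have n: "lorentz ?n ?n = 1"
    using assms by (simp add: lorentz_cross_lagrange lorentz_sym[of v x])
  have "lorentz_cross ?n (lorentz_cross ?n z) = lorentz_cross ?n (lorentz v z *\<^sub>R x - lorentz x z *\<^sub>R v)"
    by (simp add: lorentz_cross_triple)
  also have "\<dots> = lorentz v z *\<^sub>R v - lorentz x z *\<^sub>R x"
    using assms by (simp add: bounded_bilinear.diff_right[OF bounded_bilinear_lorentz_cross]
        lorentz_cross_simps lorentz_cross_triple lorentz_sym[of v x])
  finally have "lorentz_cross ?n (lorentz_cross ?n z) = lorentz v z *\<^sub>R v - lorentz x z *\<^sub>R x" .
  moreover have "lorentz_cross ?n (lorentz_cross ?n z) = - lorentz_cross (lorentz_cross ?n z) ?n"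
    by (simp add: lorentz_cross_def cross3_def vec_eq_iff forall_3)
  moreover have "- lorentz_cross (lorentz_cross ?n z) ?n = z - lorentz z ?n *\<^sub>R ?n"
    unfolding lorentz_cross_triple[of ?n z ?n] n by simp
  ultimately show ?thesis
    by (simp add: lorentz_sym[of v z] lorentz_sym[of x z] algebra_simps)
qed

text \<open>Cauchy-Schwarz for the two spatial coordinates. Strictness comes from \<open>x\<close>
  being timelike, so \<open>y\<close> may be null, as it is for multiples of
  \<open>e0\<close>.\<close>

lemma lorentz_future_neg:
  assumes "lorentz x x = -1" "x$1 > 0" "lorentz y y \<le> 0" "y$1 > 0"
  shows "lorentz x y < 0"
proof -
  define p q where "p = x$2 * y$2 + x$3 * y$3" and "q = x$1 * y$1"
  have x: "x$2 * x$2 + x$3 * x$3 = x$1 * x$1 - 1" and y: "y$2 * y$2 + y$3 * y$3 \<le> y$1 * y$1"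
    using assms by (simp_all add: lorentz_def)
  have "p\<^sup>2 \<le> (x$2 * x$2 + x$3 * x$3) * (y$2 * y$2 + y$3 * y$3)"
  proof -
    have "(x$2 * x$2 + x$3 * x$3) * (y$2 * y$2 + y$3 * y$3) - p\<^sup>2 = (x$2 * y$3 - x$3 * y$2)\<^sup>2"
      unfolding p_def by algebra
    then show ?thesis
      by (metis zero_le_power2 diff_ge_0_iff_ge)
  qed
  also have "\<dots> \<le> (x$2 * x$2 + x$3 * x$3) * (y$1 * y$1)"
    using y by (intro mult_left_mono) (simp_all add: sum_squares_ge_zero)
  also have "\<dots> < q\<^sup>2"
    using assms(4) by (simp add: x q_def power2_eq_square algebra_simps)
  finally have "p < q"
    using power2_less_imp_less[of p q] assms(2,4) by (simp add: q_def)
  then show ?thesis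
    by (simp add: lorentz_def p_def q_def)
qed

text \<open>The vectors \<open>e0 + e2\<close> and \<open>e0 - e2\<close> are unit timelike and unit
  spacelike, so the frame expansion applies. As the orientation of the basis is not prescribed, the
  frame normal equals \<open>e0 - e2\<close> only up to a sign \<open>c\<close>, which disappears
  because \<open>c * c = 1\<close>.\<close>

lemma pseudo_orthonormal_expansion:
  assumes "pseudo_orthonormal e0 e1 e2"
  shows "x = (- 2 * lorentz x e2) *\<^sub>R e0 + lorentz x e1 *\<^sub>R e1 + (- 2 * lorentz x e0) *\<^sub>R e2"
proof -
  note e = assms[unfolded pseudo_orthonormal_def]
  have e': "lorentz e2 e0 = - 1/2" "lorentz e0 e1 = 0" "lorentz e2 e1 = 0"
    using e by (simp_all add: lorentz_sym)
  define u w where "u = e0 + e2" and "w = e0 - e2"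
  define n where "n = lorentz_cross u e1"
  have u: "lorentz u u = -1" "lorentz e1 e1 = 1" "lorentz u e1 = 0"
    and w: "lorentz w w = 1" "lorentz w u = 0" "lorentz w e1 = 0"
    using e e' by (simp_all add: u_def w_def lorentz_simps)
  note exp = lorentz_frame_expansion[OF u, folded n_def]
  have n: "lorentz n n = 1"
    unfolding n_def lorentz_cross_lagrange using u by (simp add: lorentz_sym[of e1 u])
  define c where "c = lorentz w n"
  have w_n: "w = c *\<^sub>R n"
    using exp[of w] w by (simp add: c_def)
  have "c * c = 1"
    using w(1) n by (simp add: w_n lorentz_simps)
  then have "lorentz x n *\<^sub>R n = lorentz x w *\<^sub>R w"
    by (simp add: w_n lorentz_simps mult.assoc mult.left_commute[of c "lorentz x n" c])
  then have "x = lorentz x e1 *\<^sub>R e1 + lorentz x w *\<^sub>R w - lorentz x u *\<^sub>R u"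
    using exp[of x] by simp
  then show ?thesis
    unfolding u_def w_def lorentz_simps
    by (simp add: vec_eq_iff algebra_simps)
qed

text \<open>Replaces the coordinates in \<open>Phi\<close> by pairings with the null basis, which
  can be differentiated; the factor -2 inverts \<open>lorentz e0 e2\<close>.\<close>

lemma Phi_formula:
  assumes "pseudo_orthonormal e0 e1 e2"
  shows "Phi e0 e1 e2 (x, t) = (1 / (- 2 * lorentz x e2)) *\<^sub>R vector [lorentz x e1, cos t, sin t]"
  using Phi_eq[OF assms] pseudo_orthonormal_expansion[OF assms, of x] by metis

lemma pseudo_orthonormal_lorentz:
  assumes "pseudo_orthonormal e0 e1 e2"
  shows "lorentz x y = lorentz x e1 * lorentz y e1 - 2 * lorentz x e0 * lorentz y e2
    - 2 * lorentz x e2 * lorentz y e0"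
proof -
  have "lorentz x y = lorentz x ((- 2 * lorentz y e2) *\<^sub>R e0 + lorentz y e1 *\<^sub>R e1 + (- 2 * lorentz y e0) *\<^sub>R e2)"
    using pseudo_orthonormal_expansion[OF assms, of y] by simp
  then show ?thesis
    by (simp only: lorentz_simps) (simp add: algebra_simps)
qed

section \<open>Principal directions of orthogonal coordinates\<close>

text \<open>Both factors of \<open>cross3 B (cross3 A B)\<close> are orthogonal to \<open>x\<close>,
  and this product is a positive multiple of \<open>A\<close>.\<close>

lemma parallel_of_orthogonal:
  fixes A B x :: "real^3"
  assumes "A \<noteq> 0" "B \<noteq> 0" "A \<bullet> B = 0" "x \<bullet> B = 0" "x \<bullet> cross3 A B = 0"
  shows "x = (A \<bullet> x / (A \<bullet> A)) *\<^sub>R A"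
proof -
  have "cross3 x (cross3 B (cross3 A B)) = 0"
    unfolding Lagrange[of x] using assms(4,5) by simp
  moreover have "cross3 B (cross3 A B) = (B \<bullet> B) *\<^sub>R A"
    using assms(3) by (simp add: Lagrange inner_commute)
  ultimately have "cross3 x A = 0"
    using assms(2) by (simp add: cross_mult_right)
  then have "cross3 A (cross3 x A) = 0"
    by simp
  then have "(A \<bullet> A) *\<^sub>R x = (A \<bullet> x) *\<^sub>R A"
    by (simp add: Lagrange)
  then have "(1 / (A \<bullet> A)) *\<^sub>R ((A \<bullet> A) *\<^sub>R x) = (1 / (A \<bullet> A)) *\<^sub>R ((A \<bullet> x) *\<^sub>R A)"
    by simp
  then show ?thesis
    using assms(1) by simp
qed

lemma cross3_nonzero_of_orthogonal:
  fixes A B :: "real^3"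
  assumes "A \<noteq> 0" "B \<noteq> 0" "A \<bullet> B = 0"
  shows "cross3 A B \<noteq> 0"
  using norm_cross[of A B] assms by auto

lemma bounded_bilinear_cross3: "bounded_bilinear cross3"
  unfolding bilinear_conv_bounded_bilinear[symmetric] by (rule bilinear_cross)

lemmas smooth_on_cross3 [smooth_intros] = smooth_on_bilinear[OF bounded_bilinear_cross3]

lemma smooth_on_sgn:
  fixes f :: "'a::euclidean_space \<Rightarrow> 'b::real_inner"
  assumes "open S" "smooth_on S f" "\<And>x. x \<in> S \<Longrightarrow> f x \<noteq> 0"
  shows "smooth_on S (\<lambda>x. sgn (f x))"
  unfolding sgn_div_norm norm_eq_sqrt_inner
  using assms by (intro smooth_intros) auto

lemma smooth_on_gauss_map:
  assumes "open M" "smooth_on M f" "\<And>p. p \<in> M \<Longrightarrow> cross3 (dd f p (1, 0)) (dd f p (0, 1)) \<noteq> 0"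
  shows "smooth_on M (gauss_map f)"
proof -
  have "smooth_on M (\<lambda>p. sgn (cross3 (dd f p (1, 0)) (dd f p (0, 1))))"
    by (intro smooth_on_sgn smooth_intros assms)
  then show ?thesis
    by (simp add: gauss_map_def[abs_def])
qed

lemma gauss_map_orthogonal:
  "gauss_map f p \<bullet> dd f p (1, 0) = 0" "gauss_map f p \<bullet> dd f p (0, 1) = 0"
  by (simp_all add: gauss_map_def sgn_div_norm dot_cross_self)

lemma has_vector_derivative_partial:
  fixes F :: "real \<times> real \<Rightarrow> 'b::real_normed_vector"
  assumes "F differentiable (at (t, s))"
  shows "((\<lambda>t. F (t, s)) has_vector_derivative dd F (t, s) (1, 0)) (at t)"
    and "((\<lambda>s. F (t, s)) has_vector_derivative dd F (t, s) (0, 1)) (at s)"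
proof -
  have F: "(F has_derivative dd F (t, s)) (at (t, s))"
    using assms by (simp add: frechet_derivative_works)
  have "((\<lambda>t. (t, s)) has_derivative (\<lambda>h. (h, 0))) (at t)" "((\<lambda>s. (t, s)) has_derivative (\<lambda>h. (0, h))) (at s)"
    by (auto intro!: derivative_eq_intros)
  from diff_chain_at[OF this(1), of F "dd F (t, s)"] diff_chain_at[OF this(2), of F "dd F (t, s)"] F
  have d: "((\<lambda>t. F (t, s)) has_derivative (\<lambda>h. dd F (t, s) (h, 0))) (at t)"
    "((\<lambda>s. F (t, s)) has_derivative (\<lambda>h. dd F (t, s) (0, h))) (at s)"
    by (simp_all add: o_def)
  have eq: "dd F (t, s) (h, 0) = h *\<^sub>R dd F (t, s) (1, 0)"
    "dd F (t, s) (0, h) = h *\<^sub>R dd F (t, s) (0, 1)" for h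
    using dd_pair[OF assms, of "(h, 0)"] dd_pair[OF assms, of "(0, h)"]
    by (simp_all only: fst_conv snd_conv scaleR_zero_left add_0_left add_0_right)
  show "((\<lambda>t. F (t, s)) has_vector_derivative dd F (t, s) (1, 0)) (at t)"
    "((\<lambda>s. F (t, s)) has_vector_derivative dd F (t, s) (0, 1)) (at s)"
    unfolding has_vector_derivative_def eq[symmetric] by (fact d)+
qed

text \<open>Supports implicit differentiation: the product rule gives the derivative of an
  expression known to be constant, and that derivative must vanish. In this way no explicit quotient
  or root has to be differentiated.\<close>

lemma vector_derivative_const_on_open:
  assumes "open S" "x \<in> S" "\<And>y. y \<in> S \<Longrightarrow> g y = c" "(g has_vector_derivative d) (at x)"
  shows "d = 0"
proof -
  have "(g has_vector_derivative 0) (at x)"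
    by (rule has_vector_derivative_transform_within_open[OF has_vector_derivative_const[of c] assms(1,2)])
      (simp add: assms(3))
  then show ?thesis
    using vector_derivative_unique_at[OF assms(4)] by simp
qed

lemma vector_derivative_orthogonal_of_unit:
  fixes g :: "real \<Rightarrow> 'b::real_inner"
  assumes "open S" "x \<in> S" "\<And>y. y \<in> S \<Longrightarrow> g y \<bullet> g y = c" "(g has_vector_derivative d) (at x)"
  shows "d \<bullet> g x = 0"
  using vector_derivative_const_on_open[OF assms(1-3)
      bounded_bilinear.has_vector_derivative[OF bounded_bilinear_inner assms(4,4)]]
  by (simp add: inner_commute)

lemma open_slices:
  assumes "open M" "(t, s) \<in> M"
  shows "open ((\<lambda>t. (t, s)) -` M)" "open ((\<lambda>s. (t, s)) -` M)"
  using assms(1) by (auto intro!: open_vimage continuous_intros)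

text \<open>Each partial derivative of the unit normal is orthogonal to the normal and, by
  \<open>N1\<close> or \<open>N2\<close>, to the other coordinate vector. Only a multiple of its own
  coordinate vector remains.\<close>

lemma principal_directions_of_orthogonal_coordinates:
  fixes f :: "real \<times> real \<Rightarrow> real^3"
  assumes M: "open M" "p \<in> M" and f: "smooth_on M f"
    and A: "\<And>q. q \<in> M \<Longrightarrow> dd f q (1, 0) \<noteq> 0" and B: "\<And>q. q \<in> M \<Longrightarrow> dd f q (0, 1) \<noteq> 0"
    and AB: "\<And>q. q \<in> M \<Longrightarrow> dd f q (1, 0) \<bullet> dd f q (0, 1) = 0"
    and N1: "dd (gauss_map f) p (1, 0) \<bullet> dd f p (0, 1) = 0"
    and N2: "dd (gauss_map f) p (0, 1) \<bullet> dd f p (1, 0) = 0"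
  shows "\<exists>\<kappa>. \<forall>v\<in>span {(1, 0)} - {0}. principal_direction f p \<kappa> v"
    and "\<exists>\<kappa>. \<forall>v\<in>span {(0, 1)} - {0}. principal_direction f p \<kappa> v"
proof -
  define N where "N = gauss_map f"
  define c where "c q = cross3 (dd f q (1, 0)) (dd f q (0, 1))" for q
  have c: "c q \<noteq> 0" if "q \<in> M" for q
    unfolding c_def using A B AB that by (intro cross3_nonzero_of_orthogonal) auto
  have N: "smooth_on M N"
    unfolding N_def using c by (intro smooth_on_gauss_map M f) (auto simp: c_def)
  have diff: "N differentiable (at p)"
    using smooth_on_differentiable[OF N M(2)] .
  obtain t s where p: "p = (t, s)" by force
  have one: "N q \<bullet> N q = 1" if "q \<in> M" for q
    using c[OF that] by (simp add: N_def gauss_map_def c_def[symmetric] dot_square_norm norm_sgn)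
  have "dd N p (1, 0) \<bullet> N p = 0"
    using vector_derivative_orthogonal_of_unit[OF open_slices(1)[OF M(1) M(2)[unfolded p]] _ _
        has_vector_derivative_partial(1)[OF diff[unfolded p]], of 1] one M(2)
    by (simp add: p)
  moreover have "dd N p (0, 1) \<bullet> N p = 0"
    using vector_derivative_orthogonal_of_unit[OF open_slices(2)[OF M(1) M(2)[unfolded p]] _ _
        has_vector_derivative_partial(2)[OF diff[unfolded p]], of 1] one M(2)
    by (simp add: p)
  moreover have cN: "c p = norm (c p) *\<^sub>R N p"
    using c[OF M(2)] by (simp add: N_def gauss_map_def c_def[symmetric] sgn_div_norm)
  ultimately have "dd N p (1, 0) \<bullet> c p = 0" "dd N p (0, 1) \<bullet> c p = 0"
    by (metis inner_scaleR_right mult_zero_right)+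
  then have c1: "dd N p (1, 0) \<bullet> cross3 (dd f p (1, 0)) (dd f p (0, 1)) = 0"
    and c2: "dd N p (0, 1) \<bullet> cross3 (dd f p (0, 1)) (dd f p (1, 0)) = 0"
    using cross_skew[of "dd f p (0, 1)" "dd f p (1, 0)"] by (auto simp: c_def)
  have "dd f p (0, 1) \<bullet> dd f p (1, 0) = 0"
    using AB[OF M(2)] by (simp add: inner_commute)
  then obtain k l where "dd N p (1, 0) = k *\<^sub>R dd f p (1, 0)" "dd N p (0, 1) = l *\<^sub>R dd f p (0, 1)"
    using parallel_of_orthogonal[OF A[OF M(2)] B[OF M(2)] AB[OF M(2)] N1[folded N_def] c1]
      parallel_of_orthogonal[OF B[OF M(2)] A[OF M(2)] _ N2[folded N_def] c2] by blast
  then have "dd N p (1, 0) = - ((- k) *\<^sub>R dd f p (1, 0))" "dd N p (0, 1) = - ((- l) *\<^sub>R dd f p (0, 1))"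
    by (simp_all only: scaleR_minus_left minus_minus)
  moreover have "\<forall>v\<in>span {u} - {0}. principal_direction f p \<kappa> v"
    if "dd N p u = - (\<kappa> *\<^sub>R dd f p u)" for u \<kappa>
  proof
    fix v assume "v \<in> span {u} - {0}"
    then obtain r where r: "v = r *\<^sub>R u" "v \<noteq> 0"
      by (auto simp: span_singleton)
    have "dd N p v = r *\<^sub>R dd N p u" "dd f p v = r *\<^sub>R dd f p u"
      using linear_frechet_derivative[OF diff] smooth_on_linear_dd[OF f M(2)] r(1)
      by (simp_all add: linear_scale)
    with that r(2) show "principal_direction f p \<kappa> v"
      by (simp add: principal_direction_def N_def)
  qed
  ultimately show "\<exists>\<kappa>. \<forall>v\<in>span {(1, 0)} - {0}. principal_direction f p \<kappa> v"
    "\<exists>\<kappa>. \<forall>v\<in>span {(0, 1)} - {0}. principal_direction f p \<kappa> v"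
    by blast+
qed

section \<open>The axis and planes as affine sets\<close>

lemma axis_line_eq_span: "axis_line = span {axis 1 1}"
  by (auto simp: axis_line_def span_singleton vec_eq_iff forall_3 axis_def)

lemma line_set_axis_line: "line_set axis_line"
proof -
  have "dim axis_line = 1"
    using dim_eq_card_independent[of "{axis 1 1 :: real^3}"]
    by (simp add: axis_line_eq_span axis_eq_0_iff)
  then show ?thesis
    by (simp add: line_set_def axis_line_eq_span subspace_imp_affine aff_dim_subspace)
qed

lemma plane_set_hyperplane: "(a::real^3) \<noteq> 0 \<Longrightarrow> plane_set {y. a \<bullet> y = b}"
  by (simp add: plane_set_def affine_hyperplane aff_dim_hyperplane)

lemma inner_3: "(x::real^3) \<bullet> y = x$1 * y$1 + x$2 * y$2 + x$3 * y$3"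
  by (simp add: inner_vec_def sum_3)

section \<open>Surfaces generated by parallel curves are Joachimsthal surfaces\<close>

lemma smooth_on_has_vector_derivative:
  fixes f :: "real \<Rightarrow> 'b::real_normed_vector"
  assumes "smooth_on S f" "x \<in> S"
  shows "(f has_vector_derivative dd f x 1) (at x)"
proof -
  have eq: "h *\<^sub>R dd f x 1 = dd f x h" for h
    using linear_scale[OF smooth_on_linear_dd[OF assms], of h 1] by simp
  show ?thesis
    unfolding has_vector_derivative_def eq by (rule smooth_on_derivative[OF assms])
qed

lemma has_vector_derivative_vector_3:
  assumes "(a has_real_derivative a') (at x)" "(b has_real_derivative b') (at x)"
    "(c has_real_derivative c') (at x)"
  shows "((\<lambda>x. vector [a x, b x, c x] :: real^3) has_vector_derivative vector [a', b', c']) (at x)"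
proof -
  have s: "((\<lambda>x. g x *\<^sub>R u) has_vector_derivative g' *\<^sub>R u) (at x)" if "(g has_real_derivative g') (at x)"
    for g g' and u :: "real^3"
    using has_vector_derivative_scaleR[OF that has_vector_derivative_const[of u]] by simp
  show ?thesis
    unfolding vector_3_expansion by (intro has_vector_derivative_add s assms)
qed

lemma smooth_on_fst_compose:
  fixes g :: "'a::euclidean_space \<Rightarrow> 'c::real_normed_vector" and B :: "'b::euclidean_space set"
  assumes "open A" "open B" "smooth_on A g"
  shows "smooth_on (A \<times> B) (\<lambda>p. g (fst p))"
  by (rule smooth_on_compose[OF assms(3) _ _ assms(1)])
    (auto intro!: smooth_on_fst smooth_on_ident open_Times assms)

lemma smooth_on_snd_compose:
  fixes g :: "'b::euclidean_space \<Rightarrow> 'c::real_normed_vector" and A :: "'a::euclidean_space set"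
  assumes "open A" "open B" "smooth_on B g"
  shows "smooth_on (A \<times> B) (\<lambda>p. g (snd p))"
  by (rule smooth_on_compose[OF assms(3) _ _ assms(2)])
    (auto intro!: smooth_on_snd smooth_on_ident open_Times assms)

lemma has_vector_derivative_lorentz_const:
  "(g has_vector_derivative g') (at x) \<Longrightarrow> ((\<lambda>x. lorentz (g x) c) has_real_derivative lorentz g' c) (at x)"
  using has_vector_derivative_lorentz[OF _ has_vector_derivative_const, of g g' x UNIV c]
  by (simp add: lorentz_simps has_real_derivative_iff_has_vector_derivative)

locale parallel_family =
  fixes e0 e1 e2 :: "real^3" and J I :: "real set" and \<gamma> :: "real \<Rightarrow> real^3" and a :: "real \<Rightarrow> real"
  assumes e: "pseudo_orthonormal e0 e1 e2"
    and \<gamma>: "unit_speed_curve J \<gamma>"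
    and a: "height_function I a"
begin

definition v where "v t = dd \<gamma> t 1"
definition n where "n t = lorentz_cross (\<gamma> t) (v t)"
text \<open>The factor in the derivative of \<open>n\<close> as a multiple of \<open>v\<close>; it
  is minus the geodesic curvature of \<gamma> with respect to \<open>n\<close>.\<close>

definition \<kappa> where "\<kappa> t = lorentz (dd n t 1) (v t)"
text \<open>The factor by which the parallel curve at distance \<open>snd p\<close> is faster than
  \<gamma>; its zeros are the singular points of the lift.\<close>

definition lam where "lam p = cosh (snd p) + sinh (snd p) * \<kappa> (fst p)"
definition X where "X p = cosh (snd p) *\<^sub>R \<gamma> (fst p) + sinh (snd p) *\<^sub>R n (fst p)"
text \<open>The unit velocity, at \<open>X p\<close>, of the geodesic that leaves \<gamma> in the
  direction \<open>n\<close>.\<close>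

definition m where "m p = sinh (snd p) *\<^sub>R \<gamma> (fst p) + cosh (snd p) *\<^sub>R n (fst p)"
text \<open>The \<open>e0\<close> coordinate of \<open>X p\<close>, hence the denominator in
  \<open>Phi\<close>.\<close>

definition x0 where "x0 p = - 2 * lorentz (X p) e2"
definition f where "f = Phi e0 e1 e2 \<circ> lift_map \<gamma> a"
definition M where "M = regular_points (J \<times> I) (lift_map \<gamma> a)"

section \<open>Moving frame of the curve and derivatives of the lift\<close>

lemma open_J: "open J" and open_I: "open I" and smooth_\<gamma>: "smooth_on J \<gamma>" and smooth_a: "smooth_on I a"
  using \<gamma> a by (auto simp: unit_speed_curve_def height_function_def open_interval_def)

lemma open_JI: "open (J \<times> I)"
  using open_J open_I by (rule open_Times)

lemma smooth_v: "smooth_on J v"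
  unfolding v_def[abs_def] by (intro smooth_intros open_J smooth_\<gamma>)

lemma smooth_n: "smooth_on J n"
  unfolding n_def[abs_def] by (intro smooth_intros open_J smooth_\<gamma> smooth_v)

lemma \<gamma>_deriv: "t \<in> J \<Longrightarrow> (\<gamma> has_vector_derivative v t) (at t)"
  using smooth_on_has_vector_derivative[OF smooth_\<gamma>] by (simp add: v_def)

lemma frame:
  assumes "t \<in> J"
  shows "lorentz (\<gamma> t) (\<gamma> t) = -1" "lorentz (v t) (v t) = 1" "lorentz (\<gamma> t) (v t) = 0"
    "lorentz (n t) (n t) = 1" "lorentz (\<gamma> t) (n t) = 0" "lorentz (v t) (n t) = 0"
proof -
  have \<gamma>\<gamma>: "lorentz (\<gamma> t) (\<gamma> t) = -1" if "t \<in> J" for t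
    using \<gamma> that by (auto simp: unit_speed_curve_def hyperbolic_plane_def)
  then show "lorentz (\<gamma> t) (\<gamma> t) = -1"
    using assms by blast
  show vv: "lorentz (v t) (v t) = 1"
    using \<gamma> assms vector_derivative_eq_dd[OF smooth_on_differentiable[OF smooth_\<gamma>]]
    by (auto simp: unit_speed_curve_def v_def)
  have "lorentz (\<gamma> t) (v t) + lorentz (v t) (\<gamma> t) = 0"
    by (rule vector_derivative_const_on_open[OF open_J assms _
          has_vector_derivative_lorentz[OF \<gamma>_deriv[OF assms] \<gamma>_deriv[OF assms]], of "-1"])
      (simp add: \<gamma>\<gamma>)
  then show \<gamma>v: "lorentz (\<gamma> t) (v t) = 0"
    by (simp add: lorentz_sym)
  show "lorentz (n t) (n t) = 1"
    using \<gamma>\<gamma>[OF assms] vv \<gamma>v by (simp add: n_def lorentz_cross_lagrange lorentz_sym[of "v t" "\<gamma> t"])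
qed (simp_all add: n_def)

lemma n_deriv:
  assumes "t \<in> J"
  shows "(n has_vector_derivative \<kappa> t *\<^sub>R v t) (at t)"
proof -
  note d = smooth_on_has_vector_derivative[OF smooth_n assms]
  have "lorentz (\<gamma> t) (dd n t 1) + lorentz (v t) (n t) = 0"
    by (rule vector_derivative_const_on_open[OF open_J assms _
          has_vector_derivative_lorentz[OF \<gamma>_deriv[OF assms] d], of 0]) (simp add: frame)
  moreover have "lorentz (n t) (dd n t 1) + lorentz (dd n t 1) (n t) = 0"
    by (rule vector_derivative_const_on_open[OF open_J assms _
          has_vector_derivative_lorentz[OF d d], of 1]) (simp add: frame)
  ultimately have "lorentz (dd n t 1) (\<gamma> t) = 0" "lorentz (dd n t 1) (n t) = 0"
    using frame[OF assms] by (simp_all add: lorentz_sym)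
  then have "dd n t 1 = \<kappa> t *\<^sub>R v t"
    using lorentz_frame_expansion[OF frame(1-3)[OF assms], of "dd n t 1"]
    by (simp add: \<kappa>_def n_def[symmetric])
  with d show ?thesis by simp
qed

lemma lift_map_eq: "p \<in> J \<times> I \<Longrightarrow> lift_map \<gamma> a p = (X p, a (snd p))"
  using vector_derivative_at[OF \<gamma>_deriv]
  by (auto simp: lift_map_def parallel_curve_def X_def n_def)

lemma smooth_pair:
  shows "smooth_on (J \<times> I) (\<lambda>p. \<gamma> (fst p))" "smooth_on (J \<times> I) (\<lambda>p. v (fst p))"
    "smooth_on (J \<times> I) (\<lambda>p. n (fst p))" "smooth_on (J \<times> I) (\<lambda>p. a (snd p))"
  using smooth_\<gamma> smooth_v smooth_n smooth_a open_J open_I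
  by (auto intro: smooth_on_fst_compose smooth_on_snd_compose)

lemma smooth_X: "smooth_on (J \<times> I) X" and smooth_lam: "smooth_on (J \<times> I) lam"
proof -
  show "smooth_on (J \<times> I) X"
    unfolding X_def[abs_def] by (intro smooth_intros smooth_pair open_JI)
  have "smooth_on J \<kappa>"
    unfolding \<kappa>_def[abs_def] by (intro smooth_intros smooth_v smooth_n open_J)
  then have "smooth_on (J \<times> I) (\<lambda>p. \<kappa> (fst p))"
    by (rule smooth_on_fst_compose[OF open_J open_I])
  then show "smooth_on (J \<times> I) lam"
    unfolding lam_def[abs_def] by (intro smooth_intros open_JI)
qed

lemma X_partial:
  assumes "(t, s) \<in> J \<times> I"
  shows "((\<lambda>t. X (t, s)) has_vector_derivative lam (t, s) *\<^sub>R v t) (at t)"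
    and "((\<lambda>s. X (t, s)) has_vector_derivative m (t, s)) (at s)"
    and "((\<lambda>t. m (t, s)) has_vector_derivative (sinh s + cosh s * \<kappa> t) *\<^sub>R v t) (at t)"
proof -
  have t: "t \<in> J" using assms by simp
  have d: "((\<lambda>t. \<alpha> *\<^sub>R \<gamma> t + \<beta> *\<^sub>R n t) has_vector_derivative (\<alpha> + \<beta> * \<kappa> t) *\<^sub>R v t) (at t)" for \<alpha> \<beta>
    using has_vector_derivative_add[OF
        bounded_linear.has_vector_derivative[OF bounded_linear_scaleR_right \<gamma>_deriv[OF t], of \<alpha>]
        bounded_linear.has_vector_derivative[OF bounded_linear_scaleR_right n_deriv[OF t], of \<beta>]]
    by (simp add: algebra_simps)
  show "((\<lambda>t. X (t, s)) has_vector_derivative lam (t, s) *\<^sub>R v t) (at t)"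
    "((\<lambda>t. m (t, s)) has_vector_derivative (sinh s + cosh s * \<kappa> t) *\<^sub>R v t) (at t)"
    using d by (simp_all add: X_def m_def lam_def)
  have "(cosh has_real_derivative sinh s) (at s)" "(sinh has_real_derivative cosh s) (at s)"
    by (auto intro!: derivative_eq_intros)
  from has_vector_derivative_add[OF has_vector_derivative_scaleR[OF this(1) has_vector_derivative_const[of "\<gamma> t"]]
      has_vector_derivative_scaleR[OF this(2) has_vector_derivative_const[of "n t"]]]
  show "((\<lambda>s. X (t, s)) has_vector_derivative m (t, s)) (at s)"
    by (simp add: X_def m_def)
qed

lemma a_deriv:
  assumes "s \<in> I"
  shows "(a has_real_derivative deriv a s) (at s)" "deriv a s > 0"
proof -
  show "(a has_real_derivative deriv a s) (at s)"
    using smooth_on_has_vector_derivative[OF smooth_a assms]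
    by (metis has_real_derivative_iff_has_vector_derivative DERIV_imp_deriv)
  show "deriv a s > 0"
    using a assms by (simp add: height_function_def)
qed

lemma X_lorentz:
  assumes "p \<in> J \<times> I"
  shows "lorentz (X p) (X p) = -1" "lorentz (X p) (v (fst p)) = 0"
proof -
  have t: "fst p \<in> J" using assms by auto
  show "lorentz (X p) (X p) = -1"
    using frame[OF t] cosh_square_eq[of "snd p"]
    by (simp add: X_def lorentz_simps lorentz_sym[of "n (fst p)" "\<gamma> (fst p)"] power2_eq_square)
  show "lorentz (X p) (v (fst p)) = 0"
    using frame[OF t] by (simp add: X_def lorentz_simps lorentz_sym[of "n (fst p)" "v (fst p)"])
qed

text \<open>A vector orthogonal to the null vector \<open>e2\<close> has nonnegative square, whereas
  \<open>X p\<close> is timelike.\<close>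

lemma x0_nonzero:
  assumes "p \<in> J \<times> I"
  shows "x0 p \<noteq> 0"
proof
  assume "x0 p = 0"
  then have "lorentz (X p) e1 * lorentz (X p) e1 = -1"
    using X_lorentz(1)[OF assms] pseudo_orthonormal_lorentz[OF e, of "X p" "X p"] by (simp add: x0_def)
  then show False
    using zero_le_square[of "lorentz (X p) e1"] by linarith
qed

lemma f_eq: "p \<in> J \<times> I \<Longrightarrow>
    f p = (1 / x0 p) *\<^sub>R vector [lorentz (X p) e1, cos (a (snd p)), sin (a (snd p))]"
  by (simp add: f_def lift_map_eq Phi_formula[OF e] x0_def)

lemma smooth_x0: "smooth_on (J \<times> I) x0"
  unfolding x0_def[abs_def] by (intro smooth_intros smooth_X open_JI)

lemma smooth_f: "smooth_on (J \<times> I) f"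
proof (rule smooth_on_cong[OF open_JI _ f_eq[symmetric]])
  show "smooth_on (J \<times> I) (\<lambda>p. (1 / x0 p) *\<^sub>R (vector [lorentz (X p) e1, cos (a (snd p)), sin (a (snd p))] :: real^3))"
    by (intro smooth_intros smooth_X open_JI smooth_x0 smooth_pair x0_nonzero)
qed

lemma f_scaled: "p \<in> J \<times> I \<Longrightarrow> x0 p *\<^sub>R f p = vector [lorentz (X p) e1, cos (a (snd p)), sin (a (snd p))]"
  using x0_nonzero by (simp add: f_eq)

text \<open>Up to the factors \<open>lam / x0\<close> and \<open>1 / x0\<close>, the two partial derivatives of
  \<open>f\<close> are the following vectors.\<close>

definition W where
  "W p = vector [lorentz (v (fst p)) e1, 0, 0] + (2 * lorentz (v (fst p)) e2) *\<^sub>R f p"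
definition E where
  "E p = vector [lorentz (m p) e1, - sin (a (snd p)) * deriv a (snd p), cos (a (snd p)) * deriv a (snd p)]
     + (2 * lorentz (m p) e2) *\<^sub>R f p"

text \<open>Obtained by differentiating the identity \<open>f_scaled\<close>, in which the
  denominator \<open>x0\<close> has been cleared.\<close>

lemma f_partial:
  assumes "p \<in> J \<times> I"
  shows "x0 p *\<^sub>R dd f p (1, 0) = lam p *\<^sub>R W p" "x0 p *\<^sub>R dd f p (0, 1) = E p"
proof -
  obtain t s where p: "p = (t, s)" "t \<in> J" "s \<in> I" using assms by auto
  note ts = assms[unfolded p(1)]
  note diff = smooth_on_differentiable[OF smooth_f ts]
  note X1 = X_partial(1)[OF ts] and X2 = X_partial(2)[OF ts]
  have x01: "((\<lambda>t. x0 (t, s)) has_real_derivative - 2 * (lam (t, s) * lorentz (v t) e2)) (at t)"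
    unfolding x0_def
    using DERIV_cmult[OF has_vector_derivative_lorentz_const[OF X1, of e2], of "- 2"]
    by (simp add: lorentz_simps)
  have x02: "((\<lambda>s. x0 (t, s)) has_real_derivative - 2 * lorentz (m (t, s)) e2) (at s)"
    unfolding x0_def
    using DERIV_cmult[OF has_vector_derivative_lorentz_const[OF X2, of e2], of "- 2"] by simp
  define Q where "Q p = (vector [lorentz (X p) e1, cos (a (snd p)), sin (a (snd p))] :: real^3)" for p
  have Q1: "((\<lambda>t. Q (t, s)) has_vector_derivative vector [lam (t, s) * lorentz (v t) e1, 0, 0]) (at t)"
    unfolding Q_def
    using has_vector_derivative_vector_3[OF has_vector_derivative_lorentz_const[OF X1, of e1] DERIV_const DERIV_const]
    by (simp add: lorentz_simps)
  have Q2: "((\<lambda>s. Q (t, s)) has_vector_derivative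
      vector [lorentz (m (t, s)) e1, - sin (a s) * deriv a s, cos (a s) * deriv a s]) (at s)"
    unfolding Q_def snd_conv
    by (intro has_vector_derivative_vector_3 has_vector_derivative_lorentz_const[OF X2]
        DERIV_fun_cos DERIV_fun_sin a_deriv(1) p(3))
  have zero: "x0 q *\<^sub>R f q - Q q = 0" if "q \<in> J \<times> I" for q
    using f_scaled[OF that] by (simp add: Q_def)
  have "x0 (t, s) *\<^sub>R dd f (t, s) (1, 0) + (- 2 * (lam (t, s) * lorentz (v t) e2)) *\<^sub>R f (t, s)
      - vector [lam (t, s) * lorentz (v t) e1, 0, 0] = 0"
    by (rule vector_derivative_const_on_open[OF open_slices(1)[OF open_JI ts] _ _
          has_vector_derivative_diff[OF has_vector_derivative_scaleR[OF x01
            has_vector_derivative_partial(1)[OF diff]] Q1], of 0]) (use ts zero in auto)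
  then show "x0 p *\<^sub>R dd f p (1, 0) = lam p *\<^sub>R W p"
    by (simp add: p(1) W_def vec_eq_iff forall_3 algebra_simps)
  have "x0 (t, s) *\<^sub>R dd f (t, s) (0, 1) + (- 2 * lorentz (m (t, s)) e2) *\<^sub>R f (t, s)
      - vector [lorentz (m (t, s)) e1, - sin (a s) * deriv a s, cos (a s) * deriv a s] = 0"
    by (rule vector_derivative_const_on_open[OF open_slices(2)[OF open_JI ts] _ _
          has_vector_derivative_diff[OF has_vector_derivative_scaleR[OF x02
            has_vector_derivative_partial(2)[OF diff]] Q2], of 0]) (use ts zero in auto)
  then show "x0 p *\<^sub>R dd f p (0, 1) = E p"
    by (simp add: p(1) E_def vec_eq_iff forall_3 algebra_simps)
qed

text \<open>Orthogonality of \<open>X p\<close> and \<open>v\<close> says that \<open>X\<close>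
  stays on one geodesic while \<open>s\<close> varies. In the null basis it is linear in the
  coordinates of \<open>X p\<close>, and the norm condition on \<open>X p\<close> turns the
  \<open>e2\<close> coordinate into the quadratic term. The coefficients depend on \<open>t\<close>
  alone.\<close>

lemma sphere_equation:
  assumes "p \<in> J \<times> I"
  shows "lorentz (v (fst p)) e2 * (f p \<bullet> f p) + lorentz (v (fst p)) e1 * f p $ 1 + lorentz (v (fst p)) e0 = 0"
proof -
  let ?V = "v (fst p)"
  define y1 where "y1 = lorentz (X p) e1"
  define y0 where "y0 = x0 p"
  have nz: "y0 \<noteq> 0"
    using x0_nonzero[OF assms] by (simp add: y0_def)
  have e2: "lorentz (X p) e2 = - y0 / 2"
    by (simp add: y0_def x0_def)
  have "y0 * y0 * (f p \<bullet> f p) = (x0 p *\<^sub>R f p) \<bullet> (x0 p *\<^sub>R f p)"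
    by (simp add: y0_def)
  also have "\<dots> = y1 * y1 + 1"
    unfolding f_scaled[OF assms] inner_3 using sin_cos_squared_add[of "a (snd p)"]
    by (simp add: y1_def power2_eq_square)
  finally have ff: "y0 * y0 * (f p \<bullet> f p) = y1 * y1 + 1" .
  have f1: "f p $ 1 = y1 / y0"
    by (simp add: f_eq[OF assms] y0_def y1_def)
  have "y1 * y1 + 2 * y0 * lorentz (X p) e0 = -1"
    using pseudo_orthonormal_lorentz[OF e, of "X p" "X p"] X_lorentz(1)[OF assms]
    by (simp add: y1_def[symmetric] e2)
  moreover have "y1 * lorentz ?V e1 - 2 * lorentz (X p) e0 * lorentz ?V e2 + y0 * lorentz ?V e0 = 0"
    using pseudo_orthonormal_lorentz[OF e, of "X p" ?V] X_lorentz(2)[OF assms]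
    by (simp add: y1_def[symmetric] e2)
  ultimately have "y0 * y0 * (lorentz ?V e2 * (f p \<bullet> f p) + lorentz ?V e1 * (y1 / y0) + lorentz ?V e0) = 0"
    using nz ff by (simp add: distrib_left) algebra
  with nz f1 show ?thesis by simp
qed

text \<open>\<open>W p\<close> is the gradient at \<open>f p\<close> of the quadratic function in
  \<open>sphere_equation\<close>. On the zero set its squared length is the discriminant of that
  function, which in the null basis is \<open>lorentz (v t) (v t)\<close>.\<close>

lemma W_norm:
  assumes "p \<in> J \<times> I"
  shows "W p \<bullet> W p = 1"
proof -
  have t: "fst p \<in> J" using assms by auto
  let ?V = "v (fst p)"
  have "W p \<bullet> W p = lorentz ?V e1 * lorentz ?V e1 + 4 * lorentz ?V e2 * (lorentz ?V e1 * f p $ 1)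
      + 4 * lorentz ?V e2 * lorentz ?V e2 * (f p \<bullet> f p)"
    by (simp add: W_def inner_3 algebra_simps)
  also have "\<dots> = lorentz ?V e1 * lorentz ?V e1 - 4 * lorentz ?V e0 * lorentz ?V e2"
    using sphere_equation[OF assms] by algebra
  also have "\<dots> = 1"
    using pseudo_orthonormal_lorentz[OF e, of ?V ?V] frame(2)[OF t] by simp
  finally show ?thesis .
qed

text \<open>The quadratic function with gradient \<open>W p\<close> vanishes along the whole curve
  of constant \<open>t\<close>, so its derivative in \<open>s\<close> is zero.\<close>

lemma W_orthogonal:
  assumes "p \<in> J \<times> I"
  shows "W p \<bullet> dd f p (0, 1) = 0"
proof -
  obtain t s where p: "p = (t, s)" "t \<in> J" "s \<in> I" using assms by auto
  note ts = assms[unfolded p(1)]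
  note d = has_vector_derivative_partial(2)[OF smooth_on_differentiable[OF smooth_f ts]]
  let ?B = "dd f (t, s) (0, 1)"
  have 1: "((\<lambda>s. f (t, s) \<bullet> f (t, s)) has_vector_derivative (f (t, s) \<bullet> ?B + ?B \<bullet> f (t, s))) (at s)"
    by (rule bounded_bilinear.has_vector_derivative[OF bounded_bilinear_inner d d])
  have 2: "((\<lambda>s. f (t, s) $ 1) has_vector_derivative ?B $ 1) (at s)"
    by (rule bounded_linear.has_vector_derivative[OF bounded_linear_vec_nth d])
  have "((\<lambda>s. lorentz (v t) e2 * (f (t, s) \<bullet> f (t, s)) + lorentz (v t) e1 * f (t, s) $ 1 + lorentz (v t) e0)
      has_vector_derivative
      lorentz (v t) e2 * (f (t, s) \<bullet> ?B + ?B \<bullet> f (t, s)) + lorentz (v t) e1 * ?B $ 1 + 0) (at s)"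
    by (intro has_vector_derivative_add has_vector_derivative_const
        bounded_linear.has_vector_derivative[OF bounded_linear_mult_right] 1 2)
  then have "lorentz (v t) e2 * (f (t, s) \<bullet> ?B + ?B \<bullet> f (t, s)) + lorentz (v t) e1 * ?B $ 1 + 0 = 0"
    by (rule vector_derivative_const_on_open[OF open_I p(3), of _ 0, rotated])
      (use sphere_equation[of "(t, y)" for y] p(2) in simp)
  then show ?thesis
    by (simp add: p(1) W_def inner_3 algebra_simps)
qed

text \<open>The height component of the lift has derivative zero in \<open>t\<close> and positive in
  \<open>s\<close>, so the two partial derivatives are independent exactly when the first one,
  \<open>lam p *\<^sub>R v t\<close>, does not vanish.\<close>

lemma M_eq: "M = {p \<in> J \<times> I. lam p \<noteq> 0}"
proof -
  have "lift_map \<gamma> a differentiable (at p) \<and>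
      (inj (dd (lift_map \<gamma> a) p) \<longleftrightarrow> lam p \<noteq> 0)" if p: "p \<in> J \<times> I" for p
  proof -
    obtain t s where ts: "p = (t, s)" "t \<in> J" "s \<in> I" using p by auto
    let ?F = "lift_map \<gamma> a"
    have "smooth_on (J \<times> I) ?F"
      by (rule smooth_on_cong[OF open_JI _ lift_map_eq[symmetric]])
        (intro smooth_intros open_JI smooth_X smooth_pair)
    then have diff: "?F differentiable (at p)" and lin: "linear (dd ?F p)"
      using p by (auto intro: smooth_on_differentiable smooth_on_linear_dd)
    have F1: "dd ?F p (1, 0) = (lam p *\<^sub>R v t, 0)"
    proof -
      have "((\<lambda>t. (X (t, s), a s)) has_vector_derivative (lam (t, s) *\<^sub>R v t, 0)) (at t)"
        by (intro has_vector_derivative_Pair X_partial(1) p[unfolded ts(1)] has_vector_derivative_const)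
      then have "((\<lambda>t. ?F (t, s)) has_vector_derivative (lam (t, s) *\<^sub>R v t, 0)) (at t)"
        by (rule has_vector_derivative_transform_within_open[OF _ open_J ts(2)]) (simp add: lift_map_eq ts)
      then show ?thesis
        using has_vector_derivative_partial(1)[OF diff[unfolded ts(1)]] vector_derivative_unique_at
        by (auto simp: ts(1))
    qed
    have F2: "dd ?F p (0, 1) = (m p, deriv a s)"
    proof -
      have "((\<lambda>s. (X (t, s), a s)) has_vector_derivative (m (t, s), deriv a s)) (at s)"
        using a_deriv(1)[OF ts(3)]
        by (intro has_vector_derivative_Pair X_partial(2) p[unfolded ts(1)])
          (simp add: has_real_derivative_iff_has_vector_derivative)
      then have "((\<lambda>s. ?F (t, s)) has_vector_derivative (m (t, s), deriv a s)) (at s)"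
        by (rule has_vector_derivative_transform_within_open[OF _ open_I ts(3)]) (simp add: lift_map_eq ts)
      then show ?thesis
        using has_vector_derivative_partial(2)[OF diff[unfolded ts(1)]] vector_derivative_unique_at
        by (auto simp: ts(1))
    qed
    have "v t \<noteq> 0"
      using frame(2)[OF ts(2)] by (auto simp: lorentz_simps)
    have "inj (dd ?F p) \<longleftrightarrow> lam p \<noteq> 0"
    proof
      assume "inj (dd ?F p)"
      then have "dd ?F p (1, 0) \<noteq> dd ?F p 0"
        by (auto simp: zero_prod_def dest!: injD)
      then show "lam p \<noteq> 0"
        using F1 linear_0[OF lin] by (auto simp: zero_prod_def)
    next
      assume l: "lam p \<noteq> 0"
      show "inj (dd ?F p)"
        unfolding linear_injective_0[OF lin]
      proof (intro allI impI)
        fix h assume "dd ?F p h = 0"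
        then have h: "fst h *\<^sub>R (lam p *\<^sub>R v t, 0::real) + snd h *\<^sub>R (m p, deriv a s) = 0"
          using dd_pair[OF diff, of h] F1 F2 by simp
        then have "snd h = 0"
          using a_deriv(2)[OF ts(3)] by (simp add: zero_prod_def)
        with h show "h = 0"
          using l \<open>v t \<noteq> 0\<close> by (simp add: zero_prod_def prod_eq_iff)
      qed
    qed
    with diff show ?thesis by simp
  qed
  then show ?thesis
    by (auto simp: M_def regular_points_def)
qed

lemma open_M: "open M"
proof -
  have "M = (J \<times> I) \<inter> lam -` (- {0})"
    by (auto simp: M_eq)
  then show ?thesis
    using continuous_open_preimage[OF smooth_on_continuous[OF smooth_lam] open_JI
        open_Compl[OF closed_singleton, of 0]] by simp
qed

lemma M_subset: "M \<subseteq> J \<times> I"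
  by (auto simp: M_eq)

section \<open>The surface is immersed and its coordinate directions are principal\<close>

lemma f_partial_nonzero:
  assumes "p \<in> M"
  shows "dd f p (1, 0) \<noteq> 0" "dd f p (0, 1) \<noteq> 0" "dd f p (1, 0) \<bullet> dd f p (0, 1) = 0"
proof -
  have p: "p \<in> J \<times> I" "lam p \<noteq> 0" "snd p \<in> I"
    using assms by (auto simp: M_eq)
  have A: "dd f p (1, 0) = (lam p / x0 p) *\<^sub>R W p"
    using f_partial(1)[OF p(1)] x0_nonzero[OF p(1)]
    by (metis (no_types, lifting) divide_inverse mult.commute pth_1 left_inverse scaleR_scaleR)
  show "dd f p (1, 0) \<noteq> 0"
    using p x0_nonzero[OF p(1)] W_norm[OF p(1)] by (auto simp: A)
  show "dd f p (1, 0) \<bullet> dd f p (0, 1) = 0"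
    using W_orthogonal[OF p(1)] by (simp add: A)
  show "dd f p (0, 1) \<noteq> 0"
  proof
    let ?a = "a (snd p)" and ?a' = "deriv a (snd p)"
    assume "dd f p (0, 1) = 0"
    then have E0: "E p = 0"
      using f_partial(2)[OF p(1)] by simp
    define k where "k = 2 * lorentz (m p) e2 / x0 p"
    have "E p $ 2 = - sin ?a * ?a' + k * cos ?a" "E p $ 3 = cos ?a * ?a' + k * sin ?a"
      by (simp_all add: E_def f_eq[OF p(1)] k_def)
    with E0 have "- sin ?a * ?a' + k * cos ?a = 0" "cos ?a * ?a' + k * sin ?a = 0"
      by simp_all
    \<comment> \<open>The weights \<open>- sin ?a\<close> and \<open>cos ?a\<close> isolate the
      component in the direction of rotation about the axis, which is \<open>?a'\<close>.\<close>
    then have "?a' * ((sin ?a)\<^sup>2 + (cos ?a)\<^sup>2) = 0"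
      by algebra
    then show False
      using a_deriv(2)[OF p(3)] by simp
  qed
qed

text \<open>The normal is orthogonal to \<open>W\<close> and \<open>E\<close>, and the derivative of
  \<open>W\<close> in \<open>s\<close>, like that of \<open>E\<close> in \<open>t\<close>, is again
  tangent to the surface. Using these rescaled tangent vectors keeps derivatives of
  \<open>lam\<close> and \<open>x0\<close> out of the computation.\<close>

lemma gauss_map_partial:
  assumes "p \<in> M"
  shows "dd (gauss_map f) p (1, 0) \<bullet> dd f p (0, 1) = 0" "dd (gauss_map f) p (0, 1) \<bullet> dd f p (1, 0) = 0"
proof -
  let ?N = "gauss_map f"
  obtain t s where p: "p = (t, s)" "(t, s) \<in> J \<times> I" "t \<in> J" "s \<in> I" using assms M_subset by auto
  have N: "smooth_on M ?N"
    using f_partial_nonzero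
    by (intro smooth_on_gauss_map open_M smooth_on_subset[OF smooth_f M_subset] cross3_nonzero_of_orthogonal)
  have diff: "?N differentiable (at (t, s))" "f differentiable (at (t, s))"
    using assms smooth_on_differentiable[OF N] smooth_on_differentiable[OF smooth_f p(2)] by (auto simp: p(1))
  note N1 = has_vector_derivative_partial(1)[OF diff(1)] and N2 = has_vector_derivative_partial(2)[OF diff(1)]
  note f1 = has_vector_derivative_partial(1)[OF diff(2)] and f2 = has_vector_derivative_partial(2)[OF diff(2)]
  have NW: "?N q \<bullet> W q = 0" if "q \<in> M" for q
  proof -
    have q: "q \<in> J \<times> I" "lam q \<noteq> 0" using that by (auto simp: M_eq)
    have "lam q * (?N q \<bullet> W q) = x0 q * (?N q \<bullet> dd f q (1, 0))"
      using f_partial(1)[OF q(1)] by (metis inner_scaleR_right)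
    then show ?thesis
      using q(2) by (simp add: gauss_map_orthogonal)
  qed
  have NE: "?N q \<bullet> E q = 0" if "q \<in> J \<times> I" for q
    using f_partial(2)[OF that] gauss_map_orthogonal(2)[of f q]
    by (metis inner_scaleR_right mult_zero_right)
  have W2: "((\<lambda>s. W (t, s)) has_vector_derivative 0 + (2 * lorentz (v t) e2) *\<^sub>R dd f (t, s) (0, 1)) (at s)"
    unfolding W_def fst_conv
    by (intro has_vector_derivative_add has_vector_derivative_const
        bounded_linear.has_vector_derivative[OF bounded_linear_scaleR_right f2])
  have "?N (t, s) \<bullet> (0 + (2 * lorentz (v t) e2) *\<^sub>R dd f (t, s) (0, 1)) + dd ?N (t, s) (0, 1) \<bullet> W (t, s) = 0"
    by (rule vector_derivative_const_on_open[OF open_slices(2)[OF open_M assms[unfolded p(1)]] _ _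
          bounded_bilinear.has_vector_derivative[OF bounded_bilinear_inner N2 W2], of 0])
      (use assms NW p(1) in auto)
  then have "dd ?N p (0, 1) \<bullet> W p = 0"
    by (simp add: p(1) gauss_map_orthogonal)
  then show "dd ?N p (0, 1) \<bullet> dd f p (1, 0) = 0"
    using f_partial(1)[of p] x0_nonzero[of p] p(1,2)
    by (metis inner_scaleR_right mult_eq_0_iff)
  let ?\<mu> = "sinh s + cosh s * \<kappa> t"
  have E1: "((\<lambda>t. E (t, s)) has_vector_derivative
      vector [?\<mu> * lorentz (v t) e1, 0, 0] +
      ((2 * lorentz (m (t, s)) e2) *\<^sub>R dd f (t, s) (1, 0) + (2 * (?\<mu> * lorentz (v t) e2)) *\<^sub>R f (t, s))) (at t)"
    unfolding E_def snd_conv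
  proof (intro has_vector_derivative_add has_vector_derivative_scaleR f1)
    note d = has_vector_derivative_lorentz_const[OF X_partial(3)[OF p(2)]]
    show "((\<lambda>t. vector [lorentz (m (t, s)) e1, - sin (a s) * deriv a s, cos (a s) * deriv a s] :: real^3)
        has_vector_derivative vector [?\<mu> * lorentz (v t) e1, 0, 0]) (at t)"
      using has_vector_derivative_vector_3[OF d[of e1] DERIV_const DERIV_const] by (simp add: lorentz_simps)
    show "((\<lambda>t. 2 * lorentz (m (t, s)) e2) has_real_derivative 2 * (?\<mu> * lorentz (v t) e2)) (at t)"
      using DERIV_cmult[OF d[of e2], of 2] by (simp add: lorentz_simps)
  qed
  have "?N (t, s) \<bullet> (vector [?\<mu> * lorentz (v t) e1, 0, 0] +
      ((2 * lorentz (m (t, s)) e2) *\<^sub>R dd f (t, s) (1, 0) + (2 * (?\<mu> * lorentz (v t) e2)) *\<^sub>R f (t, s)))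
      + dd ?N (t, s) (1, 0) \<bullet> E (t, s) = 0"
    by (rule vector_derivative_const_on_open[OF open_slices(1)[OF open_JI p(2)] _ _
          bounded_bilinear.has_vector_derivative[OF bounded_bilinear_inner N1 E1], of 0])
      (use p NE in auto)
  \<comment> \<open>Regrouping exhibits the derivative of \<open>E\<close> in \<open>t\<close> as a
    combination of the tangent vectors \<open>W\<close> and the first partial derivative of
    \<open>f\<close>.\<close>
  moreover have "vector [?\<mu> * lorentz (v t) e1, 0, 0] +
      ((2 * lorentz (m (t, s)) e2) *\<^sub>R dd f (t, s) (1, 0) + (2 * (?\<mu> * lorentz (v t) e2)) *\<^sub>R f (t, s))
      = ?\<mu> *\<^sub>R W (t, s) + (2 * lorentz (m (t, s)) e2) *\<^sub>R dd f (t, s) (1, 0)"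
    by (simp add: W_def vec_eq_iff forall_3 algebra_simps)
  ultimately have "dd ?N p (1, 0) \<bullet> E p = 0"
    using NW[OF assms] by (simp add: p(1) inner_add_right gauss_map_orthogonal)
  then show "dd ?N p (1, 0) \<bullet> dd f p (0, 1) = 0"
    using f_partial(2)[of p] x0_nonzero[of p] p(1,2)
    by (metis inner_scaleR_right mult_eq_0_iff)
qed

lemma f_avoids_axis: "f ` M \<subseteq> - axis_line"
proof safe
  fix p assume "p \<in> M" "f p \<in> axis_line"
  moreover from this have "p \<in> J \<times> I"
    using M_subset by blast
  ultimately have "cos (a (snd p)) = 0" "sin (a (snd p)) = 0"
    using x0_nonzero[of p] f_eq[of p] by (auto simp: axis_line_def)
  then show False
    using sin_cos_squared_add[of "a (snd p)"] by simp
qed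

section \<open>Coordinate curves lie in planes through the axis and in spheres\<close>

lemma integral_curve_coordinates:
  assumes "integral_curve M (\<lambda>_. span {d}) K c"
  shows "d = (1, 0) \<Longrightarrow> \<exists>k. \<forall>\<tau>\<in>K. snd (c \<tau>) = k" "d = (0, 1) \<Longrightarrow> \<exists>k. \<forall>\<tau>\<in>K. fst (c \<tau>) = k"
proof -
  have K: "convex K"
    using assms by (auto simp: integral_curve_def open_interval_def is_interval_convex)
  have c: "(c has_vector_derivative vector_derivative c (at \<tau>)) (at \<tau>)"
    "vector_derivative c (at \<tau>) \<in> span {d}" if "\<tau> \<in> K" for \<tau>
    using assms that by (auto simp: integral_curve_def vector_derivative_works[symmetric])
  have const: "\<exists>k. \<forall>\<tau>\<in>K. h (c \<tau>) = k" if h: "bounded_linear h" "h d = 0" for h :: "real \<times> real \<Rightarrow> real"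
  proof -
    have "((\<lambda>\<tau>. h (c \<tau>)) has_vector_derivative 0) (at \<tau> within K)" if "\<tau> \<in> K" for \<tau>
    proof -
      have "h (vector_derivative c (at \<tau>)) = 0"
        using c(2)[OF that] h by (auto simp: span_singleton linear_scale bounded_linear.linear)
      then show ?thesis
        using bounded_linear.has_vector_derivative[OF h(1) c(1)[OF that]]
        by (simp add: has_vector_derivative_at_within)
    qed
    then show ?thesis
      using has_vector_derivative_zero_constant[OF K] by metis
  qed
  show "d = (1, 0) \<Longrightarrow> \<exists>k. \<forall>\<tau>\<in>K. snd (c \<tau>) = k" "d = (0, 1) \<Longrightarrow> \<exists>k. \<forall>\<tau>\<in>K. fst (c \<tau>) = k"
    using const[OF bounded_linear_snd] const[OF bounded_linear_fst] by auto
qed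

lemma coordinate_curve_in_plane:
  "\<exists>P. plane_set P \<and> axis_line \<subseteq> P \<and> f ` {p \<in> J \<times> I. snd p = s} \<subseteq> P"
proof (intro exI conjI)
  \<comment> \<open>The unit normal of the plane through the axis that makes the angle
    \<open>a s\<close>.\<close>
  define u where "u = (vector [0, - sin (a s), cos (a s)] :: real^3)"
  have "u \<bullet> u = 1"
    using sin_cos_squared_add[of "a s"] by (simp add: u_def inner_3 power2_eq_square)
  then show "plane_set {y. u \<bullet> y = 0}"
    by (intro plane_set_hyperplane) auto
  show "axis_line \<subseteq> {y. u \<bullet> y = 0}"
    by (auto simp: axis_line_def u_def inner_3)
  show "f ` {p \<in> J \<times> I. snd p = s} \<subseteq> {y. u \<bullet> y = 0}"
    by (auto simp: f_eq u_def inner_3)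
qed

lemma coordinate_curve_in_sphere:
  assumes "t \<in> J"
  shows "\<exists>\<Sigma>. sphere_centered_on axis_line \<Sigma> \<and> f ` {p \<in> J \<times> I. fst p = t} \<subseteq> \<Sigma>"
proof -
  \<comment> \<open>The coordinates of \<open>v t\<close> in the null basis. Completing the square
    in \<open>sphere_equation\<close> gives centre \<open>g1 / g0\<close> on the axis and, since
    \<open>v t\<close> has norm 1, radius \<open>1 / \<bar>g0\<bar>\<close>. If
    \<open>g0 = 0\<close>, the geodesic ends at the point at infinity of the half-plane and the
    sphere degenerates to a plane.\<close>
  define g0 g1 g2 where "g0 = - 2 * lorentz (v t) e2" and "g1 = lorentz (v t) e1" and "g2 = - 2 * lorentz (v t) e0"
  have g: "g1 * g1 - g0 * g2 = 1"
    using pseudo_orthonormal_lorentz[OF e, of "v t" "v t"] frame(2)[OF assms]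
    by (simp add: g0_def g1_def g2_def mult.commute[of "lorentz (v t) e0"])
  have sph: "g0 * (f p \<bullet> f p) - 2 * g1 * f p $ 1 + g2 = 0" if "p \<in> J \<times> I" "fst p = t" for p
    using sphere_equation[OF that(1)] that(2) by (simp add: g0_def g1_def g2_def)
  show ?thesis
  proof (cases "g0 = 0")
    case True
    then have g1: "g1 \<noteq> 0" using g by auto
    define u where "u = (axis 1 1 :: real^3)"
    have u: "u \<noteq> 0" "\<And>y. u \<bullet> y = y $ 1"
      by (simp_all add: u_def axis_eq_0_iff inner_axis')
    have "sphere_centered_on axis_line {y. u \<bullet> y = g2 / (2 * g1)}"
      unfolding sphere_centered_on_def
    proof (intro disjI2 conjI ballI plane_set_hyperplane u(1))
      fix x y x' y'
      assume "x \<in> axis_line" "y \<in> axis_line"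
        "x' \<in> {y. u \<bullet> y = g2 / (2 * g1)}" "y' \<in> {y. u \<bullet> y = g2 / (2 * g1)}"
      then show "(x - y) \<bullet> (x' - y') = 0"
        unfolding u(2) by (simp add: axis_line_def inner_3)
    qed
    moreover have "f ` {p \<in> J \<times> I. fst p = t} \<subseteq> {y. u \<bullet> y = g2 / (2 * g1)}"
      using sph True g1 by (auto simp: u(2) field_simps)
    ultimately show ?thesis by blast
  next
    case False
    define z where "z = (vector [g1 / g0, 0, 0] :: real^3)"
    have "dist z (f p) = 1 / \<bar>g0\<bar>" if "p \<in> J \<times> I" "fst p = t" for p
    proof -
      have "(dist z (f p))\<^sup>2 = z \<bullet> z - 2 * (z \<bullet> f p) + f p \<bullet> f p"
        by (simp add: dist_norm power2_norm_eq_inner inner_diff_left inner_diff_right inner_commute)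
      also have "\<dots> = (g1 * g1 - g0 * (2 * g1 * f p $ 1 - g0 * (f p \<bullet> f p))) / (g0 * g0)"
        using False by (simp add: z_def inner_3 field_simps)
      also have "\<dots> = (1 / \<bar>g0\<bar>)\<^sup>2"
      proof -
        have "2 * g1 * f p $ 1 - g0 * (f p \<bullet> f p) = g2"
          using sph[OF that] by simp
        then show ?thesis
          using g by (simp add: power2_eq_square)
      qed
      finally show ?thesis
        by (rule power2_eq_imp_eq) auto
    qed
    then have "f ` {p \<in> J \<times> I. fst p = t} \<subseteq> sphere z (1 / \<bar>g0\<bar>)"
      by auto
    moreover have "z \<in> axis_line"
      by (simp add: z_def axis_line_def)
    then have "sphere_centered_on axis_line (sphere z (1 / \<bar>g0\<bar>))"
      using False unfolding sphere_centered_on_def by (intro disjI1 bexI exI[of _ "1 / \<bar>g0\<bar>"]) auto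
    ultimately show ?thesis by blast
  qed
qed

theorem joachimsthal: "joachimsthal_surface axis_line M f"
proof -
  have fM: "smooth_on M f"
    using smooth_on_subset[OF smooth_f M_subset] .
  have inj: "inj (dd f p)" if "p \<in> M" for p
    unfolding linear_injective_0[OF smooth_on_linear_dd[OF fM that]]
  proof (intro allI impI)
    fix h assume "dd f p h = 0"
    then have h: "fst h *\<^sub>R dd f p (1, 0) + snd h *\<^sub>R dd f p (0, 1) = 0"
      using dd_pair[OF smooth_on_differentiable[OF fM that], of h] by simp
    note nz = f_partial_nonzero[OF that]
    have "(fst h *\<^sub>R dd f p (1, 0) + snd h *\<^sub>R dd f p (0, 1)) \<bullet> dd f p (1, 0) = fst h * (dd f p (1, 0) \<bullet> dd f p (1, 0))"
      "(fst h *\<^sub>R dd f p (1, 0) + snd h *\<^sub>R dd f p (0, 1)) \<bullet> dd f p (0, 1) = snd h * (dd f p (0, 1) \<bullet> dd f p (0, 1))"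
      using nz(3) by (simp_all add: inner_add_left inner_commute[of "dd f p (0, 1)" "dd f p (1, 0)"])
    then show "h = 0"
      using h nz by (simp add: prod_eq_iff)
  qed
  \<comment> \<open>The coordinate fields are chosen everywhere, umbilics included, so no case
    distinction on the principal curvatures arises.\<close>
  have "\<exists>k1 k2. principal_line_fields M f k1 k2 (\<lambda>_. span {(1, 0)}) (\<lambda>_. span {(0, 1)})"
  proof -
    obtain k1 k2 where k: "\<forall>p\<in>M. \<forall>v\<in>span {(1, 0)} - {0}. principal_direction f p (k1 p) v"
      "\<forall>p\<in>M. \<forall>v\<in>span {(0, 1)} - {0}. principal_direction f p (k2 p) v"
      using principal_directions_of_orthogonal_coordinates[OF open_M _ fM f_partial_nonzero gauss_map_partial]
      by (metis (no_types, lifting))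
    have "smooth_line_field M (\<lambda>_. span {d})" if "d \<noteq> 0" for d
      unfolding smooth_line_field_def
      using that open_M by (auto intro!: exI[of _ M] exI[of _ "\<lambda>_. d"] smooth_on_const)
    moreover have "dd f p v \<bullet> dd f p w = 0" if "p \<in> M" "v \<in> span {(1, 0)}" "w \<in> span {(0, 1)}" for p v w
    proof -
      obtain k l where "v = k *\<^sub>R (1, 0)" "w = l *\<^sub>R (0, 1)"
        using \<open>v \<in> _\<close> \<open>w \<in> _\<close> by (auto simp: span_singleton)
      then have "dd f p v = k *\<^sub>R dd f p (1, 0)" "dd f p w = l *\<^sub>R dd f p (0, 1)"
        using linear_scale[OF smooth_on_linear_dd[OF fM that(1)]] by blast+
      then show ?thesis
        using f_partial_nonzero(3)[OF that(1)] by simp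
    qed
    ultimately have "principal_line_fields M f k1 k2 (\<lambda>_. span {(1, 0)}) (\<lambda>_. span {(0, 1)})"
      using k unfolding principal_line_fields_def by (simp add: zero_prod_def)
    then show ?thesis by blast
  qed
  moreover have "\<exists>P. plane_set P \<and> axis_line \<subseteq> P \<and> f ` c ` K \<subseteq> P"
    if c: "integral_curve M (\<lambda>_. span {(1, 0)}) K c" for K c
  proof -
    obtain k where "\<forall>\<tau>\<in>K. snd (c \<tau>) = k"
      using integral_curve_coordinates(1)[OF c] by auto
    moreover have "c ` K \<subseteq> J \<times> I"
      using c M_subset by (auto simp: integral_curve_def)
    ultimately have "f ` c ` K \<subseteq> f ` {p \<in> J \<times> I. snd p = k}"
      by (intro image_mono) auto
    then show ?thesis
      using coordinate_curve_in_plane[of k] by blast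
  qed
  moreover have "\<exists>\<Sigma>. sphere_centered_on axis_line \<Sigma> \<and> f ` c ` K \<subseteq> \<Sigma>"
    if c: "integral_curve M (\<lambda>_. span {(0, 1)}) K c" for K c
  proof -
    obtain k where k: "\<forall>\<tau>\<in>K. fst (c \<tau>) = k"
      using integral_curve_coordinates(2)[OF c] by auto
    moreover have cK: "c ` K \<subseteq> J \<times> I" "K \<noteq> {}"
      using c M_subset by (auto simp: integral_curve_def open_interval_def)
    ultimately have "f ` c ` K \<subseteq> f ` {p \<in> J \<times> I. fst p = k}"
      by (intro image_mono) auto
    moreover have "k \<in> J"
      using k cK by fastforce
    ultimately show ?thesis
      using coordinate_curve_in_sphere[of k] by blast
  qed
  ultimately show ?thesis
    unfolding joachimsthal_surface_def immersed_surface_def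
    using line_set_axis_line open_M fM inj by blast
qed

end

section \<open>Parametrizing by parallel curves\<close>

lemma diffeomorphism_on_compose:
  assumes "diffeomorphism_on V U \<phi>" "diffeomorphism_on U W \<eta>"
  shows "diffeomorphism_on V W (\<lambda>x. \<eta> (\<phi> x))"
proof -
  obtain g where g: "open V" "open U" "smooth_on V \<phi>" "smooth_on U g" "\<phi> ` V = U" "g ` U = V"
    "\<And>x. x \<in> V \<Longrightarrow> g (\<phi> x) = x" "\<And>y. y \<in> U \<Longrightarrow> \<phi> (g y) = y"
    using diffeomorphism_onE[OF assms(1)] by metis
  obtain h where h: "open W" "smooth_on U \<eta>" "smooth_on W h" "\<eta> ` U = W" "h ` W = U"
    "\<And>x. x \<in> U \<Longrightarrow> h (\<eta> x) = x" "\<And>y. y \<in> W \<Longrightarrow> \<eta> (h y) = y"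
    using diffeomorphism_onE[OF assms(2)] by metis
  show ?thesis
  proof (rule diffeomorphism_onI[where g="\<lambda>y. g (h y)"])
    show "smooth_on V (\<lambda>x. \<eta> (\<phi> x))" "smooth_on W (\<lambda>y. g (h y))"
      using smooth_on_compose[OF h(2) g(3)] smooth_on_compose[OF g(4) h(3)] g h by auto
  qed (use g h in auto)
qed

lemma diffeomorphism_on_Times:
  assumes "diffeomorphism_on A A' f" "diffeomorphism_on B B' g"
  shows "diffeomorphism_on (A \<times> B) (A' \<times> B') (\<lambda>p. (f (fst p), g (snd p)))"
proof -
  obtain f' where f: "open A" "open A'" "smooth_on A f" "smooth_on A' f'" "f ` A = A'" "f' ` A' = A"
    "\<And>x. x \<in> A \<Longrightarrow> f' (f x) = x" "\<And>y. y \<in> A' \<Longrightarrow> f (f' y) = y"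
    using diffeomorphism_onE[OF assms(1)] by metis
  obtain g' where g: "open B" "open B'" "smooth_on B g" "smooth_on B' g'" "g ` B = B'" "g' ` B' = B"
    "\<And>x. x \<in> B \<Longrightarrow> g' (g x) = x" "\<And>y. y \<in> B' \<Longrightarrow> g (g' y) = y"
    using diffeomorphism_onE[OF assms(2)] by metis
  show ?thesis
  proof (rule diffeomorphism_onI[where g="\<lambda>p. (f' (fst p), g' (snd p))"])
    show "smooth_on (A \<times> B) (\<lambda>p. (f (fst p), g (snd p)))"
      by (intro smooth_on_Pair open_Times smooth_on_fst_compose smooth_on_snd_compose f g)
    show "smooth_on (A' \<times> B') (\<lambda>p. (f' (fst p), g' (snd p)))"
      by (intro smooth_on_Pair open_Times smooth_on_fst_compose smooth_on_snd_compose f g)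
  qed (use f g in \<open>auto intro: open_Times\<close>)
qed

lemma diffeomorphism_on_inverse:
  assumes "diffeomorphism_on V U \<psi>"
  obtains g where "diffeomorphism_on U V g" "\<And>x. x \<in> V \<Longrightarrow> g (\<psi> x) = x" "\<And>y. y \<in> U \<Longrightarrow> \<psi> (g y) = y"
proof -
  obtain g where g: "open V" "open U" "smooth_on V \<psi>" "smooth_on U g" "\<psi> ` V = U" "g ` U = V"
    "\<And>x. x \<in> V \<Longrightarrow> g (\<psi> x) = x" "\<And>y. y \<in> U \<Longrightarrow> \<psi> (g y) = y"
    using diffeomorphism_onE[OF assms] by metis
  show thesis
    by (rule that[of g]) (use g in \<open>auto intro!: diffeomorphism_onI[where g=\<psi>]\<close>)
qed

lemma dd_const_on_open:
  assumes "open S" "x \<in> S" "\<And>y. y \<in> S \<Longrightarrow> g y = c" "(g has_derivative g') (at x)"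
  shows "g' v = 0"
proof -
  have "((\<lambda>_. c) has_derivative g') (at x)"
    by (rule has_derivative_transform_within_open[OF assms(4,1,2)]) (simp add: assms(3))
  then have "g' = (\<lambda>_. 0)"
    using has_derivative_const has_derivative_unique by blast
  then show ?thesis by simp
qed

lemma partial_zero_constant:
  fixes g :: "real \<Rightarrow> 'b::real_normed_vector"
  assumes "convex A" "x \<in> A" "y \<in> A" "\<And>t. t \<in> A \<Longrightarrow> (g has_vector_derivative 0) (at t)"
  shows "g x = g y"
  using has_vector_derivative_zero_constant[OF assms(1), of g] assms(2-4) has_vector_derivative_at_within
  by metis

lemma inj_of_diagonal:
  fixes L :: "real \<times> real \<Rightarrow> real \<times> real"
  assumes "linear L" "L v = (k, 0)" "L w = (0, l)" "k \<noteq> 0" "l \<noteq> 0"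
  shows "inj L"
proof -
  have "y = L ((fst y / k) *\<^sub>R v + (snd y / l) *\<^sub>R w)" for y
    using assms(2-5) by (simp add: linear_add[OF assms(1)] linear_scale[OF assms(1)] prod_eq_iff)
  then have "surj L" by (metis surj_def)
  then show ?thesis
    using assms(1) linear_surjective_imp_injective by blast
qed

lemma ball_real_interval: "ball (x::real) r = {x - r<..<x + r}"
  by (auto simp: dist_real_def)

lemma open_interval_ball: "r > 0 \<Longrightarrow> open_interval (ball (x::real) r)"
  by (simp add: open_interval_def ball_real_interval is_interval_def)

lemma smooth_antiderivative_exists:
  fixes f :: "real \<Rightarrow> real"
  assumes "r > 0" "smooth_on (ball x r) f"
  obtains F r' where "0 < r'" "r' \<le> r" "smooth_on (ball x r') F"
    "\<And>y. y \<in> ball x r' \<Longrightarrow> (F has_real_derivative f y) (at y)"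
proof -
  have sub: "{x - r/2..x + r/2} \<subseteq> ball x r"
    using assms(1) by (auto simp: ball_real_interval)
  obtain F where F: "\<And>y. y \<in> {x - r/2..x + r/2} \<Longrightarrow>
      (F has_vector_derivative f y) (at y within {x - r/2..x + r/2})"
    using antiderivative_continuous[OF continuous_on_subset[OF smooth_on_continuous[OF assms(2)] sub]] by metis
  have F': "(F has_vector_derivative f y) (at y)" if "y \<in> ball x (r/2)" for y
    using F[of y] that by (simp add: ball_real_interval at_within_Icc_at)
  show thesis
  proof (rule that[of "r/2" F])
    show "smooth_on (ball x (r/2)) F"
      by (rule smooth_on_antiderivative[OF _ F' smooth_on_subset[OF assms(2) subset_ball]])
        (use assms(1) in auto)
    show "(F has_real_derivative f y) (at y)" if "y \<in> ball x (r/2)" for y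
      using F'[OF that] by (simp add: has_real_derivative_iff_has_vector_derivative)
  qed (use assms(1) in auto)
qed

text \<open>Serves twice: to express \<theta> through the signed distance and to reparametrize a
  curve by arc length.\<close>

lemma smooth_inverse_real:
  fixes F :: "real \<Rightarrow> real"
  assumes "r > 0" "smooth_on (ball x r) F" "\<And>y. y \<in> ball x r \<Longrightarrow> (F has_real_derivative F' y) (at y)"
    "F' x \<noteq> 0"
  obtains b \<delta> where "\<delta> > 0" "diffeomorphism_on (ball (F x) \<delta>) (b ` ball (F x) \<delta>) b"
    "b ` ball (F x) \<delta> \<subseteq> ball x r" "b (F x) = x" "\<And>u. u \<in> ball (F x) \<delta> \<Longrightarrow> F (b u) = u"
    "\<And>u. u \<in> ball (F x) \<delta> \<Longrightarrow> (b has_real_derivative inverse (F' (b u))) (at u)"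
    "\<And>u. u \<in> ball (F x) \<delta> \<Longrightarrow> F' (b u) \<noteq> 0"
proof -
  have dF: "dd F y 1 = F' y" if "y \<in> ball x r" for y
    using dd_eq[of F "(*) (F' y)" y 1] assms(3)[OF that] by (simp add: has_field_derivative_def)
  obtain V where V: "open V" "x \<in> V" "V \<subseteq> ball x r" "diffeomorphism_on V (F ` V) F"
    using smooth_local_diffeo_real[OF open_ball _ assms(2)] dF[of x] assms(1,4)
    by (metis centre_in_ball)
  obtain b where b: "diffeomorphism_on (F ` V) V b" "\<And>y. y \<in> V \<Longrightarrow> b (F y) = y"
    "\<And>u. u \<in> F ` V \<Longrightarrow> F (b u) = u"
    using diffeomorphism_on_inverse[OF V(4)] by metis
  have bV: "open (F ` V)" "b ` (F ` V) = V" "smooth_on (F ` V) b"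
    using b(1) by (auto simp: diffeomorphism_on_def bij_betw_def)
  obtain \<delta> where \<delta>: "\<delta> > 0" "ball (F x) \<delta> \<subseteq> F ` V"
    using bV(1) V(2) open_contains_ball by blast
  show thesis
  proof (rule that[OF \<delta>(1) diffeomorphism_on_restrict[OF b(1) open_ball \<delta>(2)]])
    show "b ` ball (F x) \<delta> \<subseteq> ball x r"
      using \<delta>(2) bV(2) V(3) by blast
    show "b (F x) = x"
      using b(2) V(2) by blast
    fix u assume "u \<in> ball (F x) \<delta>"
    then have u: "u \<in> F ` V" "b u \<in> ball x r"
      using \<delta>(2) bV(2) V(3) by blast+
    show "F (b u) = u"
      using b(3) u(1) by blast
    obtain b' where b': "(b has_real_derivative b') (at u)"
      using smooth_on_has_vector_derivative[OF bV(3) u(1)] has_real_derivative_iff_has_vector_derivative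
      by blast
    have "((\<lambda>u. F (b u)) has_real_derivative F' (b u) * b') (at u)"
      by (rule DERIV_chain2[OF assms(3)[OF u(2)] b'])
    moreover have "((\<lambda>u. F (b u)) has_real_derivative 1) (at u)"
      using has_field_derivative_transform_within_open[OF DERIV_ident bV(1) u(1)] b(3) by metis
    ultimately have "F' (b u) * b' = 1"
      using DERIV_unique by blast
    then show "(b has_real_derivative inverse (F' (b u))) (at u)" "F' (b u) \<noteq> 0"
      using b' by (auto simp: inverse_unique)
  qed
qed

text \<open>The quotient in \<open>pos\<close> is the derivative with respect to \<theta>, at
  \<open>p\<close> and along \<open>V2\<close>, of the signed distance measured in the direction
  \<open>lorentz_cross (X p) (\<nu> p)\<close>. Its sign becomes the sign of the derivative of
  \<open>a\<close>.\<close>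

lemma parallel_parametrization:
  fixes X \<nu> :: "real \<times> real \<Rightarrow> real^3" and \<theta> \<rho> :: "real \<times> real \<Rightarrow> real"
    and V1 V2 :: "real \<times> real \<Rightarrow> real \<times> real"
  assumes e: "pseudo_orthonormal e0 e1 e2"
    and U: "open U" "p \<in> U"
    and smooth: "smooth_on U X" "smooth_on U \<theta>" "smooth_on U V1" "smooth_on U V2" "smooth_on U \<nu>"
    and H: "X ` U \<subseteq> hyperbolic_plane"
    and \<theta>: "\<And>q. q \<in> U \<Longrightarrow> dd \<theta> q (V1 q) = 0" "\<And>q. q \<in> U \<Longrightarrow> dd \<theta> q (V2 q) \<noteq> 0"
    and \<nu>: "\<And>q. q \<in> U \<Longrightarrow> lorentz (\<nu> q) (\<nu> q) = 1" "\<And>q. q \<in> U \<Longrightarrow> lorentz (X q) (\<nu> q) = 0"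
    and X1: "\<And>q. q \<in> U \<Longrightarrow> dd X q (V1 q) = \<rho> q *\<^sub>R \<nu> q" "\<And>q. q \<in> U \<Longrightarrow> \<rho> q \<noteq> 0"
    and \<nu>2: "\<And>q. q \<in> U \<Longrightarrow> dd \<nu> q (V2 q) = 0"
    and pos: "lorentz (dd X p (V2 p)) (lorentz_cross (X p) (\<nu> p)) / dd \<theta> p (V2 p) > 0"
  shows "\<exists>J I \<gamma> a W \<psi>. unit_speed_curve J \<gamma> \<and> height_function I a \<and> p \<in> W \<and> W \<subseteq> U \<and>
    regular_points (J \<times> I) (lift_map \<gamma> a) = J \<times> I \<and> diffeomorphism_on (J \<times> I) W \<psi> \<and>
    (\<forall>q\<in>J \<times> I. lift_map \<gamma> a q = (X (\<psi> q), \<theta> (\<psi> q)))"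
proof -
  \<comment> \<open>A scalar that is constant along \<open>V2\<close>, as \<nu> is. Along
    \<open>V1\<close> at \<open>p\<close> its derivative is minus \<open>\<rho> p\<close>, by
    differentiating the orthogonality of \<open>X\<close> and \<nu>; so \<open>h\<close> and
    \<theta> are independent there.\<close>
  define h where "h q = lorentz (\<nu> q) (X p)" for q
  have smooth_h: "smooth_on U h"
    unfolding h_def[abs_def] by (intro smooth_intros U smooth)
  have dh: "dd h q v = lorentz (dd \<nu> q v) (X p)" if "q \<in> U" for q v
    unfolding h_def[abs_def]
    by (rule dd_eq[OF bounded_linear.has_derivative[OF
          bounded_bilinear.bounded_linear_left[OF bounded_bilinear_lorentz] smooth_on_derivative[OF smooth(5) that]]])
  have "lorentz (X p) (dd \<nu> p (V1 p)) + lorentz (dd X p (V1 p)) (\<nu> p) = 0"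
    using dd_const_on_open[OF U \<nu>(2) has_derivative_lorentz[OF smooth_on_derivative[OF smooth(1) U(2)]
          smooth_on_derivative[OF smooth(5) U(2)]]] .
  then have h1: "dd h p (V1 p) \<noteq> 0"
    using X1[OF U(2)] \<nu>(1)[OF U(2)] by (simp add: dh[OF U(2)] lorentz_simps lorentz_sym)
  have h2: "dd h q (V2 q) = 0" if "q \<in> U" for q
    using dh[OF that] \<nu>2[OF that] by (simp add: lorentz_simps)
  define \<Psi> where "\<Psi> q = (h q, \<theta> q)" for q
  have smooth_\<Psi>: "smooth_on U \<Psi>"
    unfolding \<Psi>_def[abs_def] by (intro smooth_intros U smooth smooth_h)
  have d\<Psi>: "dd \<Psi> q v = (dd h q v, dd \<theta> q v)" if "q \<in> U" for q v
    unfolding \<Psi>_def[abs_def]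
    by (rule dd_eq[OF has_derivative_Pair[OF smooth_on_derivative[OF smooth_h that] smooth_on_derivative[OF smooth(2) that]]])
  have "inj (dd \<Psi> p)"
    by (rule inj_of_diagonal[OF smooth_on_linear_dd[OF smooth_\<Psi> U(2)], of "V1 p" "dd h p (V1 p)" "V2 p" "dd \<theta> p (V2 p)"])
      (use h1 h2 \<theta> U(2) in \<open>auto simp: d\<Psi>\<close>)
  define U1 where "U1 = U \<inter> (\<lambda>q. dd h q (V1 q)) -` (- {0})"
  have "open U1"
    unfolding U1_def by (intro continuous_open_preimage smooth_on_continuous smooth_intros U smooth smooth_h) auto
  moreover have "U1 \<subseteq> U" "p \<in> U1"
    using U(2) h1 by (auto simp: U1_def)
  ultimately obtain V where V: "open V" "p \<in> V" "V \<subseteq> U1" "diffeomorphism_on V (\<Psi> ` V) \<Psi>"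
    using smooth_local_diffeo_real2[of U1 p \<Psi>] \<open>inj (dd \<Psi> p)\<close> smooth_on_subset[OF smooth_\<Psi>] by metis
  have VU: "V \<subseteq> U" using V(3) \<open>U1 \<subseteq> U\<close> by blast
  obtain g where g: "diffeomorphism_on (\<Psi> ` V) V g" "\<And>q. q \<in> V \<Longrightarrow> g (\<Psi> q) = q"
    "\<And>y. y \<in> \<Psi> ` V \<Longrightarrow> \<Psi> (g y) = y"
    using diffeomorphism_on_inverse[OF V(4)] by metis
  have gV: "open (\<Psi> ` V)" "g ` (\<Psi> ` V) = V" "smooth_on (\<Psi> ` V) g"
    using g(1) by (auto simp: diffeomorphism_on_def bij_betw_def)
  \<comment> \<open>With respect to \<open>V1\<close> and \<open>V2\<close> the derivative of \<Psi>
    is diagonal at every point, not only at \<open>p\<close>. Hence the new coordinate fields are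
    rescalings of \<open>V1\<close> and \<open>V2\<close>.\<close>
  have dg: "dd g y (1, 0) = (1 / dd h (g y) (V1 (g y))) *\<^sub>R V1 (g y)"
    "dd g y (0, 1) = (1 / dd \<theta> (g y) (V2 (g y))) *\<^sub>R V2 (g y)" if "y \<in> \<Psi> ` V" for y
  proof -
    have q: "g y \<in> V" "g y \<in> U" "dd h (g y) (V1 (g y)) \<noteq> 0"
      using gV(2) that VU V(3) by (auto simp: U1_def)
    have lin: "linear (dd g y)"
      using smooth_on_linear_dd[OF gV(3) that] .
    have "dd g y (dd \<Psi> (g y) w) = w" for w
    proof -
      have "((\<lambda>q. g (\<Psi> q)) has_derivative (\<lambda>w. dd g y (dd \<Psi> (g y) w))) (at (g y))"
        using has_derivative_compose[OF smooth_on_derivative[OF smooth_\<Psi> q(2)], of g "dd g y"]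
          smooth_on_derivative[OF gV(3) that] g(3)[OF that] by simp
      moreover have "((\<lambda>q. g (\<Psi> q)) has_derivative (\<lambda>w. w)) (at (g y))"
        by (rule has_derivative_transform_within_open[OF has_derivative_ident V(1) q(1)]) (simp add: g(2))
      ultimately show ?thesis
        using has_derivative_unique by metis
    qed
    from this[of "V1 (g y)"] this[of "V2 (g y)"]
    have *: "dd g y (dd h (g y) (V1 (g y)) *\<^sub>R (1, 0)) = V1 (g y)"
      "dd g y (dd \<theta> (g y) (V2 (g y)) *\<^sub>R (0, 1)) = V2 (g y)"
      using h2[OF q(2)] \<theta>(1)[OF q(2)] by (simp_all add: d\<Psi>[OF q(2)])
    show "dd g y (1, 0) = (1 / dd h (g y) (V1 (g y))) *\<^sub>R V1 (g y)"
      "dd g y (0, 1) = (1 / dd \<theta> (g y) (V2 (g y))) *\<^sub>R V2 (g y)"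
      using *[unfolded linear_scale[OF lin]] q(3) \<theta>(2)[OF q(2)]
      by (metis divide_inverse left_inverse mult_1 scaleR_one scaleR_scaleR)+
  qed
  obtain \<tau>0 \<sigma>0 where p0: "\<Psi> p = (\<tau>0, \<sigma>0)" by force
  have "(\<tau>0, \<sigma>0) \<in> \<Psi> ` V"
    using V(2) p0 by (metis imageI)
  then obtain A' B' where "open A'" "open B'" "\<tau>0 \<in> A'" "\<sigma>0 \<in> B'" "A' \<times> B' \<subseteq> \<Psi> ` V"
    using open_prod_elim[OF gV(1)] by (metis mem_Sigma_iff)
  moreover from this obtain r1 r2 where "r1 > 0" "ball \<tau>0 r1 \<subseteq> A'" "r2 > 0" "ball \<sigma>0 r2 \<subseteq> B'"
    using open_contains_ball by meson
  ultimately obtain r1 r2 where r: "r1 > 0" "r2 > 0" "ball \<tau>0 r1 \<times> ball \<sigma>0 r2 \<subseteq> \<Psi> ` V"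
    by (meson Sigma_mono subset_trans)
  define A B where "A = ball \<tau>0 r1" and "B = ball \<sigma>0 r2"
  have AB: "open A" "open B" "convex A" "convex B" "\<tau>0 \<in> A" "\<sigma>0 \<in> B" "A \<times> B \<subseteq> \<Psi> ` V" "open (A \<times> B)"
    using r by (auto simp: A_def B_def open_Times)
  have gU: "g y \<in> U" if "y \<in> A \<times> B" for y
    using that AB(7) gV(2) VU by blast
  have gAB: "smooth_on (A \<times> B) g"
    using smooth_on_subset[OF gV(3) AB(7)] .
  have gp: "g (\<tau>0, \<sigma>0) = p"
    using g(2)[OF V(2)] p0 by simp
  define Y where "Y y = X (g y)" for y
  define n where "n y = \<nu> (g y)" for y
  define \<mu> where "\<mu> y = lorentz (dd Y y (1, 0)) (n y)" for y
  have smooth_Y: "smooth_on (A \<times> B) Y" and smooth_n: "smooth_on (A \<times> B) n"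
    unfolding Y_def[abs_def] n_def[abs_def]
    using gU by (auto intro!: smooth_on_compose[OF smooth(1) gAB AB(8) U(1)] smooth_on_compose[OF smooth(5) gAB AB(8) U(1)])
  have smooth_\<mu>: "smooth_on (A \<times> B) \<mu>"
    unfolding \<mu>_def[abs_def] by (intro smooth_intros AB smooth_Y smooth_n)
  have dY: "dd Y y v = dd X (g y) (dd g y v)" and dn: "dd n y v = dd \<nu> (g y) (dd g y v)"
    if "y \<in> A \<times> B" for y v
    unfolding Y_def[abs_def] n_def[abs_def]
    using gU[OF that] that
    by (intro dd_compose smooth_on_differentiable[OF smooth(1)] smooth_on_differentiable[OF smooth(5)]
        smooth_on_differentiable[OF gAB]; blast)+
  have Y1: "dd Y y (1, 0) = \<mu> y *\<^sub>R n y" "\<mu> y \<noteq> 0" if "y \<in> A \<times> B" for y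
  proof -
    have y: "y \<in> \<Psi> ` V" "g y \<in> U" "g y \<in> U1"
      using that AB(7) gU V(3) gV(2) by blast+
    have *: "dd Y y (1, 0) = (\<rho> (g y) / dd h (g y) (V1 (g y))) *\<^sub>R n y"
      unfolding dY[OF that] dg(1)[OF y(1)] linear_scale[OF smooth_on_linear_dd[OF smooth(1) y(2)]] X1(1)[OF y(2)] n_def
      by simp
    then have "\<mu> y = \<rho> (g y) / dd h (g y) (V1 (g y))"
      using \<nu>(1)[OF y(2)] by (simp add: \<mu>_def lorentz_simps n_def)
    with * X1(2)[OF y(2)] y(3) show "dd Y y (1, 0) = \<mu> y *\<^sub>R n y" "\<mu> y \<noteq> 0"
      by (auto simp: U1_def)
  qed
  have n2: "dd n y (0, 1) = 0" if "y \<in> A \<times> B" for y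
  proof -
    have y: "y \<in> \<Psi> ` V" "g y \<in> U"
      using that AB(7) gU by blast+
    show ?thesis
      unfolding dn[OF that] dg(2)[OF y(1)] linear_scale[OF smooth_on_linear_dd[OF smooth(5) y(2)]] \<nu>2[OF y(2)]
      by simp
  qed
  \<comment> \<open>The base curve \<open>X0\<close> is the lift of the level curve of \<theta>
    through \<open>p\<close>; \<open>N\<close> is its unit tangent up to sign and \<open>n0\<close>
    its unit normal.\<close>
  define N where "N \<tau> = n (\<tau>, \<sigma>0)" for \<tau>
  define X0 where "X0 \<tau> = Y (\<tau>, \<sigma>0)" for \<tau>
  define n0 where "n0 \<tau> = lorentz_cross (X0 \<tau>) (N \<tau>)" for \<tau>
  have nN: "n (\<tau>, \<sigma>) = N \<tau>" if "\<tau> \<in> A" "\<sigma> \<in> B" for \<tau> \<sigma>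
    unfolding N_def
  proof (rule partial_zero_constant[OF AB(4) that(2) AB(6)])
    fix \<sigma> assume "\<sigma> \<in> B"
    then show "((\<lambda>\<sigma>. n (\<tau>, \<sigma>)) has_vector_derivative 0) (at \<sigma>)"
      using has_vector_derivative_partial(2)[OF smooth_on_differentiable[OF smooth_n, of "(\<tau>, \<sigma>)"]]
        n2[of "(\<tau>, \<sigma>)"] that(1) by simp
  qed
  have YY: "lorentz (Y y) (Y y) = -1" "Y y $ 1 > 0" "lorentz (n y) (n y) = 1" "lorentz (Y y) (n y) = 0"
    if "y \<in> A \<times> B" for y
    using gU[OF that] H \<nu> by (auto simp: Y_def n_def hyperbolic_plane_def)
  have fr: "lorentz (X0 \<tau>) (X0 \<tau>) = -1" "lorentz (N \<tau>) (N \<tau>) = 1" "lorentz (X0 \<tau>) (N \<tau>) = 0" if "\<tau> \<in> A" for \<tau>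
    using YY[of "(\<tau>, \<sigma>0)"] that AB(6) by (auto simp: X0_def N_def)
  have dY1: "((\<lambda>\<tau>. Y (\<tau>, \<sigma>)) has_vector_derivative \<mu> (\<tau>, \<sigma>) *\<^sub>R N \<tau>) (at \<tau>)" if "\<tau> \<in> A" "\<sigma> \<in> B" for \<tau> \<sigma>
    using has_vector_derivative_partial(1)[OF smooth_on_differentiable[OF smooth_Y, of "(\<tau>, \<sigma>)"]]
      Y1(1)[of "(\<tau>, \<sigma>)"] nN[OF that] that by simp
  note dX0 = dY1[OF _ AB(6), folded X0_def]
  have dN: "\<exists>N'. (N has_vector_derivative N') (at \<tau>) \<and> lorentz N' (N \<tau>) = 0" if "\<tau> \<in> A" for \<tau>
  proof -
    have *: "(N has_vector_derivative dd n (\<tau>, \<sigma>0) (1, 0)) (at \<tau>)"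
      using has_vector_derivative_partial(1)[OF smooth_on_differentiable[OF smooth_n, of "(\<tau>, \<sigma>0)"]] that AB(6)
      by (simp add: N_def[abs_def])
    have "lorentz (N \<tau>) (dd n (\<tau>, \<sigma>0) (1, 0)) + lorentz (dd n (\<tau>, \<sigma>0) (1, 0)) (N \<tau>) = 0"
      by (rule vector_derivative_const_on_open[OF AB(1) that fr(2) has_vector_derivative_lorentz[OF * *]])
    then show ?thesis
      using * lorentz_sym[of "N \<tau>"] by (metis add_0 double_zero)
  qed
  \<comment> \<open>Since \<open>Y\<close> is orthogonal to \<open>N \<tau>\<close>, these two
    components determine it: the hyperbolic cosine and sine of the signed distance from
    \<open>X0 \<tau>\<close> along the geodesic with normal \<open>N \<tau>\<close>.\<close>
  define C where "C \<tau> \<sigma> = - lorentz (Y (\<tau>, \<sigma>)) (X0 \<tau>)" for \<tau> \<sigma>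
  define S where "S \<tau> \<sigma> = lorentz (Y (\<tau>, \<sigma>)) (n0 \<tau>)" for \<tau> \<sigma>
  have YN: "lorentz (Y (\<tau>, \<sigma>)) (N \<tau>) = 0" if "\<tau> \<in> A" "\<sigma> \<in> B" for \<tau> \<sigma>
    using YY(4)[of "(\<tau>, \<sigma>)"] nN[OF that] that by simp
  have exp: "Y (\<tau>, \<sigma>) = C \<tau> \<sigma> *\<^sub>R X0 \<tau> + S \<tau> \<sigma> *\<^sub>R n0 \<tau>" if "\<tau> \<in> A" "\<sigma> \<in> B" for \<tau> \<sigma>
    using lorentz_frame_expansion[OF fr[OF that(1)], of "Y (\<tau>, \<sigma>)"] YN[OF that]
    by (simp add: C_def S_def n0_def)
  have nn: "lorentz (n0 \<tau>) (n0 \<tau>) = 1" if "\<tau> \<in> A" for \<tau>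
    using fr[OF that] by (simp add: n0_def lorentz_cross_lagrange lorentz_sym[of "N \<tau>" "X0 \<tau>"])
  \<comment> \<open>The derivative of \<open>Y\<close> in \<tau> is a multiple of \<open>N\<close>,
    hence orthogonal to \<open>n0\<close>. The derivative of \<open>n0\<close> is the cross product
    of \<open>X0\<close> with a vector orthogonal to \<open>N\<close>, hence orthogonal to both
    \<open>X0\<close> and \<open>n0\<close>, which span \<open>Y\<close>. So both terms of the
    product rule vanish.\<close>
  have S_const: "S \<tau> \<sigma> = S \<tau>0 \<sigma>" if "\<tau> \<in> A" "\<sigma> \<in> B" for \<tau> \<sigma>
  proof (rule partial_zero_constant[OF AB(3) that(1) AB(5)])
    fix \<tau> assume \<tau>: "\<tau> \<in> A"
    obtain N' where N': "(N has_vector_derivative N') (at \<tau>)" "lorentz N' (N \<tau>) = 0"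
      using dN[OF \<tau>] by blast
    have "(n0 has_vector_derivative (lorentz_cross (X0 \<tau>) N' + lorentz_cross (\<mu> (\<tau>, \<sigma>0) *\<^sub>R N \<tau>) (N \<tau>))) (at \<tau>)"
      unfolding n0_def[abs_def]
      by (rule bounded_bilinear.has_vector_derivative[OF bounded_bilinear_lorentz_cross dX0[OF \<tau>] N'(1)])
    then have "(n0 has_vector_derivative lorentz_cross (X0 \<tau>) N') (at \<tau>)"
      by (simp add: lorentz_cross_simps)
    from has_vector_derivative_lorentz[OF dY1[OF \<tau> that(2)] this]
    have "((\<lambda>\<tau>. S \<tau> \<sigma>) has_vector_derivative (lorentz (Y (\<tau>, \<sigma>)) (lorentz_cross (X0 \<tau>) N')
        + lorentz (\<mu> (\<tau>, \<sigma>) *\<^sub>R N \<tau>) (n0 \<tau>))) (at \<tau>)"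
      unfolding S_def .
    moreover have "lorentz (Y (\<tau>, \<sigma>)) (lorentz_cross (X0 \<tau>) N') = 0"
      using fr[OF \<tau>] N'(2) lorentz_sym[of "N \<tau>" N'] lorentz_sym[of "N \<tau>" "X0 \<tau>"]
      by (simp add: exp[OF \<tau> that(2)] lorentz_simps n0_def lorentz_cross_lagrange)
    moreover have "lorentz (\<mu> (\<tau>, \<sigma>) *\<^sub>R N \<tau>) (n0 \<tau>) = 0"
      by (simp add: n0_def lorentz_simps)
    ultimately show "((\<lambda>\<tau>. S \<tau> \<sigma>) has_vector_derivative 0) (at \<tau>)"
      by simp
  qed
  define sh where "sh \<sigma> = S \<tau>0 \<sigma>" for \<sigma>
  have C_sh: "C \<tau> \<sigma> = sqrt (1 + (sh \<sigma>)\<^sup>2)" if "\<tau> \<in> A" "\<sigma> \<in> B" for \<tau> \<sigma>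
  proof -
    have "lorentz (Y (\<tau>, \<sigma>)) (Y (\<tau>, \<sigma>)) = (S \<tau> \<sigma>)\<^sup>2 - (C \<tau> \<sigma>)\<^sup>2"
      using fr[OF that(1)] nn[OF that(1)]
      by (subst (1 2) exp[OF that]) (simp add: lorentz_simps n0_def power2_eq_square algebra_simps)
    then have "(C \<tau> \<sigma>)\<^sup>2 = 1 + (sh \<sigma>)\<^sup>2"
      using YY(1)[of "(\<tau>, \<sigma>)"] that S_const[OF that] by (simp add: sh_def)
    \<comment> \<open>Both points lie on the same sheet of the hyperboloid, which selects the
      positive root.\<close>
    moreover have "C \<tau> \<sigma> > 0"
      using lorentz_future_neg[of "Y (\<tau>, \<sigma>)" "X0 \<tau>"] YY[of "(\<tau>, \<sigma>)"] YY[of "(\<tau>, \<sigma>0)"] that AB(6)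
      by (simp add: C_def X0_def)
    ultimately show ?thesis
      by (metis real_sqrt_unique less_imp_le)
  qed
  have sh_deriv: "(sh has_real_derivative lorentz (dd Y (\<tau>0, \<sigma>) (0, 1)) (n0 \<tau>0)) (at \<sigma>)" if "\<sigma> \<in> B" for \<sigma>
    unfolding sh_def[abs_def] S_def
    by (rule has_vector_derivative_lorentz_const[OF has_vector_derivative_partial(2)[OF
            smooth_on_differentiable[OF smooth_Y]]]) (use that AB(5) in simp)
  define sh' where "sh' \<sigma> = lorentz (dd Y (\<tau>0, \<sigma>) (0, 1)) (n0 \<tau>0)" for \<sigma>
  have slice: "smooth_on B (\<lambda>\<sigma>. G (\<tau>0, \<sigma>))" if "smooth_on (A \<times> B) G" for G :: "real \<times> real \<Rightarrow> real^3"
    by (rule smooth_on_compose[OF that _ AB(2,8)]) (use AB in \<open>auto intro!: smooth_intros\<close>)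
  have slice1: "smooth_on A (\<lambda>\<tau>. G (\<tau>, \<sigma>0))" if "smooth_on (A \<times> B) G" for G :: "real \<times> real \<Rightarrow> 'z::real_normed_vector"
    by (rule smooth_on_compose[OF that _ AB(1,8)]) (use AB in \<open>auto intro!: smooth_intros\<close>)
  have smooth_sh: "smooth_on B sh"
    unfolding sh_def[abs_def] S_def by (intro smooth_intros AB slice smooth_Y)
  have smooth_sh': "smooth_on B sh'"
    unfolding sh'_def[abs_def]
    by (rule smooth_on_lorentz[OF AB(2) slice[OF smooth_on_dd_const[OF smooth_Y]] smooth_on_const])
  have sh0: "sh \<sigma>0 = 0"
    by (simp add: sh_def S_def n0_def X0_def)
  have sh'0: "sh' \<sigma>0 > 0"
  proof -
    have y: "(\<tau>0, \<sigma>0) \<in> A \<times> B" "(\<tau>0, \<sigma>0) \<in> \<Psi> ` V"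
      using AB by auto
    have "dd Y (\<tau>0, \<sigma>0) (0, 1) = (1 / dd \<theta> p (V2 p)) *\<^sub>R dd X p (V2 p)"
      unfolding dY[OF y(1)] dg(2)[OF y(2)] gp linear_scale[OF smooth_on_linear_dd[OF smooth(1) U(2)]] ..
    then show ?thesis
      using pos by (simp add: sh'_def n0_def X0_def N_def Y_def n_def gp lorentz_simps)
  qed
  \<comment> \<open>Positivity at \<sigma>0 is what \<open>pos\<close> provides; on this
    neighbourhood it persists and makes \<open>a\<close> increasing.\<close>
  define B1 where "B1 = B \<inter> sh' -` {0<..}"
  have "open B1" "\<sigma>0 \<in> B1"
    unfolding B1_def using sh'0 AB by (auto intro!: continuous_open_preimage smooth_on_continuous smooth_sh')
  then obtain r3 where r3: "r3 > 0" "ball \<sigma>0 r3 \<subseteq> B1"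
    using open_contains_ball by blast
  have r3B: "ball \<sigma>0 r3 \<subseteq> B" using r3(2) by (auto simp: B1_def)
  obtain b \<delta> where b: "\<delta> > 0" "diffeomorphism_on (ball 0 \<delta>) (b ` ball 0 \<delta>) b"
    "b ` ball 0 \<delta> \<subseteq> ball \<sigma>0 r3" "b 0 = \<sigma>0" "\<And>u. u \<in> ball 0 \<delta> \<Longrightarrow> sh (b u) = u"
    "\<And>u. u \<in> ball 0 \<delta> \<Longrightarrow> (b has_real_derivative inverse (sh' (b u))) (at u)"
    "\<And>u. u \<in> ball 0 \<delta> \<Longrightarrow> sh' (b u) \<noteq> 0"
  proof (rule smooth_inverse_real[OF r3(1) smooth_on_subset[OF smooth_sh r3B], of sh', unfolded sh0])
    show "(sh has_real_derivative sh' y) (at y)" if "y \<in> ball \<sigma>0 r3" for y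
      using sh_deriv[of y] that r3B by (auto simp: sh'_def)
  qed (use sh'0 in auto)
  \<comment> \<open>Near 0 also \<open>sinh\<close> is a diffeomorphism, so that its composition
    with \<open>b\<close> is one.\<close>
  have "smooth_on UNIV (sinh :: real \<Rightarrow> real)"
    using smooth_on_sinh[OF open_UNIV smooth_on_ident[OF open_UNIV]] .
  moreover have sinh': "(sinh has_real_derivative cosh s) (at s)" for s :: real
    by (auto intro!: derivative_eq_intros)
  moreover have "dd sinh 0 1 = (1::real)"
    using dd_eq[of sinh "(*) (cosh 0)" 0 1] sinh'[of 0] by (simp add: has_field_derivative_def)
  ultimately obtain V0 :: "real set" where V0: "open V0" "0 \<in> V0" "diffeomorphism_on V0 (sinh ` V0) sinh"
    using smooth_local_diffeo_real[OF open_UNIV UNIV_I, of sinh 0 thesis] by auto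
  have "open (V0 \<inter> sinh -` ball 0 \<delta>)"
    using V0(1) by (intro open_Int open_vimage continuous_intros) auto
  moreover have "0 \<in> V0 \<inter> sinh -` ball 0 \<delta>"
    using V0(2) b(1) by auto
  ultimately obtain r4 where r4: "r4 > 0" "ball 0 r4 \<subseteq> V0 \<inter> sinh -` ball 0 \<delta>"
    using open_contains_ball by blast
  define I where "I = ball (0::real) r4"
  \<comment> \<open>As \<open>sh\<close> is the hyperbolic sine of the signed distance and
    \<open>b\<close> inverts it, \<open>a s\<close> is the value of \<theta> at distance
    \<open>s\<close> from the base curve.\<close>
  define a where "a s = b (sinh s)" for s
  have sI: "sinh s \<in> ball 0 \<delta>" if "s \<in> I" for s
    using that r4(2) by (auto simp: I_def)
  have a_diffeo: "diffeomorphism_on I (a ` I) a"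
  proof -
    have s: "diffeomorphism_on I (sinh ` I) sinh"
      using diffeomorphism_on_restrict[OF V0(3), of I] r4(2) by (auto simp: I_def)
    then have "open (sinh ` I)" by (auto simp: diffeomorphism_on_def)
    then have "diffeomorphism_on (sinh ` I) (b ` (sinh ` I)) b"
      using diffeomorphism_on_restrict[OF b(2), of "sinh ` I"] sI by blast
    from diffeomorphism_on_compose[OF s this] show ?thesis
      by (simp add: a_def[abs_def] image_image)
  qed
  have aB: "a s \<in> B1" "sh (a s) = sinh s" if "s \<in> I" for s
    using imageI[OF sI[OF that], of b] b(3) r3(2) b(5)[OF sI[OF that]] unfolding a_def by blast+
  have height: "height_function I a"
    unfolding height_function_def
  proof (intro conjI ballI)
    show "open_interval I"
      unfolding I_def by (rule open_interval_ball[OF r4(1)])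
    show "smooth_on I a"
      using a_diffeo by (simp add: diffeomorphism_on_def)
    fix s assume s: "s \<in> I"
    have "(a has_real_derivative inverse (sh' (a s)) * cosh s) (at s)"
      unfolding a_def[abs_def] using DERIV_chain2[OF b(6)[OF sI[OF s]] sinh'] by simp
    moreover have "sh' (a s) > 0"
      using aB(1)[OF s] by (simp add: B1_def)
    ultimately show "deriv a s > 0"
      by (simp add: DERIV_imp_deriv)
  qed
  \<comment> \<open>\<open>T\<close> is arc length of the base curve carrying the sign of \<mu>.
    With its inverse as parameter change the velocity of \<gamma> is \<open>N\<close> itself rather
    than its opposite, and the normal of \<gamma> is \<open>n0\<close>.\<close>
  obtain T r5 where T: "0 < r5" "r5 \<le> r1" "smooth_on (ball \<tau>0 r5) T"
    "\<And>\<tau>. \<tau> \<in> ball \<tau>0 r5 \<Longrightarrow> (T has_real_derivative \<mu> (\<tau>, \<sigma>0)) (at \<tau>)"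
    using smooth_antiderivative_exists[OF r(1), of \<tau>0 "\<lambda>\<tau>. \<mu> (\<tau>, \<sigma>0)"] slice1[OF smooth_\<mu>]
    unfolding A_def by metis
  have r5A: "ball \<tau>0 r5 \<subseteq> A"
    using T(2) by (auto simp: A_def)
  obtain c r6 where c: "r6 > 0" "diffeomorphism_on (ball (T \<tau>0) r6) (c ` ball (T \<tau>0) r6) c"
    "c ` ball (T \<tau>0) r6 \<subseteq> ball \<tau>0 r5" "c (T \<tau>0) = \<tau>0"
    "\<And>t. t \<in> ball (T \<tau>0) r6 \<Longrightarrow> (c has_real_derivative inverse (\<mu> (c t, \<sigma>0))) (at t)"
    using smooth_inverse_real[OF T(1,3,4)] Y1(2)[of "(\<tau>0, \<sigma>0)"] AB(5,6) by (metis mem_Sigma_iff)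
  define J where "J = ball (T \<tau>0) r6"
  define \<gamma> where "\<gamma> t = X0 (c t)" for t
  have cA: "c t \<in> A" if "t \<in> J" for t
    using that c(3) r5A unfolding J_def by blast
  have c': "(c has_vector_derivative inverse (\<mu> (c t, \<sigma>0))) (at t)" if "t \<in> J" for t
    using c(5) that by (simp add: J_def has_real_derivative_iff_has_vector_derivative)
  have \<gamma>': "(\<gamma> has_vector_derivative N (c t)) (at t)" if "t \<in> J" for t
  proof -
    have "((X0 \<circ> c) has_vector_derivative inverse (\<mu> (c t, \<sigma>0)) *\<^sub>R (\<mu> (c t, \<sigma>0) *\<^sub>R N (c t))) (at t)"
      by (rule vector_diff_chain_at[OF c'[OF that] dX0[OF cA[OF that]]])
    then show ?thesis
      using Y1(2)[of "(c t, \<sigma>0)"] cA[OF that] AB(6) by (simp add: \<gamma>_def[abs_def] o_def)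
  qed
  have unit: "unit_speed_curve J \<gamma>"
    unfolding unit_speed_curve_def
  proof (intro conjI ballI)
    show "open_interval J"
      unfolding J_def by (rule open_interval_ball[OF c(1)])
    have "smooth_on A X0"
      unfolding X0_def[abs_def] by (rule slice1[OF smooth_Y])
    moreover have "smooth_on J c" "open J"
      using c(2) by (auto simp: diffeomorphism_on_def J_def)
    ultimately show "smooth_on J \<gamma>"
      unfolding \<gamma>_def[abs_def]
      by (rule smooth_on_compose[of A X0 J c]) (use cA AB(1) in auto)
    show "\<gamma> ` J \<subseteq> hyperbolic_plane"
      using cA H gU AB(6) by (auto simp: \<gamma>_def X0_def Y_def)
    show "lorentz (vector_derivative \<gamma> (at t)) (vector_derivative \<gamma> (at t)) = 1" if "t \<in> J" for t
      using vector_derivative_at[OF \<gamma>'[OF that]] fr(2)[OF cA[OF that]] by simp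
  qed
  have lift: "lift_map \<gamma> a (t, s) = (Y (c t, a s), a s)" if "t \<in> J" "s \<in> I" for t s
  proof -
    have s: "a s \<in> B" using aB(1)[OF that(2)] by (simp add: B1_def)
    have "S (c t) (a s) = sinh s" "C (c t) (a s) = cosh s"
      using S_const[OF cA[OF that(1)] s] C_sh[OF cA[OF that(1)] s] aB(2)[OF that(2)]
        cosh_square_eq[of s, symmetric]
      by (simp_all only: sh_def[symmetric] add.commute[of 1] real_sqrt_abs abs_of_nonneg[OF cosh_real_nonneg])
    then have "Y (c t, a s) = cosh s *\<^sub>R \<gamma> t + sinh s *\<^sub>R lorentz_cross (\<gamma> t) (N (c t))"
      using exp[OF cA[OF that(1)] s] by (simp add: \<gamma>_def n0_def)
    then show ?thesis
      by (simp add: lift_map_def parallel_curve_def vector_derivative_at[OF \<gamma>'[OF that(1)]])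
  qed
  define \<psi> where "\<psi> q = g (c (fst q), a (snd q))" for q
  define W where "W = \<psi> ` (J \<times> I)"
  have aIB: "a ` I \<subseteq> B" using aB(1) by (auto simp: B1_def)
  have \<psi>: "diffeomorphism_on (J \<times> I) W \<psi>"
  proof -
    have 1: "diffeomorphism_on (J \<times> I) (c ` J \<times> a ` I) (\<lambda>q. (c (fst q), a (snd q)))"
      using c(2) by (intro diffeomorphism_on_Times a_diffeo) (simp add: J_def)
    have "c ` J \<times> a ` I \<subseteq> A \<times> B"
      using cA aIB by (intro Sigma_mono) auto
    then have "diffeomorphism_on (c ` J \<times> a ` I) (g ` (c ` J \<times> a ` I)) g"
      using AB(7) 1 by (intro diffeomorphism_on_restrict[OF g(1)]) (simp_all add: diffeomorphism_on_def)
    from diffeomorphism_on_compose[OF 1 this]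
    have "diffeomorphism_on (J \<times> I) (g ` (c ` J \<times> a ` I)) \<psi>"
      by (simp add: \<psi>_def[abs_def])
    then show ?thesis
      unfolding W_def by (auto simp: diffeomorphism_on_def bij_betw_def)
  qed
  have \<psi>_AB: "(c (fst q), a (snd q)) \<in> A \<times> B" if "q \<in> J \<times> I" for q
    using that cA aIB by auto
  have lift': "lift_map \<gamma> a q = (X (\<psi> q), \<theta> (\<psi> q))" if "q \<in> J \<times> I" for q
  proof -
    have "\<Psi> (\<psi> q) = (c (fst q), a (snd q))"
      unfolding \<psi>_def using g(3) \<psi>_AB[OF that] AB(7) by blast
    then show ?thesis
      using lift[of "fst q" "snd q"] that by (auto simp: \<psi>_def Y_def \<Psi>_def)
  qed
  have "p \<in> W"
  proof -
    have "\<psi> (T \<tau>0, 0) = p"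
      using c(4) b(4) gp by (simp add: \<psi>_def a_def)
    moreover have "(T \<tau>0, 0) \<in> J \<times> I"
      using c(1) r4(1) by (simp add: J_def I_def)
    ultimately show ?thesis
      unfolding W_def by (metis imageI)
  qed
  moreover have "W \<subseteq> U"
    unfolding W_def \<psi>_def using gU \<psi>_AB by blast
  moreover have "regular_points (J \<times> I) (lift_map \<gamma> a) = J \<times> I"
  proof -
    interpret F: parallel_family e0 e1 e2 J I \<gamma> a
      using e unit height by unfold_locales
    \<comment> \<open>The derivative in \<open>t\<close> of \<open>Y (c t, a s)\<close> is
      \<open>N\<close> times a quotient of two values of \<mu>, neither of which is zero. So every
      parallel curve in the family is regular.\<close>
    have "F.lam q \<noteq> 0" if qJI: "q \<in> J \<times> I" for q
    proof
      obtain t s where q: "q = (t, s)" "t \<in> J" "s \<in> I" using qJI by auto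
      have s: "a s \<in> B" using aIB q(3) by blast
      assume "F.lam q = 0"
      then have "((\<lambda>t. F.X (t, s)) has_vector_derivative 0) (at t)"
        using F.X_partial(1)[OF qJI[unfolded q(1)]] by (simp add: q(1))
      then have 0: "((\<lambda>t. Y (c t, a s)) has_vector_derivative 0) (at t)"
        by (rule has_vector_derivative_transform_within_open[OF _ F.open_J q(2)])
          (use F.lift_map_eq lift q(3) in auto)
      have "(((\<lambda>\<tau>. Y (\<tau>, a s)) \<circ> c) has_vector_derivative
          inverse (\<mu> (c t, \<sigma>0)) *\<^sub>R (\<mu> (c t, a s) *\<^sub>R N (c t))) (at t)"
        by (rule vector_diff_chain_at[OF c'[OF q(2)] dY1[OF cA[OF q(2)] s]])
      then have "inverse (\<mu> (c t, \<sigma>0)) *\<^sub>R (\<mu> (c t, a s) *\<^sub>R N (c t)) = 0"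
        using vector_derivative_unique_at[OF 0[folded o_def[of "\<lambda>\<tau>. Y (\<tau>, a s)" c]]] by metis
      moreover have "N (c t) \<noteq> 0"
        using fr(2)[OF cA[OF q(2)]] by (auto simp: lorentz_simps)
      ultimately show False
        using Y1(2)[of "(c t, \<sigma>0)"] Y1(2)[of "(c t, a s)"] cA[OF q(2)] AB(6) s by simp
    qed
    then show ?thesis
      using F.M_eq by (auto simp: F.M_def)
  qed
  ultimately show ?thesis
    using unit height \<psi> lift' by blast
qed

section \<open>Lifting a Joachimsthal surface to the hyperbolic plane\<close>

lemma smooth_local_angle:
  fixes c s :: "'a::euclidean_space \<Rightarrow> real"
  assumes "open U" "p \<in> U" "smooth_on U c" "smooth_on U s" "\<And>q. q \<in> U \<Longrightarrow> (c q)\<^sup>2 + (s q)\<^sup>2 = 1"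
  obtains V \<theta> where "open V" "p \<in> V" "V \<subseteq> U" "smooth_on V \<theta>"
    "\<And>q. q \<in> V \<Longrightarrow> c q = cos (\<theta> q)" "\<And>q. q \<in> V \<Longrightarrow> s q = sin (\<theta> q)"
proof -
  obtain t where t: "c p = cos t" "s p = sin t"
    using sincos_total_2pi[OF assms(5)[OF assms(2)]] by metis
  \<comment> \<open>Rotating by \<open>-t\<close> moves the value at \<open>p\<close> to angle 0,
    where the cosine is positive and \<open>arctan\<close> recovers the angle.\<close>
  define c' s' where "c' q = c q * cos t + s q * sin t" and "s' q = s q * cos t - c q * sin t" for q
  have smooth: "smooth_on U c'" "smooth_on U s'"
    unfolding c'_def[abs_def] s'_def[abs_def] by (intro smooth_intros assms)+
  define V where "V = U \<inter> c' -` {0<..}"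
  have V: "open V" "V \<subseteq> U"
    unfolding V_def using assms(1) smooth(1) by (auto intro!: continuous_open_preimage smooth_on_continuous)
  have "c' p = 1"
    using sin_cos_squared_add[of t] by (simp add: c'_def t power2_eq_square)
  then have "p \<in> V"
    using assms(2) by (simp add: V_def)
  define \<theta> where "\<theta> q = t + arctan (s' q / c' q)" for q
  have "cos (arctan (s' q / c' q)) = c' q \<and> sin (arctan (s' q / c' q)) = s' q" if "q \<in> V" for q
  proof -
    have pos: "c' q > 0" using that by (simp add: V_def)
    have "(c' q)\<^sup>2 + (s' q)\<^sup>2 = ((c q)\<^sup>2 + (s q)\<^sup>2) * ((cos t)\<^sup>2 + (sin t)\<^sup>2)"
      unfolding c'_def s'_def by algebra
    then have "(c' q)\<^sup>2 + (s' q)\<^sup>2 = 1"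
      using assms(5) that V(2) by auto
    then have "1 + (s' q / c' q)\<^sup>2 = (1 / c' q)\<^sup>2"
      using pos by (simp add: field_simps)
    then have "sqrt (1 + (s' q / c' q)\<^sup>2) = 1 / c' q"
      using pos by simp
    then show ?thesis
      using pos by (simp add: cos_arctan sin_arctan)
  qed
  moreover have "cos t * c' q - sin t * s' q = c q * ((cos t)\<^sup>2 + (sin t)\<^sup>2)"
    "sin t * c' q + cos t * s' q = s q * ((cos t)\<^sup>2 + (sin t)\<^sup>2)" for q
    unfolding c'_def s'_def by algebra+
  ultimately have "c q = cos (\<theta> q)" "s q = sin (\<theta> q)" if "q \<in> V" for q
    using that by (simp_all add: \<theta>_def cos_add sin_add)
  moreover have "smooth_on V \<theta>"
    unfolding \<theta>_def[abs_def]
    by (intro smooth_intros V smooth_on_subset[OF smooth(1) V(2)] smooth_on_subset[OF smooth(2) V(2)])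
      (auto simp: V_def)
  ultimately show thesis
    using that V \<open>p \<in> V\<close> by metis
qed

text \<open>The relations leave the time orientation of \<open>e0\<close> open, so the lift has to
  take account of the sign of \<open>e0 $ 1\<close>; a null vector with vanishing time coordinate
  would be zero.\<close>

lemma pseudo_orthonormal_e0_nonzero:
  assumes "pseudo_orthonormal e0 e1 e2"
  shows "e0 $ 1 \<noteq> 0"
proof
  assume 0: "e0 $ 1 = 0"
  then have "e0 $ 2 * e0 $ 2 + e0 $ 3 * e0 $ 3 = 0"
    using assms by (simp add: pseudo_orthonormal_def lorentz_def)
  then have "e0 = 0"
    using 0 by (simp add: sum_squares_eq_zero_iff vec_eq_iff forall_3)
  then show False
    using assms by (simp add: pseudo_orthonormal_def lorentz_simps)
qed

text \<open>By \<open>angle\<close>, \<open>x0\<close> is up to sign the reciprocal distance to the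
  axis. Its sign is tied to that of \<open>e0 $ 1\<close> in order to reach the upper sheet; a
  negative \<open>x0\<close> shifts the angle by half a turn.\<close>

locale hyperbolic_lift =
  fixes e0 e1 e2 :: "real^3" and U :: "(real \<times> real) set" and y :: "real \<times> real \<Rightarrow> real^3"
    and x0 \<theta> :: "real \<times> real \<Rightarrow> real"
  assumes e: "pseudo_orthonormal e0 e1 e2"
    and U: "open U" and smooth: "smooth_on U y" "smooth_on U x0" "smooth_on U \<theta>"
    and x0: "\<And>q. q \<in> U \<Longrightarrow> x0 q * e0 $ 1 > 0"
    and angle: "\<And>q. q \<in> U \<Longrightarrow> x0 q * y q $ 2 = cos (\<theta> q)" "\<And>q. q \<in> U \<Longrightarrow> x0 q * y q $ 3 = sin (\<theta> q)"
begin

text \<open>The solution of \<open>Phi e0 e1 e2 (X q, \<theta> q) = y q\<close>. The definition of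
  \<open>Phi\<close> gives the first two coordinates, and the third is forced by the hyperboloid
  equation together with the value of \<open>x0\<close>.\<close>

definition X where "X q = x0 q *\<^sub>R (e0 + y q $ 1 *\<^sub>R e1 + (y q \<bullet> y q) *\<^sub>R e2)"

text \<open>The component of \<open>w\<close> in the direction of rotation about the axis at \<open>y q\<close>, times the distance of
  \<open>y q\<close> to the axis.\<close>

definition b where "b q w = y q $ 2 * w $ 3 - y q $ 3 * w $ 2"

lemma e_simps: "lorentz e0 e0 = 0" "lorentz e1 e1 = 1" "lorentz e2 e2 = 0" "lorentz e0 e1 = 0"
  "lorentz e1 e0 = 0" "lorentz e0 e2 = -1/2" "lorentz e2 e0 = -1/2" "lorentz e1 e2 = 0" "lorentz e2 e1 = 0"
  using e lorentz_sym[of e0 e1] lorentz_sym[of e2 e1] lorentz_sym[of e0 e2]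
  by (simp_all add: pseudo_orthonormal_def)

lemma smooth_X: "smooth_on U X"
  unfolding X_def[abs_def] by (intro smooth_intros U smooth)

lemma x0_radius:
  assumes "q \<in> U"
  shows "(x0 q)\<^sup>2 * ((y q $ 2)\<^sup>2 + (y q $ 3)\<^sup>2) = 1"
proof -
  have "(x0 q * y q $ 2)\<^sup>2 + (x0 q * y q $ 3)\<^sup>2 = 1"
    using sin_cos_squared_add[of "\<theta> q"] by (simp add: angle[OF assms] add.commute)
  then show ?thesis
    by (simp add: power_mult_distrib distrib_left)
qed

text \<open>Links geodesics to spheres: after division by \<open>x0\<close>, orthogonality to a
  fixed vector is a quadratic equation for \<open>y q\<close> that involves only its norm and its
  axial coordinate.\<close>

lemma lorentz_X:
  "lorentz (X q) (g0 *\<^sub>R e0 + g1 *\<^sub>R e1 + g2 *\<^sub>R e2) = x0 q * (g1 * y q $ 1 - (g2 + g0 * (y q \<bullet> y q)) / 2)"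
  by (simp add: X_def lorentz_simps e_simps algebra_simps)

lemma X_norm:
  assumes "q \<in> U"
  shows "lorentz (X q) (X q) = -1"
proof -
  have "lorentz (X q) (X q) = - ((x0 q)\<^sup>2 * ((y q $ 2)\<^sup>2 + (y q $ 3)\<^sup>2))"
    unfolding X_def lorentz_simps e_simps inner_3 by (simp add: power2_eq_square algebra_simps)
  then show ?thesis
    using x0_radius[OF assms] by simp
qed

text \<open>On the lower sheet \<open>- X q\<close> would be future directed, as
  \<open>x0 q *\<^sub>R e0\<close> is, and their product would be negative; but it is half of
  \<open>(x0 q)\<^sup>2 * (y q \<bullet> y q)\<close>.\<close>

lemma X_hyperbolic:
  assumes "q \<in> U"
  shows "X q \<in> hyperbolic_plane"
proof -
  have "X q $ 1 \<noteq> 0"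
  proof
    assume "X q $ 1 = 0"
    then have "lorentz (X q) (X q) = X q $ 2 * X q $ 2 + X q $ 3 * X q $ 3"
      by (simp add: lorentz_def)
    then show False
      using X_norm[OF assms] sum_squares_ge_zero[of "X q $ 2" "X q $ 3"] by simp
  qed
  moreover have "\<not> X q $ 1 < 0"
  proof
    assume "X q $ 1 < 0"
    then have "lorentz (- X q) (x0 q *\<^sub>R e0) < 0"
      using X_norm[OF assms] x0[OF assms]
      by (intro lorentz_future_neg) (simp_all add: lorentz_simps e_simps)
    moreover have "lorentz (- X q) (x0 q *\<^sub>R e0) = (x0 q)\<^sup>2 * (y q \<bullet> y q) / 2"
      by (simp add: X_def lorentz_simps e_simps power2_eq_square)
    moreover have "(x0 q)\<^sup>2 * (y q \<bullet> y q) \<ge> 0"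
      by simp
    ultimately show False
      by linarith
  qed
  ultimately show ?thesis
    using X_norm[OF assms] by (simp add: hyperbolic_plane_def)
qed

lemma Phi_X:
  assumes "q \<in> U"
  shows "Phi e0 e1 e2 (X q, \<theta> q) = y q"
proof -
  have "X q = x0 q *\<^sub>R e0 + (x0 q * y q $ 1) *\<^sub>R e1 + (x0 q * (y q \<bullet> y q)) *\<^sub>R e2"
    by (simp add: X_def scaleR_add_right)
  then have "Phi e0 e1 e2 (X q, \<theta> q) = (1 / x0 q) *\<^sub>R vector [x0 q * y q $ 1, cos (\<theta> q), sin (\<theta> q)]"
    using Phi_eq[OF e] by metis
  then show ?thesis
    using x0[OF assms] by (auto simp: angle[OF assms, symmetric] vec_eq_iff forall_3)
qed

text \<open>Implicit differentiation of \<open>x0_radius\<close>.\<close>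

lemma dd_x0:
  assumes "q \<in> U"
  shows "dd x0 q v = - (x0 q ^ 3 * (y q $ 2 * dd y q v $ 2 + y q $ 3 * dd y q v $ 3))"
proof -
  note d0 = smooth_on_derivative[OF smooth(2) assms]
  have d: "((\<lambda>q. y q $ i) has_derivative (\<lambda>v. dd y q v $ i)) (at q)" for i
    by (rule bounded_linear.has_derivative[OF bounded_linear_vec_nth smooth_on_derivative[OF smooth(1) assms]])
  let ?r = "\<lambda>q. y q $ 2 * y q $ 2 + y q $ 3 * y q $ 3"
  have "((\<lambda>q. (x0 q * x0 q) * ?r q) has_derivative (\<lambda>v. x0 q * x0 q * ((y q $ 2 * dd y q v $ 2 + dd y q v $ 2 * y q $ 2)
      + (y q $ 3 * dd y q v $ 3 + dd y q v $ 3 * y q $ 3)) + (x0 q * dd x0 q v + dd x0 q v * x0 q) * ?r q)) (at q)"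
    by (intro has_derivative_mult has_derivative_add d d0)
  then have "x0 q * x0 q * ((y q $ 2 * dd y q v $ 2 + dd y q v $ 2 * y q $ 2)
      + (y q $ 3 * dd y q v $ 3 + dd y q v $ 3 * y q $ 3)) + (x0 q * dd x0 q v + dd x0 q v * x0 q) * ?r q = 0"
    by (rule dd_const_on_open[OF U assms, of _ 1, rotated]) (use x0_radius in \<open>simp add: power2_eq_square\<close>)
  then have "x0 q * (x0 q ^ 3 * (y q $ 2 * dd y q v $ 2 + y q $ 3 * dd y q v $ 3) + dd x0 q v * ((x0 q)\<^sup>2 * ((y q $ 2)\<^sup>2 + (y q $ 3)\<^sup>2))) = 0"
    by algebra
  then show ?thesis
    using x0[OF assms] by (auto simp: x0_radius[OF assms])
qed

text \<open>The usual differential of the polar angle. Differentiating both the cosine and the sine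
  identity covers the points where one of them gives no information.\<close>

lemma dd_\<theta>:
  assumes "q \<in> U"
  shows "dd \<theta> q v = (x0 q)\<^sup>2 * b q (dd y q v)"
proof -
  note d0 = smooth_on_derivative[OF smooth(2) assms] and d\<theta> = smooth_on_derivative[OF smooth(3) assms]
  have d: "((\<lambda>q. y q $ i) has_derivative (\<lambda>v. dd y q v $ i)) (at q)" for i
    by (rule bounded_linear.has_derivative[OF bounded_linear_vec_nth smooth_on_derivative[OF smooth(1) assms]])
  have "((\<lambda>q. x0 q * y q $ 2 - cos (\<theta> q)) has_derivative
      (\<lambda>v. (x0 q * dd y q v $ 2 + dd x0 q v * y q $ 2) - dd \<theta> q v * - sin (\<theta> q))) (at q)"
    by (intro has_derivative_diff has_derivative_mult d d0 DERIV_compose_FDERIV[OF DERIV_cos] d\<theta>)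
  then have "(x0 q * dd y q v $ 2 + dd x0 q v * y q $ 2) - dd \<theta> q v * - sin (\<theta> q) = 0"
    by (rule dd_const_on_open[OF U assms, of _ 0, rotated]) (simp add: angle)
  moreover have "((\<lambda>q. x0 q * y q $ 3 - sin (\<theta> q)) has_derivative
      (\<lambda>v. (x0 q * dd y q v $ 3 + dd x0 q v * y q $ 3) - dd \<theta> q v * cos (\<theta> q))) (at q)"
    by (intro has_derivative_diff has_derivative_mult d d0 DERIV_compose_FDERIV[OF DERIV_sin] d\<theta>)
  then have "(x0 q * dd y q v $ 3 + dd x0 q v * y q $ 3) - dd \<theta> q v * cos (\<theta> q) = 0"
    by (rule dd_const_on_open[OF U assms, of _ 0, rotated]) (simp add: angle)
  ultimately have "((sin (\<theta> q))\<^sup>2 + (cos (\<theta> q))\<^sup>2) * dd \<theta> q v = (x0 q)\<^sup>2 * b q (dd y q v)"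
    unfolding b_def angle[OF assms, symmetric] by algebra
  then show ?thesis by simp
qed

lemma dd_X:
  assumes "q \<in> U"
  shows "dd X q v = dd x0 q v *\<^sub>R (e0 + y q $ 1 *\<^sub>R e1 + (y q \<bullet> y q) *\<^sub>R e2)
    + x0 q *\<^sub>R (dd y q v $ 1 *\<^sub>R e1 + (2 * (y q \<bullet> dd y q v)) *\<^sub>R e2)"
proof -
  note d0 = smooth_on_derivative[OF smooth(2) assms] and dy = smooth_on_derivative[OF smooth(1) assms]
  have d1: "((\<lambda>q. y q $ 1 *\<^sub>R e1) has_derivative (\<lambda>v. dd y q v $ 1 *\<^sub>R e1)) (at q)"
    by (rule bounded_linear.has_derivative[OF bounded_linear_scaleR_left
          bounded_linear.has_derivative[OF bounded_linear_vec_nth dy]])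
  have d2: "((\<lambda>q. (y q \<bullet> y q) *\<^sub>R e2) has_derivative (\<lambda>v. (y q \<bullet> dd y q v + dd y q v \<bullet> y q) *\<^sub>R e2)) (at q)"
    by (rule bounded_linear.has_derivative[OF bounded_linear_scaleR_left has_derivative_inner[OF dy dy]])
  show ?thesis
    unfolding X_def[abs_def]
    by (subst dd_eq[OF has_derivative_scaleR[OF d0 has_derivative_add[OF
              has_derivative_add[OF has_derivative_const d1] d2]]])
      (simp add: inner_commute algebra_simps)
qed

text \<open>This is the conformality of \<open>Phi\<close>. By \<open>dd_\<theta>\<close> the
  subtracted term is the product of the derivatives of \<theta>, so adding it back gives the product
  metric as \<open>(x0 q)\<^sup>2\<close> times the Euclidean one.\<close>

lemma lorentz_dd_X:
  assumes "q \<in> U"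
  shows "lorentz (dd X q v) (dd X q w) = (x0 q)\<^sup>2 * (dd y q v \<bullet> dd y q w)
    - (x0 q) ^ 4 * (b q (dd y q v) * b q (dd y q w))"
proof -
  define r a a' where "r = (y q $ 2)\<^sup>2 + (y q $ 3)\<^sup>2" and
    "a = y q $ 2 * dd y q v $ 2 + y q $ 3 * dd y q v $ 3" and
    "a' = y q $ 2 * dd y q w $ 2 + y q $ 3 * dd y q w $ 3"
  have r: "(x0 q)\<^sup>2 * r = 1"
    using x0_radius[OF assms] by (simp add: r_def)
  have k: "dd x0 q v = - (x0 q ^ 3 * a)" "dd x0 q w = - (x0 q ^ 3 * a')"
    using dd_x0[OF assms] by (simp_all add: a_def a'_def)
  have "lorentz (dd X q v) (dd X q w) = - (dd x0 q v * dd x0 q w * r) - dd x0 q v * x0 q * a'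
      - dd x0 q w * x0 q * a + (x0 q)\<^sup>2 * (dd y q v $ 1 * dd y q w $ 1)"
    unfolding dd_X[OF assms] lorentz_simps e_simps inner_3 r_def a_def a'_def
    by (simp add: power2_eq_square algebra_simps)
  also have "\<dots> = (x0 q)^4 * (a * a') + (x0 q)\<^sup>2 * (dd y q v $ 1 * dd y q w $ 1)"
    unfolding k using r by algebra
  also have "(x0 q)^4 * (a * a') = (x0 q)\<^sup>2 * ((x0 q)\<^sup>2 * r) * (dd y q v $ 2 * dd y q w $ 2 + dd y q v $ 3 * dd y q w $ 3)
      - (x0 q) ^ 4 * (b q (dd y q v) * b q (dd y q w))"
    unfolding a_def a'_def r_def b_def by algebra
  finally show ?thesis
    unfolding r by (simp add: inner_3 algebra_simps)
qed

text \<open>In the last hypothesis, \<open>G\<close> is the unit normal of the geodesic that contains the image under \<open>X\<close>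
  of the integral curve \<open>c\<close> of \<open>V2\<close>.\<close>

lemma parametrization:
  assumes p: "p \<in> U" and V: "smooth_on U V1" "smooth_on U V2"
    and V1: "\<And>q. q \<in> U \<Longrightarrow> dd y q (V1 q) \<noteq> 0" "\<And>q. q \<in> U \<Longrightarrow> b q (dd y q (V1 q)) = 0"
    and orth: "\<And>q. q \<in> U \<Longrightarrow> dd y q (V1 q) \<bullet> dd y q (V2 q) = 0"
    and V2: "b p (dd y p (V2 p)) \<noteq> 0" "dd X p (V2 p) \<noteq> 0"
    and geodesic: "\<And>q. q \<in> U \<Longrightarrow> \<exists>K c G. open K \<and> 0 \<in> K \<and> c 0 = q \<and> c ` K \<subseteq> U \<and>
      (\<forall>\<tau>\<in>K. (c has_vector_derivative V2 (c \<tau>)) (at \<tau>)) \<and> lorentz G G = 1 \<and>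
      (\<forall>\<tau>\<in>K. lorentz (X (c \<tau>)) G = 0)"
  shows "\<exists>J I \<gamma> a W \<psi>. unit_speed_curve J \<gamma> \<and> height_function I a \<and> p \<in> W \<and> W \<subseteq> U \<and>
    regular_points (J \<times> I) (lift_map \<gamma> a) = J \<times> I \<and> diffeomorphism_on (J \<times> I) W \<psi> \<and>
    (\<forall>q\<in>J \<times> I. lift_map \<gamma> a q = (X (\<psi> q), \<theta> (\<psi> q)))"
proof -
  \<comment> \<open>The two conditions at \<open>p\<close> are open. The first makes \<theta> vary
    along \<open>V2\<close>, the second makes \<open>X\<close> move along \<open>V2\<close> and
    thereby determine its geodesic.\<close>
  define U' where "U' = U \<inter> (\<lambda>q. b q (dd y q (V2 q))) -` (- {0}) \<inter> (\<lambda>q. dd X q (V2 q)) -` (- {0})"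
  have U'_eq: "U' = (U \<inter> (\<lambda>q. b q (dd y q (V2 q))) -` (- {0})) \<inter> (U \<inter> (\<lambda>q. dd X q (V2 q)) -` (- {0}))"
    by (auto simp: U'_def)
  have "open (U \<inter> (\<lambda>q. b q (dd y q (V2 q))) -` (- {0}))"
    unfolding b_def by (intro continuous_open_preimage smooth_on_continuous smooth_intros U smooth V) auto
  moreover have "open (U \<inter> (\<lambda>q. dd X q (V2 q)) -` (- {0}))"
    by (intro continuous_open_preimage smooth_on_continuous smooth_intros U smooth_X V) auto
  ultimately have U': "open U'" "p \<in> U'" "U' \<subseteq> U"
    using p V2 by (simp_all add: U'_eq open_Int) (auto simp: U'_def)
  define \<mu> where "\<mu> q = sqrt (lorentz (dd X q (V1 q)) (dd X q (V1 q)))" for q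
  define \<nu> where "\<nu> q = (1 / \<mu> q) *\<^sub>R dd X q (V1 q)" for q
  \<comment> \<open>Along \<open>V1\<close> the angular term of \<open>lorentz_dd_X\<close> is zero,
    so only a positive multiple of the Euclidean square remains.\<close>
  have pos1: "lorentz (dd X q (V1 q)) (dd X q (V1 q)) > 0" if "q \<in> U" for q
  proof -
    have "x0 q \<noteq> 0" using x0[OF that] by auto
    then show ?thesis
      using V1[OF that] by (simp add: lorentz_dd_X[OF that])
  qed
  have \<mu>: "\<mu> q > 0" "\<mu> q * \<mu> q = lorentz (dd X q (V1 q)) (dd X q (V1 q))" if "q \<in> U" for q
    using pos1[OF that] by (simp_all add: \<mu>_def)
  have "smooth_on U \<mu>"
    unfolding \<mu>_def[abs_def] by (intro smooth_intros U smooth_X V pos1)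
  moreover have "\<mu> q \<noteq> 0" if "q \<in> U" for q
    using \<mu>(1)[OF that] by simp
  ultimately have smooth_\<nu>: "smooth_on U \<nu>"
    unfolding \<nu>_def[abs_def] by (intro smooth_intros U smooth_X V)
  have dX1: "dd X q (V1 q) = \<mu> q *\<^sub>R \<nu> q" if "q \<in> U" for q
    using \<mu>(1)[OF that] by (simp add: \<nu>_def)
  have \<nu>\<nu>: "lorentz (\<nu> q) (\<nu> q) = 1" if "q \<in> U" for q
    using \<mu>(1)[OF that] by (simp add: \<nu>_def lorentz_simps \<mu>(2)[OF that, symmetric])
  have XdX: "lorentz (X q) (dd X q v) = 0" if "q \<in> U" for q v
  proof -
    have "lorentz (X q) (dd X q v) + lorentz (dd X q v) (X q) = 0"
      by (rule dd_const_on_open[OF U that _ has_derivative_lorentz[OF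
              smooth_on_derivative[OF smooth_X that] smooth_on_derivative[OF smooth_X that]], of "-1"])
        (simp add: X_norm)
    then show ?thesis by (simp add: lorentz_sym)
  qed
  have X\<nu>: "lorentz (X q) (\<nu> q) = 0" if "q \<in> U" for q
    using XdX[OF that] by (simp add: \<nu>_def lorentz_simps)
  \<comment> \<open>The angular correction vanishes because one of its factors belongs to
    \<open>V1\<close>; Euclidean orthogonality therefore passes to the lift.\<close>
  have dX2: "lorentz (dd X q (V2 q)) (\<nu> q) = 0" if "q \<in> U" for q
    using orth[OF that] V1(2)[OF that]
    by (simp add: \<nu>_def lorentz_simps lorentz_dd_X[OF that] inner_commute)
  have dX2n: "dd X q (V2 q) = lorentz (dd X q (V2 q)) (lorentz_cross (X q) (\<nu> q)) *\<^sub>R lorentz_cross (X q) (\<nu> q)"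
    if "q \<in> U" for q
    using lorentz_frame_expansion[OF X_norm[OF that] \<nu>\<nu>[OF that] X\<nu>[OF that], of "dd X q (V2 q)"]
      dX2[OF that] XdX[OF that, of "V2 q"] lorentz_sym[of "X q"] by simp
  have d\<nu>2: "dd \<nu> q (V2 q) = 0" if q: "q \<in> U'" for q
  proof -
    obtain K c G where c: "open K" "0 \<in> K" "c 0 = q" "c ` K \<subseteq> U"
      "\<And>\<tau>. \<tau> \<in> K \<Longrightarrow> (c has_vector_derivative V2 (c \<tau>)) (at \<tau>)" "lorentz G G = 1"
      "\<And>\<tau>. \<tau> \<in> K \<Longrightarrow> lorentz (X (c \<tau>)) G = 0"
      using geodesic[of q] q U'(3) by blast
    have along: "((\<lambda>\<tau>. g (c \<tau>)) has_vector_derivative dd g (c \<tau>) (V2 (c \<tau>))) (at \<tau>)"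
      if "smooth_on U g" "\<tau> \<in> K" for g :: "real \<times> real \<Rightarrow> real^3" and \<tau>
    proof -
      have d: "(g has_derivative dd g (c \<tau>)) (at (c \<tau>))"
        using smooth_on_derivative[OF that(1)] c(4) that(2) by blast
      show ?thesis
        using diff_chain_at[OF c(5)[OF that(2), unfolded has_vector_derivative_def] d]
          linear_scale[OF has_derivative_linear[OF d]]
        by (simp add: has_vector_derivative_def o_def)
    qed
    define K' where "K' = K \<inter> c -` U'"
    have "continuous_on K c"
      using c(5) by (meson continuous_at_imp_continuous_on has_vector_derivative_continuous)
    then have K': "open K'" "0 \<in> K'" "K' \<subseteq> K"
      using continuous_open_preimage[OF _ c(1) U'(1)] c(2,3) q by (auto simp: K'_def)
    \<comment> \<open>\<open>G\<close> is orthogonal to \<open>X\<close> and to its velocity along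
      \<open>V2\<close>, a nonzero multiple of the frame normal. Hence \<open>G\<close> is parallel
      to \<nu>, and both are unit vectors.\<close>
    have \<nu>G: "\<nu> (c \<tau>) = lorentz (\<nu> (c \<tau>)) G *\<^sub>R G" "lorentz (\<nu> (c \<tau>)) G * lorentz (\<nu> (c \<tau>)) G = 1"
      if "\<tau> \<in> K'" for \<tau>
    proof -
      let ?q = "c \<tau>" and ?n = "lorentz_cross (X (c \<tau>)) (\<nu> (c \<tau>))"
      have \<tau>: "\<tau> \<in> K" "?q \<in> U" "dd X ?q (V2 ?q) \<noteq> 0"
        using that K'(3) U'(3) by (auto simp: K'_def U'_def)
      define k where "k = lorentz (dd X ?q (V2 ?q)) ?n"
      have dk: "dd X ?q (V2 ?q) = k *\<^sub>R ?n"
        unfolding k_def by (rule dX2n[OF \<tau>(2)])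
      have "lorentz (dd X ?q (V2 ?q)) G = 0"
        by (rule vector_derivative_const_on_open[OF c(1) \<tau>(1) c(7)
              bounded_linear.has_vector_derivative[OF bounded_bilinear.bounded_linear_left[OF bounded_bilinear_lorentz]
                along[OF smooth_X \<tau>(1)]]])
      then have "k * lorentz G ?n = 0"
        unfolding dk lorentz_simps lorentz_sym[of ?n G] .
      moreover have "k \<noteq> 0"
        using \<tau>(3) dk by auto
      ultimately have "lorentz G ?n = 0" by simp
      moreover have "lorentz G (X ?q) = 0"
        using c(7)[OF \<tau>(1)] by (simp add: lorentz_sym)
      ultimately have G: "G = lorentz G (\<nu> ?q) *\<^sub>R \<nu> ?q"
        using lorentz_frame_expansion[OF X_norm[OF \<tau>(2)] \<nu>\<nu>[OF \<tau>(2)] X\<nu>[OF \<tau>(2)], of G] by simp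
      define l where "l = lorentz G (\<nu> ?q)"
      have Gl: "G = l *\<^sub>R \<nu> ?q"
        unfolding l_def by (rule G)
      have "l * l = 1"
        using c(6) \<nu>\<nu>[OF \<tau>(2)] by (simp add: Gl lorentz_simps)
      moreover have "lorentz (\<nu> ?q) G = l"
        by (simp add: l_def lorentz_sym)
      ultimately show "\<nu> ?q = lorentz (\<nu> ?q) G *\<^sub>R G" "lorentz (\<nu> ?q) G * lorentz (\<nu> ?q) G = 1"
        by (simp_all add: Gl)
    qed
    let ?d = "dd \<nu> q (V2 q)"
    have d: "((\<lambda>\<tau>. \<nu> (c \<tau>)) has_vector_derivative ?d) (at 0)"
      using along[OF smooth_\<nu>, of 0] c(2,3) by simp
    have dG: "((\<lambda>\<tau>. lorentz (\<nu> (c \<tau>)) G) has_vector_derivative lorentz ?d G) (at 0)"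
      by (rule bounded_linear.has_vector_derivative[OF bounded_bilinear.bounded_linear_left[OF bounded_bilinear_lorentz] d])
    \<comment> \<open>The factor between \<nu> and \<open>G\<close> has square 1. Differentiating
      the square shows that its derivative is zero, so \<nu> is stationary along the curve.\<close>
    have "lorentz (\<nu> (c 0)) G * lorentz ?d G + lorentz ?d G * lorentz (\<nu> (c 0)) G = 0"
      by (rule vector_derivative_const_on_open[OF K'(1,2) \<nu>G(2) has_vector_derivative_mult[OF dG dG]])
    then have "lorentz ?d G = 0"
      using \<nu>G(2)[OF K'(2)] by auto
    moreover have "((\<lambda>\<tau>. \<nu> (c \<tau>) - lorentz (\<nu> (c \<tau>)) G *\<^sub>R G) has_vector_derivative ?d - lorentz ?d G *\<^sub>R G) (at 0)"
      by (intro has_vector_derivative_diff d bounded_linear.has_vector_derivative[OF bounded_linear_scaleR_left dG])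
    then have "?d - lorentz ?d G *\<^sub>R G = 0"
      by (rule vector_derivative_const_on_open[OF K'(1,2), of _ 0, rotated])
        (simp only: \<nu>G(1)[symmetric] diff_self)
    ultimately show ?thesis by simp
  qed
  \<comment> \<open>Changing the sign of \<nu> changes the sign of \<open>k\<close>; multiplying
    \<nu> by \<open>sgn k\<close> therefore secures the positivity required by
    \<open>parallel_parametrization\<close>.\<close>
  define k where "k = lorentz (dd X p (V2 p)) (lorentz_cross (X p) (\<nu> p)) / dd \<theta> p (V2 p)"
  have \<theta>2: "dd \<theta> q (V2 q) \<noteq> 0" if "q \<in> U'" for q
    using that x0[of q] by (auto simp: U'_def dd_\<theta>)
  have "k \<noteq> 0"
    using dX2n[OF p] V2(2) \<theta>2[OF U'(2)] by (auto simp: k_def)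
  have smooth': "smooth_on U' g" if "smooth_on U g" for g :: "real \<times> real \<Rightarrow> 'z::real_normed_vector"
    using smooth_on_subset[OF that U'(3)] .
  have HU: "X ` U' \<subseteq> hyperbolic_plane"
    using X_hyperbolic U'(3) by blast
  have inU: "q \<in> U" if "q \<in> U'" for q
    using that U'(3) by blast
  have \<theta>1: "dd \<theta> q (V1 q) = 0" if "q \<in> U'" for q
    using inU[OF that] V1(2) by (simp add: dd_\<theta>)
  define \<nu>' where "\<nu>' q = sgn k *\<^sub>R \<nu> q" for q
  have sk: "sgn k * sgn k = 1"
    using \<open>k \<noteq> 0\<close> by (simp add: sgn_if)
  have "\<exists>J I \<gamma> a W \<psi>. unit_speed_curve J \<gamma> \<and> height_function I a \<and> p \<in> W \<and> W \<subseteq> U' \<and>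
    regular_points (J \<times> I) (lift_map \<gamma> a) = J \<times> I \<and> diffeomorphism_on (J \<times> I) W \<psi> \<and>
    (\<forall>q\<in>J \<times> I. lift_map \<gamma> a q = (X (\<psi> q), \<theta> (\<psi> q)))"
  proof (rule parallel_parametrization[OF e U'(1,2) smooth'[OF smooth_X] smooth'[OF smooth(3)]
        smooth'[OF V(1)] smooth'[OF V(2)] _ HU \<theta>1 \<theta>2, where \<nu>=\<nu>' and \<rho>="\<lambda>q. sgn k * \<mu> q"])
    show "smooth_on U' \<nu>'"
      unfolding \<nu>'_def[abs_def] by (intro smooth_intros U' smooth'[OF smooth_\<nu>])
    fix q assume q: "q \<in> U'"
    show "lorentz (\<nu>' q) (\<nu>' q) = 1" "lorentz (X q) (\<nu>' q) = 0"
      using \<nu>\<nu>[OF inU[OF q]] X\<nu>[OF inU[OF q]] sk by (simp_all add: \<nu>'_def lorentz_simps)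
    show "dd X q (V1 q) = (sgn k * \<mu> q) *\<^sub>R \<nu>' q"
      using dX1[OF inU[OF q]] sk by (simp add: \<nu>'_def)
    show "sgn k * \<mu> q \<noteq> 0"
      using \<open>k \<noteq> 0\<close> \<mu>(1)[OF inU[OF q]] by (simp add: sgn_if)
    show "dd \<nu>' q (V2 q) = 0"
      unfolding \<nu>'_def[abs_def] using d\<nu>2[OF q]
      by (subst dd_eq[OF bounded_linear.has_derivative[OF bounded_linear_scaleR_right
              smooth_on_derivative[OF smooth_\<nu> inU[OF q]]]]) simp
  next
    have "lorentz (dd X p (V2 p)) (lorentz_cross (X p) (\<nu>' p)) / dd \<theta> p (V2 p) = sgn k * k"
      by (simp add: \<nu>'_def lorentz_cross_simps lorentz_simps k_def)
    also have "\<dots> > 0"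
      using \<open>k \<noteq> 0\<close> by (simp add: sgn_if)
    finally show "lorentz (dd X p (V2 p)) (lorentz_cross (X p) (\<nu>' p)) / dd \<theta> p (V2 p) > 0" .
  qed
  then show ?thesis
    using U'(3) by (meson subset_trans)
qed

end

section \<open>From planes and spheres to the hypotheses on the lift\<close>

lemma integral_curve_through:
  fixes V :: "real \<times> real \<Rightarrow> real \<times> real"
  assumes "open U" "U \<subseteq> M" "q \<in> U" "smooth_on U V" "\<And>q. q \<in> U \<Longrightarrow> V q \<noteq> 0 \<and> D q = span {V q}"
  obtains K c where "integral_curve M D K c" "open K" "0 \<in> K" "c 0 = q" "c ` K \<subseteq> U"
    "\<And>\<tau>. \<tau> \<in> K \<Longrightarrow> (c has_vector_derivative V (c \<tau>)) (at \<tau>)"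
proof -
  obtain \<delta> c where c: "\<delta> > 0" "c 0 = q" "\<And>t. t \<in> {-\<delta><..<\<delta>} \<Longrightarrow> c t \<in> U"
    "\<And>t. t \<in> {-\<delta><..<\<delta>} \<Longrightarrow> (c has_vector_derivative V (c t)) (at t)"
    using smooth_field_integral_curve[OF assms(1,3,4)] by metis
  have "integral_curve M D {-\<delta><..<\<delta>} c"
    unfolding integral_curve_def
  proof (intro conjI ballI)
    show "open_interval {-\<delta><..<\<delta>}"
      using open_interval_ball[OF c(1), of 0] by (simp add: ball_real_interval)
    show "c ` {-\<delta><..<\<delta>} \<subseteq> M"
      using c(3) assms(2) by blast
    fix t assume t: "t \<in> {-\<delta><..<\<delta>}"
    show "c differentiable (at t)"
      using c(4)[OF t] differentiableI_vector by blast
    show "vector_derivative c (at t) \<in> D (c t) - {0}"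
      using vector_derivative_at[OF c(4)[OF t]] assms(5)[OF c(3)[OF t]] by (simp add: span_base)
  qed
  then show thesis
    by (rule that) (use c in auto)
qed

lemma normal_parallel_cross3:
  fixes P Q x :: "real^3"
  assumes "P \<noteq> 0" "Q \<noteq> 0" "P \<bullet> Q = 0" "x \<bullet> P = 0" "x \<bullet> Q = 0"
  shows "\<exists>k. x = k *\<^sub>R cross3 P Q"
proof -
  have "cross3 (cross3 P Q) P = (P \<bullet> P) *\<^sub>R Q"
    using assms(3) cross_skew[of "cross3 P Q" P] by (simp add: Lagrange)
  then have "x \<bullet> cross3 (cross3 P Q) P = 0"
    using assms(5) by simp
  then show ?thesis
    using parallel_of_orthogonal[OF cross3_nonzero_of_orthogonal[OF assms(1-3)] assms(1) _ assms(4)]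
    by (auto simp: dot_cross_self)
qed

text \<open>In coordinates with the given axis, the plane through \<open>z\<close> consists of the
  points whose last two coordinates are proportional to those of \<open>R z\<close>; the equation is
  the corresponding determinant.\<close>

lemma affine_hull_insert_axis:
  fixes R :: "real^3 \<Rightarrow> real^3"
  assumes R: "\<And>x. R x = A x + b0" "linear A" "inj R" "R ` L = axis_line"
    and z: "R z \<notin> axis_line"
  shows "x \<in> affine hull (insert z L) \<longleftrightarrow> R z $ 2 * R x $ 3 - R z $ 3 * R x $ 2 = 0"
proof
  let ?T = "{x. R z $ 2 * R x $ 3 - R z $ 3 * R x $ 2 = 0}"
  have aff: "R (u *\<^sub>R x + v *\<^sub>R y) = u *\<^sub>R R x + v *\<^sub>R R y" if "u + v = 1" for u v x y
  proof -
    have "b0 = u *\<^sub>R b0 + v *\<^sub>R b0"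
      using that by (simp add: scaleR_add_left[symmetric])
    then show ?thesis
      by (simp add: R(1) linear_add[OF R(2)] linear_scale[OF R(2)] algebra_simps)
  qed
  have "affine ?T"
    unfolding affine_def by (auto simp: aff) algebra
  moreover have "insert z L \<subseteq> ?T"
  proof -
    have "R x \<in> axis_line" if "x \<in> L" for x
      using R(4) that by blast
    then show ?thesis by (auto simp: axis_line_def)
  qed
  ultimately have "affine hull (insert z L) \<subseteq> ?T"
    by (meson hull_minimal)
  then show "x \<in> affine hull (insert z L) \<Longrightarrow> R z $ 2 * R x $ 3 - R z $ 3 * R x $ 2 = 0"
    by blast
  assume x: "R z $ 2 * R x $ 3 - R z $ 3 * R x $ 2 = 0"
  \<comment> \<open>\<open>k\<close> is the ratio of the parts orthogonal to the axis. After
    subtracting \<open>k\<close> times \<open>R z\<close> only an axial part is left, which two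
    points of \<open>L\<close> supply with total weight 1.\<close>
  define r k where "r = (R z $ 2)\<^sup>2 + (R z $ 3)\<^sup>2" and "k = (R z $ 2 * R x $ 2 + R z $ 3 * R x $ 3) / r"
  have r: "r \<noteq> 0"
    using z by (simp add: r_def axis_line_def sum_power2_eq_zero_iff)
  have "r * R x $ 2 = (k * r) * R z $ 2" "r * R x $ 3 = (k * r) * R z $ 3"
    using x r unfolding k_def by (simp_all add: r_def) algebra+
  then have k: "R x $ 2 = k * R z $ 2" "R x $ 3 = k * R z $ 3"
    using r by (simp_all add: mult.commute[of k r])
  define l where "l = R x $ 1 - k * R z $ 1"
  obtain x0 x1 where x01: "x0 \<in> L" "R x0 = 0" "x1 \<in> L" "R x1 = axis 1 1"
  proof -
    have "0 \<in> R ` L" "axis 1 1 \<in> R ` L"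
      unfolding R(4) by (auto simp: axis_line_def axis_def)
    then show thesis using that by (metis imageE)
  qed
  define m where "m = 1 - k - l"
  have m: "k + m + l = 1"
    by (simp add: m_def)
  let ?x = "k *\<^sub>R z + m *\<^sub>R x0 + l *\<^sub>R x1"
  have "R ?x = k *\<^sub>R A z + m *\<^sub>R A x0 + l *\<^sub>R A x1 + (k + m + l) *\<^sub>R b0"
    unfolding R(1) m by (simp add: linear_add[OF R(2)] linear_scale[OF R(2)])
  also have "\<dots> = k *\<^sub>R R z + m *\<^sub>R R x0 + l *\<^sub>R R x1"
    by (simp add: R(1) algebra_simps)
  also have "\<dots> = R x"
    using k by (simp add: x01 l_def vec_eq_iff forall_3 axis_def)
  finally have "x = ?x"
    using R(3) by (metis injD)
  moreover have "?x \<in> affine hull (insert z L)"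
    by (rule mem_affine_3[OF affine_affine_hull]) (auto intro: hull_inc x01 simp: m)
  ultimately show "x \<in> affine hull (insert z L)" by simp
qed

lemma euclidean_motion_affine:
  assumes "euclidean_motion R"
  obtains A b0 where "orthogonal_transformation A" "\<And>x. R x = A x + b0" "inj R"
proof
  have R: "dist (R x) (R y) = dist x y" for x y
    using assms by (simp add: euclidean_motion_def)
  show "orthogonal_transformation (\<lambda>x. R x - R 0)"
    unfolding orthogonal_transformation_isometry using R by (simp add: dist_norm)
  show "R x = (R x - R 0) + R 0" for x
    by simp
  show "inj R"
    using R by (metis dist_eq_0_iff injI)
qed

text \<open>The result is local at \<open>p\<close> because the angle, the vector fields spanning
  the line fields and the adapted coordinates are only available near \<open>p\<close>.\<close>

lemma joachimsthal_local_parametrization: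
  assumes e: "pseudo_orthonormal e0 e1 e2"
    and jo: "joachimsthal_surface L M f"
    and R: "euclidean_motion R" "R ` L = axis_line"
    and p: "p \<in> M" "oblique_at L f p"
  shows "\<exists>J I \<gamma> a U \<psi>. unit_speed_curve J \<gamma> \<and> height_function I a \<and> p \<in> U \<and> U \<subseteq> M \<and>
    diffeomorphism_on (regular_points (J \<times> I) (lift_map \<gamma> a)) U \<psi> \<and>
    (\<forall>q\<in>regular_points (J \<times> I) (lift_map \<gamma> a). R (f (\<psi> q)) = Phi e0 e1 e2 (lift_map \<gamma> a q))"
proof -
  have M: "open M" "smooth_on M f" "\<And>q. q \<in> M \<Longrightarrow> inj (dd f q)"
    using jo by (simp_all add: joachimsthal_surface_def immersed_surface_def)
  obtain \<kappa>1 \<kappa>2 D1 D2 where fields: "principal_line_fields M f \<kappa>1 \<kappa>2 D1 D2 \<and>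
      (\<forall>K c. integral_curve M D1 K c \<longrightarrow> (\<exists>P. plane_set P \<and> L \<subseteq> P \<and> f ` c ` K \<subseteq> P)) \<and>
      (\<forall>K c. integral_curve M D2 K c \<longrightarrow> (\<exists>\<Sigma>. sphere_centered_on L \<Sigma> \<and> f ` c ` K \<subseteq> \<Sigma>))"
    using jo[unfolded joachimsthal_surface_def, THEN conjunct2, THEN conjunct2]
    by (elim exE) (rule that)
  have D: "principal_line_fields M f \<kappa>1 \<kappa>2 D1 D2"
    using fields by (rule conjunct1)
  have planes: "\<exists>P. plane_set P \<and> L \<subseteq> P \<and> f ` c ` K \<subseteq> P" if "integral_curve M D1 K c" for K c
    using fields[THEN conjunct2, THEN conjunct1] that by simp
  have spheres: "\<exists>\<Sigma>. sphere_centered_on L \<Sigma> \<and> f ` c ` K \<subseteq> \<Sigma>" if "integral_curve M D2 K c" for K c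
    using fields[THEN conjunct2, THEN conjunct2] that by simp
  have lf: "smooth_line_field M D1" "smooth_line_field M D2"
    using D by (simp_all add: principal_line_fields_def)
  obtain U1 V1 where U1: "open U1" "p \<in> U1" "U1 \<subseteq> M" "smooth_on U1 V1"
    "\<And>q. q \<in> U1 \<Longrightarrow> V1 q \<noteq> 0 \<and> D1 q = span {V1 q}"
    using lf(1)[unfolded smooth_line_field_def, rule_format, OF p(1)] by blast
  obtain U2 V2 where U2: "open U2" "p \<in> U2" "U2 \<subseteq> M" "smooth_on U2 V2"
    "\<And>q. q \<in> U2 \<Longrightarrow> V2 q \<noteq> 0 \<and> D2 q = span {V2 q}"
    using lf(2)[unfolded smooth_line_field_def, rule_format, OF p(1)] by blast
  obtain A b0 where A: "orthogonal_transformation A" "\<And>x. R x = A x + b0" "inj R"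
    using euclidean_motion_affine[OF R(1)] by metis
  have linA: "linear A" and Ain: "A x \<bullet> A z = x \<bullet> z" for x z
    using A(1) by (simp_all add: orthogonal_transformation_def)
  have blA: "bounded_linear A"
    using linA by (simp add: linear_conv_bounded_linear)
  define y where "y q = R (f q)" for q
  have smooth_y: "smooth_on M y"
    unfolding y_def[abs_def] A(2)
    by (intro smooth_on_add smooth_on_const smooth_on_bounded_linear[OF blA] M)
  have dy: "dd y q v = A (dd f q v)" if "q \<in> M" for q v
  proof -
    have "((\<lambda>q. A (f q) + b0) has_derivative (\<lambda>v. A (dd f q v))) (at q)"
      using has_derivative_add[OF bounded_linear.has_derivative[OF blA smooth_on_derivative[OF M(2) that]]
          has_derivative_const[of b0]] by simp
    then show ?thesis
      unfolding y_def[abs_def] A(2) by (rule dd_eq)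
  qed
  define U0 where "U0 = U1 \<inter> U2 \<inter> (\<lambda>q. (y q $ 2)\<^sup>2 + (y q $ 3)\<^sup>2) -` {0<..}"
  have U12: "open (U1 \<inter> U2)" "U1 \<inter> U2 \<subseteq> M"
    using U1 U2 by auto
  have "f p \<notin> L"
    using p(2) by (simp add: oblique_at_def)
  then have y_off: "y p \<notin> axis_line"
    unfolding y_def R(2)[symmetric] using A(3) by (simp add: inj_image_mem_iff)
  have U0: "open U0" "p \<in> U0" "U0 \<subseteq> U1" "U0 \<subseteq> U2" "U0 \<subseteq> M"
  proof -
    show "open U0"
      unfolding U0_def
      by (intro continuous_open_preimage smooth_on_continuous smooth_intros U12
          smooth_on_subset[OF smooth_y U12(2)]) auto
    show "p \<in> U0"
      using U1(2) U2(2) y_off by (simp add: U0_def axis_line_def sum_power2_gt_zero_iff)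
  qed (use U1(3) in \<open>auto simp: U0_def\<close>)
  have rpos: "(y q $ 2)\<^sup>2 + (y q $ 3)\<^sup>2 > 0" if "q \<in> U0" for q
    using that by (simp add: U0_def)
  \<comment> \<open>Reciprocal distance to the axis, with the sign that puts the lift on the upper
    sheet.\<close>
  define x0 where "x0 q = sgn (e0 $ 1) / sqrt ((y q $ 2)\<^sup>2 + (y q $ 3)\<^sup>2)" for q
  have e0: "e0 $ 1 \<noteq> 0"
    by (rule pseudo_orthonormal_e0_nonzero[OF e])
  have y0: "smooth_on U0 y"
    using smooth_on_subset[OF smooth_y U0(5)] .
  have sqrt0: "sqrt ((y q $ 2)\<^sup>2 + (y q $ 3)\<^sup>2) \<noteq> 0" if "q \<in> U0" for q
    using rpos[OF that] by (metis less_irrefl real_sqrt_eq_zero_cancel_iff)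
  have smooth_x0: "smooth_on U0 x0"
    unfolding x0_def[abs_def] by (intro smooth_intros U0 y0 rpos sqrt0)
  have x0sq: "(x0 q)\<^sup>2 * ((y q $ 2)\<^sup>2 + (y q $ 3)\<^sup>2) = 1" if "q \<in> U0" for q
    using rpos[OF that] e0 by (auto simp: x0_def power_divide sgn_if)
  obtain U \<theta> where Uf: "open U" "p \<in> U" "U \<subseteq> U0" "smooth_on U \<theta>"
    "\<And>q. q \<in> U \<Longrightarrow> x0 q * y q $ 2 = cos (\<theta> q)" "\<And>q. q \<in> U \<Longrightarrow> x0 q * y q $ 3 = sin (\<theta> q)"
  proof (rule smooth_local_angle[OF U0(1,2), of "\<lambda>q. x0 q * y q $ 2" "\<lambda>q. x0 q * y q $ 3"])
    show "smooth_on U0 (\<lambda>q. x0 q * y q $ 2)" "smooth_on U0 (\<lambda>q. x0 q * y q $ 3)"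
      by (intro smooth_intros U0 smooth_x0 y0)+
    show "(x0 q * y q $ 2)\<^sup>2 + (x0 q * y q $ 3)\<^sup>2 = 1" if "q \<in> U0" for q
      using x0sq[OF that] by (simp add: power_mult_distrib distrib_left)
  qed metis
  interpret hyperbolic_lift e0 e1 e2 U y x0 \<theta>
  proof
    show "x0 q * e0 $ 1 > 0" if "q \<in> U" for q
      using rpos[of q] that Uf(3) e0 by (auto simp: x0_def sgn_if zero_less_divide_iff divide_less_0_iff)
  qed (use e Uf smooth_on_subset[OF y0 Uf(3)] smooth_on_subset[OF smooth_x0 Uf(3)] in auto)
  have UM: "U \<subseteq> U1" "U \<subseteq> U2" "U \<subseteq> M"
    using Uf(3) U0 by auto
  have V: "smooth_on U V1" "smooth_on U V2"
    using smooth_on_subset[OF U1(4) UM(1)] smooth_on_subset[OF U2(4) UM(2)] .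
  have V1: "V1 q \<noteq> 0 \<and> D1 q = span {V1 q}" and V2: "V2 q \<noteq> 0 \<and> D2 q = span {V2 q}" if "q \<in> U" for q
    using U1(5) U2(5) UM that by blast+
  have dy0: "dd y q v \<noteq> 0" if "q \<in> U" "v \<noteq> 0" for q v
  proof -
    have q: "q \<in> M" using that UM by blast
    have "dd f q v \<noteq> 0"
      using M(3)[OF q] that(2) linear_0[OF smooth_on_linear_dd[OF M(2) q]] by (metis injD)
    then show ?thesis
      using Ain[of "dd f q v" "dd f q v"] by (auto simp: dy[OF q])
  qed
  have orth: "dd y q (V1 q) \<bullet> dd y q (V2 q) = 0" if "q \<in> U" for q
  proof -
    have "V1 q \<in> D1 q" "V2 q \<in> D2 q" "q \<in> M"
      using V1[OF that] V2[OF that] UM(3) that by (auto simp: span_base)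
    then show ?thesis
      using D by (simp add: principal_line_fields_def dy Ain)
  qed
  have b_alt: "b q w = y q $ 2 * w $ 3 - y q $ 3 * w $ 2" for q w
    by (simp add: b_def)
  have along: "((\<lambda>\<tau>. y (c \<tau>)) has_vector_derivative dd y (c \<tau>) v) (at \<tau>)"
    if "c \<tau> \<in> U" "(c has_vector_derivative v) (at \<tau>)" for c \<tau> v
  proof -
    have d: "(y has_derivative dd y (c \<tau>)) (at (c \<tau>))"
      using smooth_on_derivative[OF smooth(1) that(1)] .
    show ?thesis
      using diff_chain_at[OF that(2)[unfolded has_vector_derivative_def] d]
        linear_scale[OF has_derivative_linear[OF d]]
      by (simp add: has_vector_derivative_def o_def)
  qed
  have b1: "b q (dd y q (V1 q)) = 0" if q: "q \<in> U" for q
  proof -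
    obtain K c where c: "integral_curve M D1 K c" "open K" "0 \<in> K" "c 0 = q" "c ` K \<subseteq> U"
      "\<And>\<tau>. \<tau> \<in> K \<Longrightarrow> (c has_vector_derivative V1 (c \<tau>)) (at \<tau>)"
      using integral_curve_through[OF Uf(1) UM(3) q V(1) V1] by metis
    obtain P where P: "plane_set P" "L \<subseteq> P" "f ` c ` K \<subseteq> P"
      using planes[OF c(1)] by blast
    have "affine hull P = P"
      using P(1) by (simp add: plane_set_def)
    have "\<exists>u \<beta>. u \<noteq> 0 \<and> affine hull P = {x. u \<bullet> x = \<beta>}"
      by (rule iffD1[OF aff_dim_eq_hyperplane]) (use P(1) in \<open>simp add: plane_set_def\<close>)
    then obtain u \<beta> where u: "u \<noteq> 0" "P = {x. u \<bullet> x = \<beta>}"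
      unfolding \<open>affine hull P = P\<close> by blast
    define u' \<beta>' where "u' = A u" and "\<beta>' = \<beta> + A u \<bullet> b0"
    have P': "u' \<bullet> R x = \<beta>'" if "x \<in> P" for x
      using that by (simp add: u(2) u'_def \<beta>'_def A(2) inner_add_right Ain)
    have ax: "u' \<bullet> z = \<beta>'" if "z \<in> axis_line" for z
      using that P' P(2) unfolding R(2)[symmetric] by blast
    have "\<beta>' = 0" "u' $ 1 = 0"
      using ax[of 0] ax[of "axis 1 1"] by (simp_all add: axis_line_def inner_3 axis_def)
    moreover have "u' \<noteq> 0"
      using u(1) Ain[of u u] by (auto simp: u'_def)
    ultimately have u'23: "u' $ 2 \<noteq> 0 \<or> u' $ 3 \<noteq> 0"
      by (auto simp: vec_eq_iff forall_3)
    have yP: "u' \<bullet> y (c \<tau>) = 0" if "\<tau> \<in> K" for \<tau>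
      using P' P(3) that \<open>\<beta>' = 0\<close> by (auto simp: y_def)
    have "u' \<bullet> dd y (c 0) (V1 (c 0)) = 0"
      by (rule vector_derivative_const_on_open[OF c(2,3) yP
            bounded_linear.has_vector_derivative[OF bounded_linear_inner_right along]])
        (use c in auto)
    then have "u' $ 2 * dd y q (V1 q) $ 2 + u' $ 3 * dd y q (V1 q) $ 3 = 0"
      "u' $ 2 * y q $ 2 + u' $ 3 * y q $ 3 = 0"
      using yP[OF c(3)] \<open>u' $ 1 = 0\<close> by (simp_all add: inner_3 c(4))
    \<comment> \<open>The parts of \<open>y q\<close> and of its derivative along \<open>V1\<close>
      orthogonal to the axis are both orthogonal to the nonzero pair
      \<open>(u' $ 2, u' $ 3)\<close>, hence parallel, and \<open>b\<close> is their
      determinant.\<close>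
    then have "u' $ 2 * b q (dd y q (V1 q)) = 0" "u' $ 3 * b q (dd y q (V1 q)) = 0"
      unfolding b_alt by algebra+
    then show ?thesis
      using u'23 by auto
  qed
  define N where "N = gauss_map f p"
  \<comment> \<open>Direction of rotation about the axis at \<open>y p\<close>, and at the same time
    a normal of the plane through the axis and \<open>y p\<close>.\<close>
  define \<eta> where "\<eta> = (vector [0, - y p $ 3, y p $ 2] :: real^3)"
  have \<eta>: "b p w = \<eta> \<bullet> w" "\<eta> \<bullet> y p = 0" for w
    by (simp_all add: b_alt \<eta>_def inner_3)
  have "\<eta> \<noteq> 0"
    using y_off by (auto simp: \<eta>_def axis_line_def vec_eq_iff forall_3)
  have N: "A N \<bullet> dd y p v = 0" for v
  proof -
    have "N \<bullet> dd f p v = 0"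
      using dd_pair[OF smooth_on_differentiable[OF M(2) p(1)], of v]
      by (simp add: N_def inner_add_right gauss_map_orthogonal)
    then show ?thesis
      by (simp add: dy[OF p(1)] Ain)
  qed
  have hull: "x \<in> affine hull (insert (f p) L) \<longleftrightarrow> \<eta> \<bullet> R x = 0" for x
    using affine_hull_insert_axis[OF A(2) linA A(3) R(2), of "f p" x] y_off
    by (simp add: y_def \<eta>_def inner_3 algebra_simps)
  have obl: "\<not> (\<forall>x\<in>affine hull (insert (f p) L). (x - f p) \<bullet> N = 0)" "f p + N \<notin> affine hull (insert (f p) L)"
    using p(2) by (simp_all add: oblique_at_def N_def Let_def)
  \<comment> \<open>Otherwise \<eta> would be orthogonal to both tangent directions and hence normal
    to the surface: the tangent plane would be the plane through the axis, which
    \<open>obl(1)\<close> excludes.\<close>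
  have b2: "b p (dd y p (V2 p)) \<noteq> 0"
  proof
    assume 0: "b p (dd y p (V2 p)) = 0"
    let ?P = "dd y p (V1 p)" and ?Q = "dd y p (V2 p)"
    have PQ: "?P \<noteq> 0" "?Q \<noteq> 0" "?P \<bullet> ?Q = 0"
      using dy0 orth V1 V2 Uf(2) by auto
    obtain k l where kl: "A N = k *\<^sub>R cross3 ?P ?Q" "\<eta> = l *\<^sub>R cross3 ?P ?Q"
      using normal_parallel_cross3[OF PQ, of "A N"] normal_parallel_cross3[OF PQ, of \<eta>] N
        b1[OF Uf(2)] 0 by (auto simp: \<eta>(1))
    then have "l \<noteq> 0" using \<open>\<eta> \<noteq> 0\<close> by auto
    then have AN: "A N = (k / l) *\<^sub>R \<eta>"
      using kl by simp
    have "(x - f p) \<bullet> N = 0" if "x \<in> affine hull (insert (f p) L)" for x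
    proof -
      have "(x - f p) \<bullet> N = A (x - f p) \<bullet> A N"
        by (simp add: Ain)
      also have "A (x - f p) = R x - y p"
        by (simp add: A(2) y_def linear_diff[OF linA])
      also have "(R x - y p) \<bullet> A N = (k / l) * (\<eta> \<bullet> R x - \<eta> \<bullet> y p)"
        by (simp add: AN inner_diff_right inner_commute)
      finally show ?thesis
        using that hull[of x] \<eta>(2) by simp
    qed
    then show False using obl(1) by blast
  qed
  \<comment> \<open>If \<open>X\<close> were stationary along \<open>V2\<close>, the surface would
    move there purely by rotation about the axis. Its normal would then be orthogonal to \<eta> and
    lie in the plane through the axis, against \<open>obl(2)\<close>.\<close>
  have dX2: "dd X p (V2 p) \<noteq> 0"
  proof
    assume "dd X p (V2 p) = 0"
    then have 0: "(x0 p)\<^sup>2 * (dd y p (V2 p) \<bullet> dd y p (V2 p)) - (x0 p) ^ 4 * (b p (dd y p (V2 p)) * b p (dd y p (V2 p))) = 0"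
      using lorentz_dd_X[OF Uf(2), of "V2 p" "V2 p"] by (simp add: lorentz_simps)
    define Y where "Y = dd y p (V2 p)"
    define r where "r = (y p $ 2)\<^sup>2 + (y p $ 3)\<^sup>2"
    have r: "(x0 p)\<^sup>2 * r = 1" "r > 0"
      using x0sq[OF U0(2)] rpos[OF U0(2)] by (simp_all add: r_def)
    have "r * (Y \<bullet> Y) = (b p Y)\<^sup>2"
      using 0[folded Y_def] r(1) by algebra
    \<comment> \<open>By Lagrange's identity in the plane orthogonal to the axis, the axial and
      radial parts of \<open>Y\<close> contribute a sum of two squares that equals zero.\<close>
    then have "r * (Y $ 1)\<^sup>2 + (y p $ 2 * Y $ 2 + y p $ 3 * Y $ 3)\<^sup>2 = 0"
      unfolding r_def b_alt inner_3 by algebra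
    moreover have "r * (Y $ 1)\<^sup>2 \<ge> 0"
      using r(2) by simp
    ultimately have "r * (Y $ 1)\<^sup>2 = 0" "(y p $ 2 * Y $ 2 + y p $ 3 * Y $ 3)\<^sup>2 = 0"
      using zero_le_power2[of "y p $ 2 * Y $ 2 + y p $ 3 * Y $ 3"] by linarith+
    then have Y1: "Y $ 1 = 0" and Y23: "y p $ 2 * Y $ 2 + y p $ 3 * Y $ 3 = 0"
      using r(2) by auto
    have "r * Y $ 2 = - (b p Y * y p $ 3)" "r * Y $ 3 = b p Y * y p $ 2"
      using Y23 unfolding r_def b_alt by algebra+
    then have "r *\<^sub>R Y = b p Y *\<^sub>R \<eta>"
      by (simp add: vec_eq_iff forall_3 \<eta>_def Y1)
    then have "b p Y * (A N \<bullet> \<eta>) = r * (A N \<bullet> Y)"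
      by (metis inner_scaleR_right)
    then have "A N \<bullet> \<eta> = 0"
      using N[of "V2 p"] b2 by (simp add: Y_def)
    then have "\<eta> \<bullet> R (f p + N) = 0"
      using \<eta>(2) by (simp add: A(2) linear_add[OF linA] y_def inner_add_right inner_commute)
    then show False
      using obl(2) hull by blast
  qed
  have geodesic: "\<exists>K c G. open K \<and> 0 \<in> K \<and> c 0 = q \<and> c ` K \<subseteq> U \<and>
      (\<forall>\<tau>\<in>K. (c has_vector_derivative V2 (c \<tau>)) (at \<tau>)) \<and> lorentz G G = 1 \<and>
      (\<forall>\<tau>\<in>K. lorentz (X (c \<tau>)) G = 0)" if q: "q \<in> U" for q
  proof -
    obtain K c where c: "integral_curve M D2 K c" "open K" "0 \<in> K" "c 0 = q" "c ` K \<subseteq> U"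
      "\<And>\<tau>. \<tau> \<in> K \<Longrightarrow> (c has_vector_derivative V2 (c \<tau>)) (at \<tau>)"
      using integral_curve_through[OF Uf(1) UM(3) q V(2) V2] by metis
    obtain \<Sigma> where \<Sigma>: "sphere_centered_on L \<Sigma>" "f ` c ` K \<subseteq> \<Sigma>"
      using spheres[OF c(1)] by blast
    have "\<exists>g0 g1 g2. g1 * g1 - g0 * g2 = 1 \<and>
        (\<forall>\<tau>\<in>K. g1 * y (c \<tau>) $ 1 - (g2 + g0 * (y (c \<tau>) \<bullet> y (c \<tau>))) / 2 = 0)"
      using \<Sigma>(1) unfolding sphere_centered_on_def
    proof (elim disjE bexE exE conjE)
      fix z r assume z: "z \<in> L" "r > 0" "\<Sigma> = sphere z r"
      have Rz: "R z $ 2 = 0" "R z $ 3 = 0"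
        using z(1) R(2) by (auto simp: axis_line_def)
      have "(1 / r) * (2 * R z $ 1 * y (c \<tau>) $ 1 - ((R z $ 1)\<^sup>2 - r\<^sup>2 + y (c \<tau>) \<bullet> y (c \<tau>))) = 0" if "\<tau> \<in> K" for \<tau>
      proof -
        have "f (c \<tau>) \<in> sphere z r"
          using \<Sigma>(2) z(3) that by blast
        then have "dist (R z) (y (c \<tau>)) = r"
          using R(1) by (simp add: y_def euclidean_motion_def)
        then have "(R z - y (c \<tau>)) \<bullet> (R z - y (c \<tau>)) = r\<^sup>2"
          by (simp add: dist_norm power2_norm_eq_inner[symmetric])
        then have "2 * R z $ 1 * y (c \<tau>) $ 1 - ((R z $ 1)\<^sup>2 - r\<^sup>2 + y (c \<tau>) \<bullet> y (c \<tau>)) = 0"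
          unfolding inner_3 vector_minus_component Rz by algebra
        then show ?thesis by simp
      qed
      then show ?thesis
        \<comment> \<open>Dividing the sphere equation by the radius normalizes the vector with
          coordinates \<open>g0\<close>, \<open>g1\<close>, \<open>g2\<close> to Lorentzian length
          1.\<close>
        using z(2)
        by (intro exI[of _ "1 / r"] exI[of _ "R z $ 1 / r"] exI[of _ "((R z $ 1)\<^sup>2 - r\<^sup>2) / r"])
          (auto simp: field_simps power2_eq_square)
    next
      assume perp: "\<forall>x\<in>L. \<forall>x'\<in>L. \<forall>u\<in>\<Sigma>. \<forall>v\<in>\<Sigma>. (x - x') \<bullet> (u - v) = 0"
      obtain x x' where x: "x \<in> L" "R x = axis 1 1" "x' \<in> L" "R x' = 0"
      proof -
        have "0 \<in> R ` L" "axis 1 1 \<in> R ` L"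
          unfolding R(2) by (auto simp: axis_line_def axis_def)
        then show thesis using that by (metis imageE)
      qed
      have "y (c \<tau>) $ 1 = y q $ 1" if "\<tau> \<in> K" for \<tau>
      proof -
        have "(x - x') \<bullet> (f (c \<tau>) - f (c 0)) = 0"
          using perp x \<Sigma>(2) that c(3) by blast
        then have "A (x - x') \<bullet> A (f (c \<tau>) - f (c 0)) = 0"
          by (simp add: Ain)
        moreover have "A (x - x') = R x - R x'" "A (f (c \<tau>) - f (c 0)) = y (c \<tau>) - y q"
          by (simp_all add: A(2) y_def c(4) linear_diff[OF linA])
        ultimately show ?thesis
          by (simp add: x inner_axis')
      qed
      then show ?thesis
        \<comment> \<open>A plane orthogonal to the axis is the case \<open>g0 = 0\<close> with
          \<open>g1\<close> normalized to 1; \<open>g2\<close> records its axial coordinate.\<close>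
        by (intro exI[of _ 0] exI[of _ 1] exI[of _ "2 * y q $ 1"]) auto
    qed
    then obtain g0 g1 g2 where g: "g1 * g1 - g0 * g2 = 1"
      "\<And>\<tau>. \<tau> \<in> K \<Longrightarrow> g1 * y (c \<tau>) $ 1 - (g2 + g0 * (y (c \<tau>) \<bullet> y (c \<tau>))) / 2 = 0"
      by blast
    let ?G = "g0 *\<^sub>R e0 + g1 *\<^sub>R e1 + g2 *\<^sub>R e2"
    have "lorentz ?G ?G = 1"
      using g(1) by (simp add: lorentz_simps e_simps algebra_simps)
    moreover have "\<forall>\<tau>\<in>K. lorentz (X (c \<tau>)) ?G = 0"
      using g(2) by (simp add: lorentz_X)
    ultimately show ?thesis
      using c by blast
  qed
  have dy1: "dd y q (V1 q) \<noteq> 0" if "q \<in> U" for q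
    using dy0[OF that] V1[OF that] by blast
  obtain J I \<gamma> a W \<psi> where *: "unit_speed_curve J \<gamma>" "height_function I a" "p \<in> W" "W \<subseteq> U"
    "regular_points (J \<times> I) (lift_map \<gamma> a) = J \<times> I" "diffeomorphism_on (J \<times> I) W \<psi>"
    "\<And>q. q \<in> J \<times> I \<Longrightarrow> lift_map \<gamma> a q = (X (\<psi> q), \<theta> (\<psi> q))"
    using parametrization[OF Uf(2) V dy1 b1 orth b2 dX2 geodesic] by blast
  have "R (f (\<psi> q)) = Phi e0 e1 e2 (lift_map \<gamma> a q)" if "q \<in> J \<times> I" for q
  proof -
    have "\<psi> q \<in> U"
      using that *(4,6) by (auto simp: diffeomorphism_on_def bij_betw_def)
    then show ?thesis
      using Phi_X *(7)[OF that] by (simp add: y_def)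
  qed
  moreover have "W \<subseteq> M"
    using *(4) UM(3) by blast
  ultimately show ?thesis
    using *(1,2,3,5,6) by (intro exI[of _ J] exI[of _ I] exI[of _ \<gamma>] exI[of _ a] exI[of _ W] exI[of _ \<psi>]) simp
qed

theorem corollary30:
  fixes e0 e1 e2 :: "real^3"
  assumes "pseudo_orthonormal e0 e1 e2"
  shows
    "(\<forall>J I \<gamma> a. unit_speed_curve J \<gamma> \<and> height_function I a \<longrightarrow>
        (let M = regular_points (J \<times> I) (lift_map \<gamma> a); f = Phi e0 e1 e2 \<circ> lift_map \<gamma> a
         in f ` M \<subseteq> - axis_line \<and> joachimsthal_surface axis_line M f))
     \<and>
     (\<forall>L M f R. joachimsthal_surface L M f \<and> euclidean_motion R \<and> R ` L = axis_line \<longrightarrow>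
        (\<forall>p\<in>M. oblique_at L f p \<longrightarrow>
           (\<exists>J I \<gamma> a U \<psi>. unit_speed_curve J \<gamma> \<and> height_function I a \<and>
              p \<in> U \<and> U \<subseteq> M \<and>
              diffeomorphism_on (regular_points (J \<times> I) (lift_map \<gamma> a)) U \<psi> \<and>
              (\<forall>q\<in>regular_points (J \<times> I) (lift_map \<gamma> a).
                 R (f (\<psi> q)) = Phi e0 e1 e2 (lift_map \<gamma> a q)))))"
proof (intro conjI allI impI ballI)
  fix J I \<gamma> a assume "unit_speed_curve J \<gamma> \<and> height_function I a"
  then interpret parallel_family e0 e1 e2 J I \<gamma> a
    using assms by unfold_locales auto
  show "let M = regular_points (J \<times> I) (lift_map \<gamma> a); f = Phi e0 e1 e2 \<circ> lift_map \<gamma> a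
      in f ` M \<subseteq> - axis_line \<and> joachimsthal_surface axis_line M f"
    using f_avoids_axis joachimsthal unfolding M_def f_def Let_def by blast
next
  fix L M f R p
  assume "joachimsthal_surface L M f \<and> euclidean_motion R \<and> R ` L = axis_line" "p \<in> M" "oblique_at L f p"
  then show "\<exists>J I \<gamma> a U \<psi>. unit_speed_curve J \<gamma> \<and> height_function I a \<and> p \<in> U \<and> U \<subseteq> M \<and>
      diffeomorphism_on (regular_points (J \<times> I) (lift_map \<gamma> a)) U \<psi> \<and>
      (\<forall>q\<in>regular_points (J \<times> I) (lift_map \<gamma> a). R (f (\<psi> q)) = Phi e0 e1 e2 (lift_map \<gamma> a q))"
    by (intro joachimsthal_local_parametrization[OF assms]) auto
qed

end
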